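(* Let $V=\{1,\dots,d\}$ with $d\in\{1,2,\dots\}$, and let $\Lambda_V^o$ be a Borel measure on $E_V^o=\mathbb{R}^V\setminus\{0_V\}$ such that $\Lambda_V^o(G)<\infty$ for every Borel set $G\subset\mathbb{R}^V$ with $0_V\notin\overline{G}$. Assume that $$\Lambda_V^o\left(\{y\in E_V^o:\ y_v\neq 0,\ y_{V\setminus D}=0_{V\setminus D}\}\right)\in\{0,\infty\}\qquad\text{for every } D\subset V \text{ and every } v\in D.$$ Let $\xi_V^o$ be a Poisson point process on $E_V^o$ with mean measure $\Lambda_V^o$, and for $I\subset V$ let $\xi_I$ be the point process on $\mathbb{R}^I$ given by $\xi_I(G)=\xi_V^o(\{y\in E_V^o: y_I\in G\})$, $G\in\mathcal{B}(\mathbb{R}^I)$. Let $A,B,C\subseteq V$ be disjoint. Then $\Lambda_V^o$ admits the conditional independence relation $A\perp B\mid C$ (in the sense defined in the context) if and only if $$\xi_A\perp\xi_B\mid\xi_C,$$ i.e. the random elements $\xi_A$ and $\xi_B$ are conditionally independent given $\xi_C$ in the classical probabilistic sense. Here, when $C=\emptyset$, the relation is understood as unconditional independence $\xi_A\perp\xi_B$, and when $A=\emptyset$ or $B=\emptyset$ the (conditional or unconditional) independence relation is understood to hold trivially.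
   Context: Notation: $\mathcal{B}(T)$ is the Borel $\sigma$-field of a topological space $T$, $\overline{G}$ is the closure of $G$ in $\mathbb{R}^V$, $0_I$ is the origin of $\mathbb{R}^I$, $y_I=(y_v)_{v\in I}$ for $I\subseteq V$, and $E_I^o=\mathbb{R}^I\setminus\{0_I\}$. A condition on $y_\emptyset$ such as $y_\emptyset=0_\emptyset$ is vacuous. Conditional independence for $\Lambda_V^o$. Let $$\mathcal{R}(\Lambda_V^o)=\Big\{R=\prod_{v\in V}R_v:\ R_v\in\mathcal{B}(\mathbb{R}),\ \Lambda_V^o(R)>0,\ 0_V\notin\overline{R}\Big\}.$$ If the disjoint sets $A,B,C$ form a partition of $V$ (empty sets allowed), $\Lambda_V^o$ is said to admit $A\perp B\mid C$ if for every $R\in\mathcal{R}(\Lambda_V^o)$ the classical conditional independence $Y_A\perp Y_B\mid Y_C$ holds, where $Y=(Y_v)_{v\in V}$ is an $R$-valued random vector with law $P_R(G)=\Lambda_V^o(G)/\Lambda_V^o(R)$, $G\in\mathcal{B}(\mathbb{R}^V)$, $G\subset R$. If $C=\emptyset$ the relation is understood as unconditional independence $Y_A\perp Y_B$. If $A=\emptyset$ or $B=\emptyset$ the relation is understood to hold trivially. If $A,B,C$ do not form a partition of $V$, the definition is applied with $V$ replaced by $D=A\cup B\cup C$ and $\Lambda_V^o$ replaced by the marginal measure $\Lambda_D^o(G)=\Lambda_V^o(\{y\in E_V^o: y_D\in G\})$ for Borel $G\subset E_D^o$. Point processes. An $s$-finite measure is a countable sum of finite measures. For a measurable space $(E,\mathcal{E})$,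 $\mathcal{N}(E)$ is the space of $s$-finite $\{0,1,\dots,\infty\}$-valued measures on $E$, with the smallest $\sigma$-field making all evaluations $\mu\mapsto\mu(G)$, $G\in\mathcal{E}$, measurable. A Poisson point process with $s$-finite mean measure $\Lambda$ on $E$ is a random element $\xi$ of $\mathcal{N}(E)$ such that $\xi(G)$ is Poisson with mean $\Lambda(G)$ for every $G\in\mathcal{E}$ (a.s. equal to $0$, resp. $\infty$, if $\Lambda(G)=0$, resp. $\infty$) and $\xi(G_1),\dots,\xi(G_m)$ are independent for disjoint $G_1,\dots,G_m\in\mathcal{E}$. Each $\xi_I$ is regarded as a random element of $\mathcal{N}(\mathbb{R}^I)$. *)

theory Defs
  imports "HOL-Probability.Probability"
begin

section \<open>The spaces \<open>\<real>\<^sup>I\<close> and \<open>E\<^sub>I\<^sup>o\<close>\<close>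

text \<open>Vectors indexed by \<open>I\<close> are functions that are \<open>undefined\<close> outside \<open>I\<close>, so that the
  projection \<open>y\<^sub>I\<close> of \<open>y\<close> is \<open>restrict y I\<close>. For \<open>I = {}\<close> there is exactly one vector.\<close>

definition Reuc :: "'v set \<Rightarrow> ('v \<Rightarrow> real) measure" where
  "Reuc I = PiM I (\<lambda>_. borel)"

abbreviation Rtop :: "'v set \<Rightarrow> ('v \<Rightarrow> real) topology" where
  "Rtop I \<equiv> product_topology (\<lambda>_. euclideanreal) I"

text \<open>The product \<open>\<sigma>\<close>-algebra used for \<open>Reuc\<close> is the Borel \<open>\<sigma>\<close>-algebra of \<open>\<real>\<^sup>I\<close>.\<close>

lemma sets_Reuc_eq_borel:
  assumes fin: "finite I"
  shows "sets (Reuc I) = sigma_sets (topspace (Rtop I)) {U. openin (Rtop I) U}"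
proof
  let ?N = "sigma (topspace (Rtop I)) {U. openin (Rtop I) U}"
  have sub: "{U. openin (Rtop I) U} \<subseteq> Pow (topspace (Rtop I))"
    using openin_subset by blast
  have setsN: "sets ?N = sigma_sets (topspace (Rtop I)) {U. openin (Rtop I) U}"
    using sub by (rule sets_measure_of)
  have spaceN: "space ?N = topspace (Rtop I)"
    using sub by (rule space_measure_of)
  have proj: "(\<lambda>x. x i) \<in> ?N \<rightarrow>\<^sub>M borel" if "i \<in> I" for i
  proof (rule borel_measurableI)
    fix S :: "real set" assume "open S"
    then have "openin (Rtop I) {x \<in> topspace (Rtop I). x i \<in> S}"
      by (intro openin_continuous_map_preimage[OF continuous_map_product_projection[OF that]])
        (simp flip: open_openin)
    moreover have "(\<lambda>x. x i) -` S \<inter> space ?N = {x \<in> topspace (Rtop I). x i \<in> S}"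
      unfolding spaceN by auto
    ultimately show "(\<lambda>x. x i) -` S \<inter> space ?N \<in> sets ?N"
      unfolding setsN by auto
  qed
  have "sets (PiM I (\<lambda>_. borel :: real measure)) \<subseteq> sets ?N"
  proof (rule sets_PiM_in_sets)
    show "space ?N = (\<Pi>\<^sub>E i\<in>I. space (borel :: real measure))"
      unfolding spaceN by simp
    fix i and A :: "real set" assume "i \<in> I" "A \<in> sets borel"
    then show "{x \<in> space ?N. x i \<in> A} \<in> sets ?N"
      using measurable_sets[OF proj, of i A] by (simp add: vimage_def Int_def conj_commute)
  qed
  then show "sets (Reuc I) \<subseteq> sigma_sets (topspace (Rtop I)) {U. openin (Rtop I) U}"
    unfolding setsN Reuc_def .
next
  obtain B :: "real set set" where B: "countable B" "topological_basis B"
    using ex_countable_basis by blast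
  have "U \<in> sets (Reuc I)" if U: "openin (Rtop I) U" for U
  proof -
    let ?F = "{f \<in> I \<rightarrow>\<^sub>E B. PiE I f \<subseteq> U}"
    have "countable ?F"
      by (rule countable_subset[of _ "I \<rightarrow>\<^sub>E B"]) (use fin B(1) in \<open>auto intro: countable_PiE\<close>)
    moreover have "PiE I f \<in> sets (Reuc I)" if "f \<in> ?F" for f
      unfolding Reuc_def using that fin
      by (intro sets_PiM_I_finite borel_open topological_basis_open[OF B(2)]) auto
    moreover have "U = (\<Union>f\<in>?F. PiE I f)"
    proof
      show "U \<subseteq> (\<Union>f\<in>?F. PiE I f)"
      proof
        fix x assume "x \<in> U"
        then obtain W where W: "\<And>i. i \<in> I \<Longrightarrow> open (W i)" "x \<in> PiE I W" "PiE I W \<subseteq> U"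
          using U unfolding openin_product_topology_alt open_openin[symmetric] by metis
        have "\<exists>b\<in>B. x i \<in> b \<and> b \<subseteq> W i" if "i \<in> I" for i
        proof -
          have "x i \<in> W i" using W(2) that by (rule PiE_mem)
          then show ?thesis
            using topological_basisE[OF B(2) W(1)[OF that]] by metis
        qed
        then obtain g where g: "\<And>i. i \<in> I \<Longrightarrow> g i \<in> B \<and> x i \<in> g i \<and> g i \<subseteq> W i"
          by metis
        have "PiE I (restrict g I) \<subseteq> PiE I W"
          using g by (intro PiE_mono) auto
        then have "restrict g I \<in> ?F"
          using g W(3) by auto
        moreover have "x \<in> PiE I (restrict g I)"
          using g W(2) by (auto simp: PiE_iff)
        ultimately show "x \<in> (\<Union>f\<in>?F. PiE I f)" by blast
      qed
    qed auto
    ultimately show ?thesis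
      using sets.countable_UN'[of ?F "PiE I" "Reuc I"] by (simp add: image_subset_iff)
  qed
  moreover have "topspace (Rtop I) = space (Reuc I)"
    by (simp add: Reuc_def space_PiM)
  ultimately show "sigma_sets (topspace (Rtop I)) {U. openin (Rtop I) U} \<subseteq> sets (Reuc I)"
    using sets.sigma_sets_subset[of "{U. openin (Rtop I) U}" "Reuc I"] by auto
qed

definition origin :: "'v set \<Rightarrow> 'v \<Rightarrow> real" where
  "origin I = (\<lambda>v\<in>I. 0)"

definition Epunct :: "'v set \<Rightarrow> ('v \<Rightarrow> real) measure" where
  "Epunct I = restrict_space (Reuc I) (space (Reuc I) - {origin I})"

lemma space_Epunct_in_sets:
  assumes "finite I"
  shows "space (Epunct I) \<in> sets (Reuc I)"
proof -
  have "{origin I} = PiE I (\<lambda>_. {0})"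
    using PiE_singleton[of "origin I" I] PiE_cong[of I "\<lambda>i. {origin I i}" "\<lambda>_. {0}"]
    by (simp add: origin_def)
  moreover have "PiE I (\<lambda>_. {0}) \<in> sets (Reuc I)"
    unfolding Reuc_def using assms by (intro sets_PiM_I_finite) auto
  ultimately show ?thesis
    by (simp add: Epunct_def space_restrict_space)
qed

lemma measurable_restrict_Epunct:
  assumes "sets \<mu> = sets (Epunct V)" "I \<subseteq> V"
  shows "(\<lambda>y. restrict y I) \<in> \<mu> \<rightarrow>\<^sub>M Reuc I"
proof -
  have "(\<lambda>y. restrict y I) \<in> Epunct V \<rightarrow>\<^sub>M Reuc I"
    unfolding Epunct_def Reuc_def
    by (intro measurable_restrict_space1 measurable_restrict_subset assms(2))
  then show ?thesis
    using measurable_cong_sets[OF assms(1) refl] by blast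
qed


section \<open>Conditional independence of random elements\<close>

text \<open>\<open>P(X \<in> F, Y \<in> G | \<sigma>(Z)) = P(X \<in> F | \<sigma>(Z)) P(Y \<in> G | \<sigma>(Z))\<close> almost surely, for all
  measurable \<open>F\<close> and \<open>G\<close>.\<close>

definition cond_indep_var ::
  "'w measure \<Rightarrow> 'a measure \<Rightarrow> ('w \<Rightarrow> 'a) \<Rightarrow> 'b measure \<Rightarrow> ('w \<Rightarrow> 'b)
    \<Rightarrow> 'c measure \<Rightarrow> ('w \<Rightarrow> 'c) \<Rightarrow> bool" where
  "cond_indep_var M N\<^sub>X X N\<^sub>Y Y N\<^sub>Z Z \<longleftrightarrow>
     X \<in> M \<rightarrow>\<^sub>M N\<^sub>X \<and> Y \<in> M \<rightarrow>\<^sub>M N\<^sub>Y \<and> Z \<in> M \<rightarrow>\<^sub>M N\<^sub>Z \<and>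
     (\<forall>F\<in>sets N\<^sub>X. \<forall>G\<in>sets N\<^sub>Y.
        let \<sigma>Z = vimage_algebra (space M) Z N\<^sub>Z in
        AE \<omega> in M.
          real_cond_exp M \<sigma>Z (indicator {w \<in> space M. X w \<in> F \<and> Y w \<in> G}) \<omega> =
          real_cond_exp M \<sigma>Z (indicator {w \<in> space M. X w \<in> F}) \<omega> *
          real_cond_exp M \<sigma>Z (indicator {w \<in> space M. Y w \<in> G}) \<omega>)"

text \<open>The relation between \<open>X A\<close>, \<open>X B\<close> and \<open>X C\<close> for a family \<open>X I\<close> of random elements of \<open>N I\<close>
  indexed by sets, with the conventions for empty \<open>A\<close>, \<open>B\<close>, \<open>C\<close>.\<close>

definition indep_given ::
  "'w measure \<Rightarrow> ('v set \<Rightarrow> 'a measure) \<Rightarrow> ('v set \<Rightarrow> 'w \<Rightarrow> 'a)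
    \<Rightarrow> 'v set \<Rightarrow> 'v set \<Rightarrow> 'v set \<Rightarrow> bool" where
  "indep_given M N X A B C \<longleftrightarrow>
     A = {} \<or> B = {} \<or>
     (if C = {} then prob_space.indep_var M (N A) (X A) (N B) (X B)
      else cond_indep_var M (N A) (X A) (N B) (X B) (N C) (X C))"


section \<open>Conditional independence for infinite measures\<close>

definition test_rectangles :: "'v set \<Rightarrow> ('v \<Rightarrow> real) measure \<Rightarrow> ('v \<Rightarrow> real) set set" where
  "test_rectangles V \<Lambda> =
     {R. (\<exists>Rv. R = PiE V Rv \<and> (\<forall>v\<in>V. Rv v \<in> sets borel)) \<and>
         emeasure \<Lambda> R > 0 \<and> origin V \<notin> Rtop V closure_of R}"

text \<open>The case of a partition of the index set. The vector \<open>Y\<close> is the identity on the probability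
  space \<open>uniform_measure \<Lambda> R\<close>, which is the law \<open>\<Lambda>(\<cdot> \<inter> R) / \<Lambda>(R)\<close>.\<close>

definition admits_partition ::
  "('v \<Rightarrow> real) measure \<Rightarrow> 'v set \<Rightarrow> 'v set \<Rightarrow> 'v set \<Rightarrow> bool" where
  "admits_partition \<Lambda> A B C \<longleftrightarrow>
     (\<forall>R\<in>test_rectangles (A \<union> B \<union> C) \<Lambda>.
        indep_given (uniform_measure \<Lambda> R) Reuc (\<lambda>I y. restrict y I) A B C)"

definition marginal :: "'v set \<Rightarrow> ('v \<Rightarrow> real) measure \<Rightarrow> ('v \<Rightarrow> real) measure" where
  "marginal D \<Lambda> = restrict_space (distr \<Lambda> (Reuc D) (\<lambda>y. restrict y D)) (space (Epunct D))"

lemma emeasure_marginal: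
  assumes "finite V" "sets \<Lambda> = sets (Epunct V)" "D \<subseteq> V" "G \<in> sets (Epunct D)"
  shows "emeasure (marginal D \<Lambda>) G = emeasure \<Lambda> {y \<in> space (Epunct V). restrict y D \<in> G}"
proof -
  have E: "space (Epunct D) \<in> sets (Reuc D)"
    using assms by (intro space_Epunct_in_sets) (rule finite_subset)
  then have "G \<in> sets (Reuc D)" "G \<subseteq> space (Epunct D)"
    using assms(4) sets.sets_into_space[OF assms(4)]
    by (auto simp: Epunct_def space_restrict_space sets_restrict_space_iff)
  then show ?thesis
    using E measurable_restrict_Epunct[OF assms(2,3)] sets_eq_imp_space_eq[OF assms(2)]
    by (simp add: marginal_def emeasure_restrict_space emeasure_distr vimage_def Int_def
        conj_commute sets.Int_space_eq2)
qed

definition admits ::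
  "'v set \<Rightarrow> ('v \<Rightarrow> real) measure \<Rightarrow> 'v set \<Rightarrow> 'v set \<Rightarrow> 'v set \<Rightarrow> bool" where
  "admits V \<Lambda> A B C \<longleftrightarrow>
     (if A \<union> B \<union> C = V then admits_partition \<Lambda> A B C
      else admits_partition (marginal (A \<union> B \<union> C) \<Lambda>) A B C)"


section \<open>Poisson point processes\<close>

definition s_finite :: "'a measure \<Rightarrow> bool" where
  "s_finite \<mu> \<longleftrightarrow>
     (\<exists>\<nu> :: nat \<Rightarrow> 'a measure.
        (\<forall>n. sets (\<nu> n) = sets \<mu> \<and> finite_measure (\<nu> n)) \<and>
        (\<forall>G\<in>sets \<mu>. emeasure \<mu> G = (\<Sum>n. emeasure (\<nu> n) G)))"

definition point_measures :: "'a measure \<Rightarrow> 'a measure set" where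
  "point_measures E =
     {\<mu>. sets \<mu> = sets E \<and> s_finite \<mu> \<and> (\<forall>G\<in>sets E. emeasure \<mu> G \<in> \<nat> \<union> {\<infinity>})}"

definition Npoint :: "'a measure \<Rightarrow> 'a measure measure" where
  "Npoint E = sigma (point_measures E)
     {{\<mu> \<in> point_measures E. emeasure \<mu> G \<in> S} | G S. G \<in> sets E \<and> S \<in> sets borel}"

text \<open>The mean \<open>0\<close> is treated separately because \<open>poisson_pmf\<close> is only specified for positive
  rates.\<close>

definition poisson_point_process ::
  "'w measure \<Rightarrow> 'a measure \<Rightarrow> 'a measure \<Rightarrow> ('w \<Rightarrow> 'a measure) \<Rightarrow> bool" where
  "poisson_point_process M E \<Lambda> \<xi> \<longleftrightarrow>
     sets \<Lambda> = sets E \<and> s_finite \<Lambda> \<and> \<xi> \<in> M \<rightarrow>\<^sub>M Npoint E \<and>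
     (\<forall>G\<in>sets E.
        (emeasure \<Lambda> G = 0 \<longrightarrow> (AE \<omega> in M. emeasure (\<xi> \<omega>) G = 0)) \<and>
        (emeasure \<Lambda> G = \<infinity> \<longrightarrow> (AE \<omega> in M. emeasure (\<xi> \<omega>) G = \<infinity>)) \<and>
        (0 < emeasure \<Lambda> G \<and> emeasure \<Lambda> G < \<infinity> \<longrightarrow>
          (\<forall>k::nat. measure M {\<omega> \<in> space M. emeasure (\<xi> \<omega>) G = of_nat k} =
                    pmf (poisson_pmf (measure \<Lambda> G)) k))) \<and>
     (\<forall>(m::nat) G. (\<forall>i\<in>{1..m}. G i \<in> sets E) \<and> disjoint_family_on G {1..m} \<longrightarrow>
        prob_space.indep_vars M (\<lambda>_. borel) (\<lambda>i \<omega>. emeasure (\<xi> \<omega>) (G i)) {1..m})"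

definition proj_process ::
  "('w \<Rightarrow> ('v \<Rightarrow> real) measure) \<Rightarrow> 'v set \<Rightarrow> 'w \<Rightarrow> ('v \<Rightarrow> real) measure" where
  "proj_process \<xi> I \<omega> = distr (\<xi> \<omega>) (Reuc I) (\<lambda>y. restrict y I)"

lemma emeasure_proj_process:
  assumes "\<xi> \<omega> \<in> point_measures (Epunct V)" "I \<subseteq> V" "G \<in> sets (Reuc I)"
  shows "emeasure (proj_process \<xi> I \<omega>) G = emeasure (\<xi> \<omega>) {y \<in> space (Epunct V). restrict y I \<in> G}"
proof -
  have "sets (\<xi> \<omega>) = sets (Epunct V)"
    using assms(1) by (simp add: point_measures_def)
  then show ?thesis
    using measurable_restrict_Epunct[of "\<xi> \<omega>" V I] sets_eq_imp_space_eq[of "\<xi> \<omega>" "Epunct V"] assms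
    by (simp add: proj_process_def emeasure_distr vimage_def Int_def conj_commute)
qed

end

theory Submission
  imports Defs
begin

text \<open>
  Write \<open>a\<close>, \<open>b\<close>, \<open>c\<close> for the projections \<open>y\<^sub>A\<close>, \<open>y\<^sub>B\<close>, \<open>y\<^sub>C\<close>. Conditional independence for
  \<open>\<Lambda>\<close> and for the projected Poisson processes are both equivalent to one property of \<open>\<Lambda>\<close>,
  called \<open>factorizes\<close> below, which has two parts. First, \<open>\<Lambda>(c = 0, a \<noteq> 0, b \<noteq> 0) = 0\<close>. Second, on
  \<open>c \<noteq> 0\<close>, where the image of \<open>\<Lambda>\<close> under \<open>c\<close> is \<open>\<sigma>\<close>-finite, the conditional law of \<open>(a, b)\<close> given \<open>c\<close>
  is a product. No regular conditional laws are constructed: for each function \<open>u\<close> of \<open>y\<close> only a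
  density \<open>p\<close> on \<open>\<real>\<^sup>C\<close> with \<open>\<integral> \<phi>(c) u d\<Lambda> = \<integral> \<phi>(c) p(c) d\<Lambda>\<close>, \<open>\<phi>(0) = 0\<close>, is used. It comes from the
  Radon-Nikodym theorem (\<open>relative_cond_version_exists\<close>).

  \<^emph>\<open>Test rectangles.\<close> For \<open>v \<in> C\<close> the rectangle \<open>\<bar>y\<^sub>v\<bar> > 1/n\<close> is an event of \<open>c\<close>, so conditional
  independence on it is the second part of the property restricted to that event, and countably many
  such events cover \<open>c \<noteq> 0\<close>. For the first part fix \<open>v \<in> A\<close>, \<open>w \<in> B\<close> and consider
  \<open>R\<^sub>\<epsilon> = {c = 0, \<bar>y\<^sub>v\<bar> > \<epsilon>}\<close>. As \<open>c\<close> is constant there, \<open>a\<close> and \<open>b\<close> are independent on \<open>R\<^sub>\<epsilon>\<close>, hence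
  \<open>\<Lambda>(R\<^sub>\<epsilon>) \<Lambda>(c = 0, \<bar>y\<^sub>v\<bar> > \<delta>, \<bar>y\<^sub>w\<bar> > \<delta>) \<le> \<Lambda>(\<bar>y\<^sub>v\<bar> > \<delta>) \<Lambda>(\<bar>y\<^sub>w\<bar> > \<delta>) < \<infinity>\<close> for \<open>\<epsilon> \<le> \<delta>\<close>. As \<open>\<epsilon> \<rightarrow> 0\<close>, the mass
  \<open>\<Lambda>(R\<^sub>\<epsilon>)\<close> tends to \<open>0\<close> or \<open>\<infinity>\<close> by explosiveness, and either limit forces the second factor to vanish.
  Conversely some coordinate \<open>y\<^sub>v\<close> has no zero on a given test rectangle. On the part \<open>c = 0\<close> of the
  rectangle (empty for \<open>v \<in> C\<close>) the first part of the property makes \<open>b\<close> (if \<open>v \<in> A\<close>) or \<open>a\<close> (if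
  \<open>v \<in> B\<close>) almost everywhere zero, and a constant is independent of everything. On \<open>c \<noteq> 0\<close> a product
  law restricted to a rectangle is again a product.

  \<^emph>\<open>Poisson processes.\<close> The Laplace functional \<open>E exp(-\<xi>(f)) = exp(-\<integral> (1 - e\<^sup>-\<^sup>f) d\<Lambda>)\<close> yields
  \<open>E[exp(-\<xi>(f)) | \<xi>\<^sub>C] = exp(-\<integral>\<^bsub>c=0\<^esub> (1 - e\<^sup>-\<^sup>f) d\<Lambda>) exp(-\<xi>\<^sub>C(g))\<close>, where \<open>g(0) = 0\<close> and off the origin
  \<open>1 - e\<^sup>-\<^sup>g\<close> is the conditional version of \<open>1 - e\<^sup>-\<^sup>f\<close> given \<open>c\<close> (\<open>cond_laplace\<close>). Conditional
  independence of \<open>\<xi>\<^sub>A\<close> and \<open>\<xi>\<^sub>B\<close> given \<open>\<xi>\<^sub>C\<close> can be tested on functionals \<open>exp(-\<xi>\<^sub>A(f))\<close> and \<open>exp(-\<xi>\<^sub>B(g))\<close>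
  (\<open>cond_indep_Npoint_iff\<close>), and comparing the conditional Laplace functionals of \<open>f(a)\<close>, \<open>g(b)\<close> and
  \<open>f(a) + g(b)\<close> gives exactly the two parts of the property. Explosiveness enters once more: the
  number of points of \<open>\<xi>\<^sub>I\<close> at the origin is almost surely \<open>0\<close> or almost surely \<open>\<infinity>\<close>, so it carries no
  information.

  For \<open>C = {}\<close> both conditioning \<open>\<sigma>\<close>-algebras are trivial, which turns conditional into plain
  independence (\<open>cond_indep_var_trivial\<close>). If \<open>A\<close>, \<open>B\<close>, \<open>C\<close> do not exhaust \<open>V\<close>, the marginal of \<open>\<Lambda>\<close> on
  \<open>D = A \<union> B \<union> C\<close> inherits all assumptions, and the property is the same for \<open>\<Lambda>\<close> and its marginal.
\<close>

section \<open>The Laplace functional of a Poisson process\<close>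

text \<open>The function \<open>exp(-x)\<close> extended by \<open>0\<close> to \<open>x = \<infinity>\<close>, so that \<open>exp(-\<xi>(f))\<close> makes sense when the
  integral diverges. It is continuous and injective on \<open>[0, \<infinity>]\<close>, which allows Laplace exponents to
  be compared without checking finiteness.\<close>

definition expn :: "ennreal \<Rightarrow> real" where
  "expn x = (if x = \<infinity> then 0 else exp (- enn2real x))"

lemma expn_measurable [measurable]: "expn \<in> borel_measurable borel"
  unfolding expn_def by measurable

lemma expn_nonneg [simp]: "0 \<le> expn x"
  and expn_le_1 [simp]: "expn x \<le> 1"
  and expn_0 [simp]: "expn 0 = 1"
  and expn_top [simp]: "expn \<top> = 0"
  and expn_infinity [simp]: "expn \<infinity> = 0"
  by (auto simp: expn_def)

lemma norm_expn_le_1 [simp]: "\<bar>expn x\<bar> \<le> 1"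
  by (simp add: abs_le_iff)

lemma expn_ennreal: "0 \<le> r \<Longrightarrow> expn (ennreal r) = exp (- r)"
  by (simp add: expn_def)

lemma expn_eq_0_iff [simp]: "expn x = 0 \<longleftrightarrow> x = \<infinity>"
  by (simp add: expn_def)

lemma expn_add: "expn (x + y) = expn x * expn y"
  by (cases x; cases y) (auto simp: expn_def simp flip: exp_add ennreal_plus)

lemma expn_sum: "expn (\<Sum>i\<in>I. f i) = (\<Prod>i\<in>I. expn (f i))"
  by (induction I rule: infinite_finite_induct) (auto simp: expn_add)

lemma expn_inj: "expn x = expn y \<Longrightarrow> x = y"
  by (cases x; cases y) (auto simp: expn_def split: if_splits)

lemma expn_antimono: "x \<le> y \<Longrightarrow> expn y \<le> expn x"
  by (cases x; cases y) (auto simp: expn_def top_unique split: if_splits)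

lemma expn_eq_1_iff [simp]: "expn x = 1 \<longleftrightarrow> x = 0"
  using expn_inj[of x 0] by auto

lemma expn_tendsto:
  assumes "(f \<longlongrightarrow> x) F"
  shows "((\<lambda>i. expn (f i)) \<longlongrightarrow> expn x) F"
proof (cases "x = \<infinity>")
  case False
  then have "\<forall>\<^sub>F i in F. f i < \<infinity>"
    using assms by (intro order_tendstoD(2)) (auto simp: less_top)
  then have "\<forall>\<^sub>F i in F. exp (- enn2real (f i)) = expn (f i)"
    by eventually_elim (auto simp: expn_def)
  moreover have "((\<lambda>i. exp (- enn2real (f i))) \<longlongrightarrow> exp (- enn2real x)) F"
    using assms False by (intro tendsto_intros tendsto_enn2real) (auto simp: ennreal_enn2real_if)
  ultimately show ?thesis
    using False by (simp add: expn_def[of x] tendsto_cong)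
next
  case True
  have "((\<lambda>i. expn (f i)) \<longlongrightarrow> 0) F"
  proof (rule order_tendstoI)
    fix a :: real assume "a < 0"
    then show "\<forall>\<^sub>F i in F. a < expn (f i)"
      by (simp add: less_le_trans[of a 0])
  next
    fix a :: real assume a: "0 < a"
    have "\<forall>\<^sub>F i in F. ennreal (max 0 (1 - ln a)) < f i"
      using assms True by (intro order_tendstoD(1)) auto
    then show "\<forall>\<^sub>F i in F. expn (f i) < a"
    proof eventually_elim
      case (elim i)
      then have "expn (f i) \<le> expn (ennreal (max 0 (1 - ln a)))"
        by (intro expn_antimono) auto
      also have "\<dots> = exp (- max 0 (1 - ln a))" by (rule expn_ennreal) simp
      also have "\<dots> \<le> exp (ln a - 1)" by simp
      also have "\<dots> < exp (ln a)" by (subst exp_less_cancel_iff) simp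
      also have "\<dots> = a" using a by simp
      finally show ?case .
    qed
  qed
  with True show ?thesis by simp
qed

text \<open>Splits a Laplace exponent into a part that depends on \<open>y\<close> only and a part that is linear in
  \<open>1 - exp(-x)\<close>; conditioning acts on the second one.\<close>

lemma ennreal_one_minus_expn_add:
  "ennreal (1 - expn (x + y)) = ennreal (1 - expn y) + ennreal (expn y) * ennreal (1 - expn x)"
proof -
  have "ennreal (1 - expn y) + ennreal (expn y) * ennreal (1 - expn x) = ennreal ((1 - expn y) + expn y * (1 - expn x))"
    by (subst ennreal_mult[symmetric], simp, simp, subst ennreal_plus[symmetric]) auto
  also have "(1 - expn y) + expn y * (1 - expn x) = 1 - expn (x + y)"
    by (simp add: expn_add algebra_simps)
  finally show ?thesis by simp
qed

text \<open>Written with sums instead of differences, so that it can be integrated in \<open>[0, \<infinity>]\<close>.\<close>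

lemma one_minus_expn_inclusion_exclusion:
  "ennreal (1 - expn (x + y)) + ennreal (1 - expn x) * ennreal (1 - expn y) =
    ennreal (1 - expn x) + ennreal (1 - expn y)"
proof -
  have "expn x * expn y \<le> 1" using mult_mono[of "expn x" 1 "expn y" 1] by simp
  then have "ennreal (1 - expn (x + y)) + ennreal (1 - expn x) * ennreal (1 - expn y) =
      ennreal ((1 - expn (x + y)) + (1 - expn x) * (1 - expn y))"
    by (subst ennreal_mult[symmetric], simp, simp, subst ennreal_plus) (auto simp: expn_add)
  also have "(1 - expn (x + y)) + (1 - expn x) * (1 - expn y) = (1 - expn x) + (1 - expn y)"
    by (simp add: expn_add algebra_simps)
  also have "ennreal ((1 - expn x) + (1 - expn y)) = ennreal (1 - expn x) + ennreal (1 - expn y)"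
    by (rule ennreal_plus) auto
  finally show ?thesis .
qed

text \<open>The inverse of \<open>expn\<close> on \<open>[0, 1]\<close>.\<close>

definition nlog :: "real \<Rightarrow> ennreal" where
  "nlog p = (if p \<le> 0 then \<infinity> else ennreal (- ln p))"

lemma nlog_measurable [measurable]: "nlog \<in> borel_measurable borel"
  unfolding nlog_def by measurable

lemma expn_nlog [simp]: "0 \<le> p \<Longrightarrow> p \<le> 1 \<Longrightarrow> expn (nlog p) = p"
  by (auto simp: nlog_def expn_ennreal)

lemma nlog_1 [simp]: "nlog 1 = 0"
  by (simp add: nlog_def)

text \<open>In the case of a finite positive mean the claim is \<open>\<Sum>\<^sub>k e\<^sup>-\<^sup>l l\<^sup>k/k! e\<^sup>-\<^sup>x\<^sup>k = exp(-l (1 - e\<^sup>-\<^sup>x))\<close>. A finite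
  \<open>x\<close> suffices below, because \<open>f\<close> is approximated from below by finite simple functions.\<close>

lemma expn_poisson_count:
  fixes N :: "'w \<Rightarrow> ennreal" and l x :: ennreal
  assumes "prob_space M" and N [measurable]: "N \<in> borel_measurable M"
    and zero: "l = 0 \<Longrightarrow> AE \<omega> in M. N \<omega> = 0"
    and infinite: "l = \<infinity> \<Longrightarrow> AE \<omega> in M. N \<omega> = \<infinity>"
    and finite: "\<And>k::nat. 0 < l \<Longrightarrow> l < \<infinity> \<Longrightarrow>
      measure M {\<omega> \<in> space M. N \<omega> = of_nat k} = pmf (poisson_pmf (enn2real l)) k"
    and x: "x < \<infinity>"
  shows "(\<integral>\<omega>. expn (x * N \<omega>) \<partial>M) = expn (l * ennreal (1 - expn x))"
proof -
  interpret prob_space M by fact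
  consider "l = 0" | "l = \<infinity>" | "0 < l" "l < \<infinity>"
    by (metis infinity_ennreal_def less_top not_gr_zero)
  then show ?thesis
  proof cases
    case 1
    then have "(\<integral>\<omega>. expn (x * N \<omega>) \<partial>M) = (\<integral>\<omega>. 1 \<partial>M)"
      using zero by (intro integral_cong_AE) auto
    then show ?thesis using 1 by (simp add: prob_space)
  next
    case 2
    then have "(\<integral>\<omega>. expn (x * N \<omega>) \<partial>M) = (\<integral>\<omega>. expn (x * \<infinity>) \<partial>M)"
      using infinite by (intro integral_cong_AE) auto
    also have "\<dots> = expn (x * \<infinity>)" by (simp add: prob_space)
    also have "\<dots> = expn (l * ennreal (1 - expn x))"
    proof (cases "x = 0")
      case False
      then have "expn x < 1" using expn_le_1[of x] expn_eq_1_iff[of x] by linarith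
      then show ?thesis using 2 False by (simp add: ennreal_mult_top ennreal_top_mult)
    qed simp
    finally show ?thesis .
  next
    case 3
    define r where "r = enn2real l"
    have r: "0 < r" "l = ennreal r"
      using 3 by (auto simp: r_def enn2real_positive_iff)
    define s where "s = enn2real x"
    have s: "0 \<le> s" "x = ennreal s" using x by (auto simp: s_def)
    \<comment> \<open>the count as a natural number; \<open>N\<close> is almost surely finite since the Poisson weights sum to 1\<close>
    define K where "K \<omega> = nat \<lfloor>enn2real (N \<omega>)\<rfloor>" for \<omega>
    have K [measurable]: "K \<in> M \<rightarrow>\<^sub>M count_space UNIV"
      unfolding K_def by measurable
    have KN: "K \<omega> = k" if "N \<omega> = of_nat k" for \<omega> k
      using that by (simp add: K_def enn2real_of_nat)
    define A where "A k = {\<omega> \<in> space M. N \<omega> = of_nat k}" for k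
    have [measurable]: "A k \<in> sets M" for k unfolding A_def by measurable
    have pA: "prob (A k) = pmf (poisson_pmf r) k" for k
      using finite[OF 3] by (simp add: A_def r_def)
    have "disjoint_family A" by (auto simp: disjoint_family_on_def A_def)
    then have "(\<lambda>k. prob (A k)) sums prob (\<Union>k. A k)"
      by (intro finite_measure_UNION) auto
    moreover have "(\<lambda>k. prob (A k)) sums 1"
    proof -
      have "(\<lambda>k. r ^ k /\<^sub>R fact k * exp (- r)) sums (exp r * exp (- r))"
        by (rule sums_mult2[OF exp_converges])
      moreover have "r ^ k /\<^sub>R fact k * exp (- r) = prob (A k)" for k
        using r(1) by (simp add: pA divide_inverse)
      ultimately show ?thesis by (simp add: exp_minus)
    qed
    ultimately have "prob (\<Union>k. A k) = 1" by (simp add: sums_iff)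
    then have "AE \<omega> in M. \<omega> \<in> (\<Union>k. A k)"
      by (subst AE_in_set_eq_1) auto
    then have AE: "AE \<omega> in M. N \<omega> = of_nat (K \<omega>)"
      by (rule AE_mp) (auto simp: A_def KN)
    have "measure_pmf (poisson_pmf r) = distr M (count_space UNIV) K"
    proof (rule measure_eqI_countable[where A=UNIV])
      fix k :: nat
      have "emeasure (distr M (count_space UNIV) K) {k} = ennreal (prob {\<omega> \<in> space M. K \<omega> = k})"
      proof -
        have "emeasure (distr M (count_space UNIV) K) {k} = emeasure M (K -` {k} \<inter> space M)"
          by (rule emeasure_distr) simp_all
        also have "K -` {k} \<inter> space M = {\<omega> \<in> space M. K \<omega> = k}" by auto
        finally show ?thesis using emeasure_eq_measure by (rule trans)
      qed
      also have "prob {\<omega> \<in> space M. K \<omega> = k} = prob (A k)"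
      proof (rule finite_measure_eq_AE)
        show "AE \<omega> in M. (\<omega> \<in> {\<omega> \<in> space M. K \<omega> = k}) = (\<omega> \<in> A k)"
          using AE by eventually_elim (auto simp: A_def)
      qed measurable
      finally show "emeasure (measure_pmf (poisson_pmf r)) {k} = emeasure (distr M (count_space UNIV) K) {k}"
        by (simp add: pA emeasure_pmf_single)
    qed auto
    note distr = this
    have "(\<integral>\<omega>. expn (x * N \<omega>) \<partial>M) = (\<integral>\<omega>. exp (- s * real (K \<omega>)) \<partial>M)"
    proof (rule integral_cong_AE)
      show "AE \<omega> in M. expn (x * N \<omega>) = exp (- s * real (K \<omega>))"
        using AE
      proof eventually_elim
        case (elim \<omega>)
        have "x * of_nat (K \<omega>) = ennreal (s * real (K \<omega>))"
          using s by (simp add: ennreal_mult ennreal_of_nat_eq_real_of_nat)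
        then show ?case
          using s(1) by (subst elim) (simp add: expn_ennreal)
      qed
    qed measurable
    also have "\<dots> = (\<integral>k. exp (- s * real k) \<partial>measure_pmf (poisson_pmf r))"
      unfolding distr by (subst integral_distr) auto
    also have "\<dots> = (\<integral>k. pmf (poisson_pmf r) k * exp (- s * real k) \<partial>count_space UNIV)"
      unfolding measure_pmf_eq_density by (subst integral_density) auto
    also have "\<dots> = (\<Sum>k. pmf (poisson_pmf r) k * exp (- s * real k))"
    proof (rule sums_unique[OF sums_integral_count_space_nat])
      have "integrable (measure_pmf (poisson_pmf r)) (\<lambda>k. exp (- s * real k))"
        by (rule measure_pmf.integrable_const_bound[where B=1]) (auto simp: s)
      then show "integrable (count_space UNIV) (\<lambda>k. pmf (poisson_pmf r) k * exp (- s * real k))"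
        unfolding measure_pmf_eq_density by (subst (asm) integrable_density) auto
    qed
    also have "(\<lambda>k. pmf (poisson_pmf r) k * exp (- s * real k)) =
        (\<lambda>k. exp (- r) * ((r * exp (- s)) ^ k / fact k))"
    proof
      fix k :: nat
      have "exp (- s * real k) = exp (- s) ^ k"
        using exp_of_nat_mult[of k "- s"] by (simp add: mult.commute)
      then show "pmf (poisson_pmf r) k * exp (- s * real k) =
          exp (- r) * ((r * exp (- s)) ^ k / fact k)"
        using r(1) by (simp add: power_mult_distrib)
    qed
    also have "(\<Sum>k. exp (- r) * ((r * exp (- s)) ^ k / fact k)) = exp (- r) * exp (r * exp (- s))"
    proof (rule sums_unique[symmetric])
      have "(\<lambda>k. exp (- r) * ((r * exp (- s)) ^ k /\<^sub>R fact k)) sums (exp (- r) * exp (r * exp (- s)))"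
        by (rule sums_mult[OF exp_converges])
      moreover have "(r * exp (- s)) ^ k /\<^sub>R fact k = (r * exp (- s)) ^ k / fact k" for k
        by (simp only: real_scaleR_def divide_inverse mult.commute)
      ultimately show "(\<lambda>k. exp (- r) * ((r * exp (- s)) ^ k / fact k)) sums (exp (- r) * exp (r * exp (- s)))"
        by (simp only:)
    qed
    also have "\<dots> = expn (l * ennreal (1 - expn x))"
    proof -
      have "l * ennreal (1 - expn x) = ennreal (r * (1 - exp (- s)))"
        using s r(1) by (simp add: r(2) expn_ennreal ennreal_mult'')
      then have "expn (l * ennreal (1 - expn x)) = exp (- (r * (1 - exp (- s))))"
        using s r(1) by (simp add: expn_ennreal)
      moreover have "- (r * (1 - exp (- s))) = - r + r * exp (- s)"
        by (simp add: algebra_simps)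
      ultimately show ?thesis by (simp only: exp_add)
    qed
    finally show ?thesis .
  qed
qed

lemma space_Npoint [simp]: "space (Npoint E) = point_measures E"
  unfolding Npoint_def by (rule space_measure_of) auto

lemma sets_Npoint: "sets (Npoint E) = sigma_sets (point_measures E)
    {{\<mu> \<in> point_measures E. emeasure \<mu> G \<in> S} | G S. G \<in> sets E \<and> S \<in> sets borel}"
  unfolding Npoint_def by (rule sets_measure_of) auto

lemma sets_point_measure: "\<mu> \<in> point_measures E \<Longrightarrow> sets \<mu> = sets E"
  by (simp add: point_measures_def)

lemma space_point_measure: "\<mu> \<in> point_measures E \<Longrightarrow> space \<mu> = space E"
  using sets_eq_imp_space_eq[OF sets_point_measure] by blast

lemma measurable_emeasure_Npoint:
  assumes "G \<in> sets E"
  shows "(\<lambda>\<mu>. emeasure \<mu> G) \<in> borel_measurable (Npoint E)"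
proof (rule measurableI)
  fix S :: "ennreal set" assume "S \<in> sets borel"
  moreover have "(\<lambda>\<mu>. emeasure \<mu> G) -` S \<inter> space (Npoint E) = {\<mu> \<in> point_measures E. emeasure \<mu> G \<in> S}"
    by auto
  ultimately show "(\<lambda>\<mu>. emeasure \<mu> G) -` S \<inter> space (Npoint E) \<in> sets (Npoint E)"
    unfolding sets_Npoint using assms by (auto intro!: sigma_sets.Basic)
qed simp

lemma measurable_NpointI:
  assumes "\<And>\<omega>. \<omega> \<in> space M \<Longrightarrow> \<zeta> \<omega> \<in> point_measures E"
    and "\<And>G. G \<in> sets E \<Longrightarrow> (\<lambda>\<omega>. emeasure (\<zeta> \<omega>) G) \<in> borel_measurable M"
  shows "\<zeta> \<in> M \<rightarrow>\<^sub>M Npoint E"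
  unfolding Npoint_def
proof (rule measurable_measure_of)
  show "\<zeta> \<in> space M \<rightarrow> point_measures E" using assms(1) by auto
  fix Y assume "Y \<in> {{\<mu> \<in> point_measures E. emeasure \<mu> G \<in> S} |G S. G \<in> sets E \<and> S \<in> sets borel}"
  then obtain G S where Y: "Y = {\<mu> \<in> point_measures E. emeasure \<mu> G \<in> S}" "G \<in> sets E" "S \<in> sets borel"
    by auto
  then have "\<zeta> -` Y \<inter> space M = (\<lambda>\<omega>. emeasure (\<zeta> \<omega>) G) -` S \<inter> space M"
    using assms(1) by auto
  then show "\<zeta> -` Y \<inter> space M \<in> sets M"
    using measurable_sets[OF assms(2)[OF Y(2)] Y(3)] by simp
qed auto

text \<open>The evaluations at sets generate the \<open>\<sigma>\<close>-algebra, and integrals are monotone limits of linear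
  combinations of evaluations.\<close>

lemma measurable_nn_integral_Npoint:
  assumes "f \<in> borel_measurable E"
  shows "(\<lambda>\<mu>. \<integral>\<^sup>+y. f y \<partial>\<mu>) \<in> borel_measurable (Npoint E)"
  using assms
proof (induction rule: borel_measurable_induct)
  case (cong f g)
  have "(\<integral>\<^sup>+y. f y \<partial>\<mu>) = (\<integral>\<^sup>+y. g y \<partial>\<mu>)" if "\<mu> \<in> space (Npoint E)" for \<mu>
    using that cong(3) by (intro nn_integral_cong) (simp add: space_point_measure)
  then show ?case by (rule measurable_cong[THEN iffD2, OF _ cong(4)])
next
  case (set A)
  have "(\<integral>\<^sup>+y. indicator A y \<partial>\<mu>) = emeasure \<mu> A" if "\<mu> \<in> space (Npoint E)" for \<mu>
    using that set by (intro nn_integral_indicator) (simp add: sets_point_measure)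
  then show ?case by (rule measurable_cong[THEN iffD2, OF _ measurable_emeasure_Npoint[OF set]])
next
  case (mult u c)
  have [measurable]: "(\<lambda>\<mu>. integral\<^sup>N \<mu> u) \<in> borel_measurable (Npoint E)"
    by (rule mult.IH)
  have "(\<integral>\<^sup>+y. c * u y \<partial>\<mu>) = c * (\<integral>\<^sup>+y. u y \<partial>\<mu>)" if "\<mu> \<in> space (Npoint E)" for \<mu>
    using that mult(2) by (intro nn_integral_cmult) (simp add: measurable_cong_sets[OF sets_point_measure refl])
  then show ?case by (rule measurable_cong[THEN iffD2]) measurable
next
  case (add u v)
  have [measurable]: "(\<lambda>\<mu>. integral\<^sup>N \<mu> u) \<in> borel_measurable (Npoint E)"
    "(\<lambda>\<mu>. integral\<^sup>N \<mu> v) \<in> borel_measurable (Npoint E)"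
    by (rule add.IH)+
  have "(\<integral>\<^sup>+y. v y + u y \<partial>\<mu>) = (\<integral>\<^sup>+y. v y \<partial>\<mu>) + (\<integral>\<^sup>+y. u y \<partial>\<mu>)" if "\<mu> \<in> space (Npoint E)" for \<mu>
    using that add by (intro nn_integral_add) (simp_all add: measurable_cong_sets[OF sets_point_measure refl])
  then show ?case by (rule measurable_cong[THEN iffD2]) measurable
next
  case (seq U)
  have [measurable]: "(\<lambda>\<mu>. integral\<^sup>N \<mu> (U i)) \<in> borel_measurable (Npoint E)" for i
    by (rule seq.IH)
  have "(\<integral>\<^sup>+y. (SUP i. U i) y \<partial>\<mu>) = (SUP i. \<integral>\<^sup>+y. U i y \<partial>\<mu>)" if "\<mu> \<in> space (Npoint E)" for \<mu>
    unfolding SUP_apply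
    using that seq by (intro nn_integral_monotone_convergence_SUP)
      (simp_all add: measurable_cong_sets[OF sets_point_measure refl])
  then show ?case by (rule measurable_cong[THEN iffD2]) measurable
qed

lemma measurable_nn_integral_process:
  assumes "\<zeta> \<in> M \<rightarrow>\<^sub>M Npoint E" "f \<in> borel_measurable E"
  shows "(\<lambda>\<omega>. \<integral>\<^sup>+y. f y \<partial>\<zeta> \<omega>) \<in> borel_measurable M"
  using measurable_compose[OF assms(1) measurable_nn_integral_Npoint[OF assms(2)]] by simp

text \<open>For a simple function the integral is \<open>\<Sum>\<^sub>i h\<^sub>i \<xi>(G\<^sub>i)\<close> with disjoint \<open>G\<^sub>i\<close>, so the expectation is a product
  of Laplace transforms of independent Poisson counts.\<close>

lemma laplace_functional_simple:
  assumes "prob_space M" and ppp: "poisson_point_process M E \<Lambda> \<xi>"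
    and f: "simple_function E f" "\<And>x. f x < \<infinity>"
  shows "(\<integral>\<omega>. expn (\<integral>\<^sup>+y. f y \<partial>\<xi> \<omega>) \<partial>M) = expn (\<integral>\<^sup>+y. ennreal (1 - expn (f y)) \<partial>\<Lambda>)"
proof -
  interpret prob_space M by fact
  have sets\<Lambda>: "sets \<Lambda> = sets E" and \<xi> [measurable]: "\<xi> \<in> M \<rightarrow>\<^sub>M Npoint E"
    using ppp by (auto simp: poisson_point_process_def)
  have space\<Lambda>: "space \<Lambda> = space E" using sets\<Lambda> by (rule sets_eq_imp_space_eq)
  \<comment> \<open>the values of \<open>f\<close> are numbered from 1, to match the indexing in the definition of a Poisson process\<close>
  obtain h where h: "bij_betw h {1..card (f ` space E)} (f ` space E)"
    using ex_bij_betw_nat_finite_1[OF simple_functionD(1)[OF f(1)]] by auto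
  define m where "m = card (f ` space E)"
  define G where "G i = f -` {h i} \<inter> space E" for i
  have inj: "inj_on h {1..m}" and img: "h ` {1..m} = f ` space E"
    using h by (auto simp: bij_betw_def m_def)
  have G: "G i \<in> sets E" for i
    unfolding G_def by (rule simple_functionD(2)[OF f(1)])
  have disj: "disjoint_family_on G {1..m}"
    unfolding disjoint_family_on_def
  proof (intro ballI impI)
    fix i j assume ij: "i \<in> {1..m}" "j \<in> {1..m}" "i \<noteq> j"
    then have "h i \<noteq> h j" using inj by (meson inj_onD)
    then show "G i \<inter> G j = {}" by (auto simp: G_def)
  qed
  have hfin: "h i < \<infinity>" if "i \<in> {1..m}" for i
  proof -
    have "h i \<in> f ` space E" unfolding img[symmetric] using that by (rule imageI)
    then show ?thesis using f(2) by auto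
  qed
  have repr: "(\<integral>\<^sup>+y. g (f y) \<partial>\<mu>) = (\<Sum>i\<in>{1..m}. g (h i) * emeasure \<mu> (G i))"
    if s: "sets \<mu> = sets E" for \<mu> and g :: "ennreal \<Rightarrow> ennreal"
  proof -
    have sp: "space \<mu> = space E" using s by (rule sets_eq_imp_space_eq)
    have "g (f y) = (\<Sum>i\<in>{1..m}. g (h i) * indicator (G i) y)" if "y \<in> space \<mu>" for y
    proof -
      have "y \<in> space E" using that by (simp only: sp)
      then have "f y \<in> h ` {1..m}" unfolding img by (rule imageI)
      then obtain j where j: "j \<in> {1..m}" "f y = h j" by blast
      have "g (h i) * indicator (G i) y = (if i = j then g (f y) else 0)" if "i \<in> {1..m}" for i
      proof (cases "i = j")
        case True
        have "y \<in> G j" using j(2) \<open>y \<in> space \<mu>\<close> sp by (simp add: G_def)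
        then show ?thesis using True j(2) by simp
      next
        case False
        then have "h i \<noteq> h j" using inj that j(1) by (meson inj_onD)
        then have "y \<notin> G i" using j(2) by (simp add: G_def)
        then show ?thesis using False by simp
      qed
      then show ?thesis using j(1) by simp
    qed
    then have "(\<integral>\<^sup>+y. g (f y) \<partial>\<mu>) = (\<integral>\<^sup>+y. (\<Sum>i\<in>{1..m}. g (h i) * indicator (G i) y) \<partial>\<mu>)"
      by (rule nn_integral_cong)
    also have "\<dots> = (\<Sum>i\<in>{1..m}. \<integral>\<^sup>+y. g (h i) * indicator (G i) y \<partial>\<mu>)"
      using G s by (intro nn_integral_sum) (auto intro!: borel_measurable_times borel_measurable_indicator)
    also have "\<dots> = (\<Sum>i\<in>{1..m}. g (h i) * emeasure \<mu> (G i))"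
      using G s by (intro sum.cong refl nn_integral_cmult_indicator) simp
    finally show ?thesis .
  qed
  have ind: "indep_vars (\<lambda>_. borel) (\<lambda>i \<omega>. emeasure (\<xi> \<omega>) (G i)) {1..m}"
    using ppp G disj by (auto simp: poisson_point_process_def)
  have meas: "(\<lambda>\<omega>. emeasure (\<xi> \<omega>) (G i)) \<in> borel_measurable M" for i
    using measurable_compose[OF \<xi> measurable_emeasure_Npoint[OF G]] by simp
  have "(\<integral>\<omega>. expn (\<integral>\<^sup>+y. f y \<partial>\<xi> \<omega>) \<partial>M) = (\<integral>\<omega>. (\<Prod>i\<in>{1..m}. expn (h i * emeasure (\<xi> \<omega>) (G i))) \<partial>M)"
  proof (intro Bochner_Integration.integral_cong refl)
    fix \<omega> assume "\<omega> \<in> space M"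
    then have "sets (\<xi> \<omega>) = sets E"
      using measurable_space[OF \<xi>] by (simp add: sets_point_measure)
    from repr[OF this, of "\<lambda>x. x"] show "expn (\<integral>\<^sup>+y. f y \<partial>\<xi> \<omega>) = (\<Prod>i\<in>{1..m}. expn (h i * emeasure (\<xi> \<omega>) (G i)))"
      by (simp add: expn_sum)
  qed
  also have "\<dots> = (\<Prod>i\<in>{1..m}. \<integral>\<omega>. expn (h i * emeasure (\<xi> \<omega>) (G i)) \<partial>M)"
  proof (rule indep_vars_lebesgue_integral)
    show "indep_vars (\<lambda>_. borel) (\<lambda>i \<omega>. expn (h i * emeasure (\<xi> \<omega>) (G i))) {1..m}"
      by (rule indep_vars_compose2[OF ind]) measurable
    show "integrable M (\<lambda>\<omega>. expn (h i * emeasure (\<xi> \<omega>) (G i)))" for i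
      using meas[of i] by (intro integrable_const_bound[where B=1]) auto
  qed simp
  also have "\<dots> = (\<Prod>i\<in>{1..m}. expn (emeasure \<Lambda> (G i) * ennreal (1 - expn (h i))))"
  proof (intro prod.cong refl expn_poisson_count[OF \<open>prob_space M\<close> meas _ _ _ hfin])
    fix i
    show "AE \<omega> in M. emeasure (\<xi> \<omega>) (G i) = 0" if "emeasure \<Lambda> (G i) = 0"
      using that ppp G by (auto simp: poisson_point_process_def)
    show "AE \<omega> in M. emeasure (\<xi> \<omega>) (G i) = \<infinity>" if "emeasure \<Lambda> (G i) = \<infinity>"
      using that ppp G by (auto simp: poisson_point_process_def)
    show "prob {\<omega> \<in> space M. emeasure (\<xi> \<omega>) (G i) = of_nat k} = pmf (poisson_pmf (enn2real (emeasure \<Lambda> (G i)))) k"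
      if "0 < emeasure \<Lambda> (G i)" "emeasure \<Lambda> (G i) < \<infinity>" for k :: nat
      using that ppp G by (auto simp: poisson_point_process_def measure_def)
  qed
  also have "\<dots> = expn (\<Sum>i\<in>{1..m}. ennreal (1 - expn (h i)) * emeasure \<Lambda> (G i))"
    by (simp add: expn_sum mult.commute)
  also have "\<dots> = expn (\<integral>\<^sup>+y. ennreal (1 - expn (f y)) \<partial>\<Lambda>)"
    by (simp add: repr[OF sets\<Lambda>, of "\<lambda>x. ennreal (1 - expn x)"])
  finally show ?thesis .
qed

text \<open>Both sides are continuous along an increasing sequence of simple functions: the left one by
  dominated convergence, the right one by monotone convergence.\<close>

lemma laplace_functional:
  assumes "prob_space M" and ppp: "poisson_point_process M E \<Lambda> \<xi>"
    and f: "f \<in> borel_measurable E"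
  shows "(\<integral>\<omega>. expn (\<integral>\<^sup>+y. f y \<partial>\<xi> \<omega>) \<partial>M) = expn (\<integral>\<^sup>+y. ennreal (1 - expn (f y)) \<partial>\<Lambda>)"
proof -
  interpret prob_space M by fact
  have sets\<Lambda>: "sets \<Lambda> = sets E" and \<xi> [measurable]: "\<xi> \<in> M \<rightarrow>\<^sub>M Npoint E"
    using ppp by (auto simp: poisson_point_process_def)
  obtain u where u: "\<And>i. simple_function E (u i)" "incseq u" "\<And>i x. u i x < top" "\<And>x. (SUP i. u i x) = f x"
    using borel_measurable_implies_simple_function_sequence'[OF f] by blast
  have um: "u i \<in> borel_measurable E" for i
    using u(1) by (rule borel_measurable_simple_function)
  have inc: "incseq (\<lambda>i. u i x)" for x
    using u(2) by (auto simp: incseq_def le_fun_def)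
  have conv: "(\<lambda>i. \<integral>\<^sup>+y. u i y \<partial>\<mu>) \<longlonglongrightarrow> (\<integral>\<^sup>+y. f y \<partial>\<mu>)" if "sets \<mu> = sets E" for \<mu>
  proof -
    have "(\<integral>\<^sup>+y. f y \<partial>\<mu>) = (SUP i. \<integral>\<^sup>+y. u i y \<partial>\<mu>)"
      unfolding u(4)[symmetric] using u(2) um that
      by (intro nn_integral_monotone_convergence_SUP) (simp_all add: measurable_cong_sets[OF that refl])
    moreover have "incseq (\<lambda>i. \<integral>\<^sup>+y. u i y \<partial>\<mu>)"
      using u(2) by (auto simp: incseq_def le_fun_def intro!: nn_integral_mono)
    ultimately show ?thesis by (simp add: LIMSEQ_SUP)
  qed
  have "(\<lambda>i. \<integral>\<omega>. expn (\<integral>\<^sup>+y. u i y \<partial>\<xi> \<omega>) \<partial>M) \<longlonglongrightarrow> (\<integral>\<omega>. expn (\<integral>\<^sup>+y. f y \<partial>\<xi> \<omega>) \<partial>M)"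
  proof (rule integral_dominated_convergence[where w="\<lambda>_. 1"])
    show "AE \<omega> in M. (\<lambda>i. expn (\<integral>\<^sup>+y. u i y \<partial>\<xi> \<omega>)) \<longlonglongrightarrow> expn (\<integral>\<^sup>+y. f y \<partial>\<xi> \<omega>)"
      using measurable_space[OF \<xi>]
      by (intro AE_I2 expn_tendsto conv) (auto simp: sets_point_measure)
  qed (use measurable_nn_integral_process[OF \<xi> f] measurable_nn_integral_process[OF \<xi> um] in auto)
  moreover have "(\<lambda>i. expn (\<integral>\<^sup>+y. ennreal (1 - expn (u i y)) \<partial>\<Lambda>)) \<longlonglongrightarrow>
      expn (\<integral>\<^sup>+y. ennreal (1 - expn (f y)) \<partial>\<Lambda>)"
  proof (rule expn_tendsto, rule nn_integral_LIMSEQ)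
    show "incseq (\<lambda>i y. ennreal (1 - expn (u i y)))"
      using inc by (auto simp: incseq_def le_fun_def intro!: ennreal_leI expn_antimono)
    show "(\<lambda>y. ennreal (1 - expn (u i y))) \<in> borel_measurable \<Lambda>" for i
      using um[of i] by (simp add: measurable_cong_sets[OF sets\<Lambda> refl])
    show "(\<lambda>i. ennreal (1 - expn (u i y))) \<longlonglongrightarrow> ennreal (1 - expn (f y))" for y
      using LIMSEQ_SUP[OF inc, of y] u(4)[of y] by (intro tendsto_intros expn_tendsto) simp
  qed
  moreover have "(\<integral>\<omega>. expn (\<integral>\<^sup>+y. u i y \<partial>\<xi> \<omega>) \<partial>M) = expn (\<integral>\<^sup>+y. ennreal (1 - expn (u i y)) \<partial>\<Lambda>)" for i
    using u(1,3) by (intro laplace_functional_simple[OF \<open>prob_space M\<close> ppp]) auto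
  ultimately show ?thesis using LIMSEQ_unique by auto
qed

section \<open>Laplace functionals determine conditional independence\<close>

text \<open>The event \<open>\<zeta>(G) = k\<close> is reached from Laplace functionals by limits: with
  \<open>N = \<zeta>(G)\<close>, the functions \<open>e\<^sup>k\<^sup>n e\<^sup>-\<^sup>n\<^sup>N (1 - \<Sum>\<^bsub>j<k\<^esub> 1\<^bsub>N=j\<^esub>)\<close> are bounded by \<open>1\<close> and tend to
  \<open>1\<^bsub>N=k\<^esub>\<close> as \<open>n \<rightarrow> \<infinity>\<close>. They are built from Laplace functionals and from indicators of smaller counts, which
  are treated by induction on \<open>k\<close>. Keeping a factor \<open>exp(-\<zeta>(f))\<close> with arbitrary \<open>f\<close> makes the statement
  reusable for several sets \<open>G\<close> in turn.\<close>

lemma integral_expn_of_nat_eq_0: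
  assumes "prob_space M" and \<zeta>: "\<zeta> \<in> M \<rightarrow>\<^sub>M Npoint E"
    and T: "integrable M (T :: _ \<Rightarrow> real)" and G: "G \<in> sets E"
    and zero: "\<And>f. f \<in> borel_measurable E \<Longrightarrow> (\<integral>\<omega>. T \<omega> * expn (\<integral>\<^sup>+y. f y \<partial>\<zeta> \<omega>) \<partial>M) = 0"
    and f: "f \<in> borel_measurable E"
  shows "(\<integral>\<omega>. T \<omega> * indicator {\<omega>. emeasure (\<zeta> \<omega>) G = of_nat k} \<omega> * expn (\<integral>\<^sup>+y. f y \<partial>\<zeta> \<omega>) \<partial>M) = 0"
  using f
proof (induction k arbitrary: f rule: less_induct)
  case (less k)
  interpret prob_space M by fact
  define N where "N \<omega> = emeasure (\<zeta> \<omega>) G" for \<omega>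
  define I where "I j \<omega> = (indicator {\<omega>. N \<omega> = of_nat j} \<omega> :: real)" for j \<omega>
  have [measurable]: "T \<in> borel_measurable M" using T by (rule borel_measurable_integrable)
  have N [measurable]: "N \<in> borel_measurable M"
    unfolding N_def using measurable_compose[OF \<zeta> measurable_emeasure_Npoint[OF G]] by simp
  have L [measurable]: "(\<lambda>\<omega>. \<integral>\<^sup>+y. g y \<partial>\<zeta> \<omega>) \<in> borel_measurable M" if "g \<in> borel_measurable E" for g
    using measurable_nn_integral_process[OF \<zeta> that] .
  have [measurable]: "(\<lambda>\<omega>. I j \<omega>) \<in> borel_measurable M" for j
    unfolding I_def by measurable
  have Nnat: "N \<omega> \<in> \<nat> \<union> {\<infinity>}" if "\<omega> \<in> space M" for \<omega>
    using measurable_space[OF \<zeta> that] G by (auto simp: N_def point_measures_def)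
  \<comment> \<open>multiplying by \<open>exp(-nN)\<close> replaces \<open>f\<close> by \<open>n 1\<^sub>G + f\<close>\<close>
  define g where "g n y = of_nat n * indicator G y + f y" for n :: nat and y
  have g: "g n \<in> borel_measurable E" for n
    using G less.prems unfolding g_def by measurable
  have int_g: "expn (\<integral>\<^sup>+y. g n y \<partial>\<zeta> \<omega>) = expn (of_nat n * N \<omega>) * expn (\<integral>\<^sup>+y. f y \<partial>\<zeta> \<omega>)"
    if "\<omega> \<in> space M" for n \<omega>
  proof -
    have s: "sets (\<zeta> \<omega>) = sets E"
      using measurable_space[OF \<zeta> that] by (simp add: sets_point_measure)
    have "(\<integral>\<^sup>+y. g n y \<partial>\<zeta> \<omega>) = of_nat n * N \<omega> + (\<integral>\<^sup>+y. f y \<partial>\<zeta> \<omega>)"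
      unfolding g_def N_def using G less.prems s
      by (subst nn_integral_add) (simp_all add: measurable_cong_sets[OF s refl] nn_integral_cmult_indicator)
    then show ?thesis by (simp add: expn_add)
  qed
  define u where "u n \<omega> = exp (real k * real n) * expn (of_nat n * N \<omega>) * (1 - (\<Sum>j<k. I j \<omega>))" for n \<omega>
  have expn_N: "expn (of_nat n * N \<omega>) = exp (- (real n * real j))" if "N \<omega> = of_nat j" for \<omega> n j
    using that by (simp add: ennreal_of_nat_eq_real_of_nat expn_ennreal flip: ennreal_mult)
  have u_less: "u n \<omega> = 0" if "N \<omega> = of_nat j" "j < k" for n \<omega> j
  proof -
    have "(\<Sum>i<k. I i \<omega>) = (\<Sum>i<k. if i = j then 1 else 0)"
      using that by (intro sum.cong) (auto simp: I_def)
    then show ?thesis using that by (simp add: u_def)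
  qed
  have u_ge: "u n \<omega> = exp (- (real n * (real j - real k)))" if "N \<omega> = of_nat j" "k \<le> j" for n \<omega> j
  proof -
    have "(\<Sum>i<k. I i \<omega>) = 0"
      using that by (intro sum.neutral) (auto simp: I_def)
    then have "u n \<omega> = exp (real k * real n) * exp (- (real n * real j))"
      unfolding u_def expn_N[OF that(1)] by simp
    then show ?thesis by (simp add: algebra_simps flip: exp_add)
  qed
  have u_inf: "u n \<omega> = (if n = 0 then 1 else 0)" if "N \<omega> = \<infinity>" for n \<omega>
    using that by (simp add: u_def I_def ennreal_mult_top)
  have u_bound: "\<bar>u n \<omega>\<bar> \<le> 1" if \<omega>: "\<omega> \<in> space M" for n \<omega>
  proof -
    consider j where "N \<omega> = of_nat j" "j < k" | j where "N \<omega> = of_nat j" "k \<le> j" | "N \<omega> = \<infinity>"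
      using Nnat[OF \<omega>] by (metis Nats_cases UnE not_le singletonD)
    then show ?thesis
      by cases (simp_all add: u_less u_ge u_inf)
  qed
  have u_lim: "(\<lambda>n. u n \<omega>) \<longlonglongrightarrow> I k \<omega>" if \<omega>: "\<omega> \<in> space M" for \<omega>
  proof -
    consider j where "N \<omega> = of_nat j" "j < k" | "N \<omega> = of_nat k" | j where "N \<omega> = of_nat j" "k < j" | "N \<omega> = \<infinity>"
      using Nnat[OF \<omega>] by (metis Nats_cases UnE linorder_neqE_nat singletonD)
    then show ?thesis
    proof cases
      case 1
      then show ?thesis by (simp add: u_less[OF 1] I_def)
    next
      case 2
      then show ?thesis by (simp add: u_ge[OF 2] I_def)
    next
      case (3 j)
      define r where "r = exp (- (real j - real k))"
      have r: "0 \<le> r" "r < 1" using 3 by (auto simp: r_def)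
      have "u n \<omega> = r ^ n" for n
        using 3 exp_of_nat_mult[of n "- (real j - real k)"] u_ge[of \<omega> j n]
        by (simp add: r_def del: minus_diff_eq)
      moreover have "I k \<omega> = 0" using 3 by (simp add: I_def)
      ultimately show ?thesis using LIMSEQ_realpow_zero[OF r] by simp
    next
      case 4
      have "I k \<omega> = 0" using 4 by (simp add: I_def)
      moreover have "\<forall>\<^sub>F n in sequentially. u n \<omega> = 0"
        using eventually_gt_at_top[of 0] by eventually_elim (simp add: u_inf[OF 4])
      ultimately show ?thesis by (simp add: tendsto_eventually)
    qed
  qed
  have bnd: "integrable M (\<lambda>\<omega>. T \<omega> * h \<omega>)" if [measurable]: "h \<in> borel_measurable M" and "\<And>\<omega>. \<omega> \<in> space M \<Longrightarrow> \<bar>h \<omega>\<bar> \<le> 1" for h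
  proof (rule Bochner_Integration.integrable_bound[OF T])
    show "AE \<omega> in M. norm (T \<omega> * h \<omega>) \<le> norm (T \<omega>)"
      using that(2) by (intro AE_I2) (simp add: abs_mult mult_left_le)
  qed measurable
  have I01: "\<bar>I j \<omega>\<bar> \<le> 1" for j \<omega> by (simp add: I_def)
  have IL: "\<bar>I j \<omega> * expn x\<bar> \<le> 1" for j \<omega> x
    using mult_mono[OF I01[of j \<omega>] norm_expn_le_1[of x]] by (simp add: abs_mult)
  note [measurable] = less.prems g
  \<comment> \<open>expanding \<open>u n\<close> leaves a Laplace functional and indicators of counts smaller than \<open>k\<close>\<close>
  have zero_n: "(\<integral>\<omega>. T \<omega> * u n \<omega> * expn (\<integral>\<^sup>+y. f y \<partial>\<zeta> \<omega>) \<partial>M) = 0" for n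
  proof -
    have "(\<integral>\<omega>. T \<omega> * u n \<omega> * expn (\<integral>\<^sup>+y. f y \<partial>\<zeta> \<omega>) \<partial>M) =
        (\<integral>\<omega>. exp (real k * real n) * (T \<omega> * expn (\<integral>\<^sup>+y. g n y \<partial>\<zeta> \<omega>)
          - (\<Sum>j<k. T \<omega> * I j \<omega> * expn (\<integral>\<^sup>+y. g n y \<partial>\<zeta> \<omega>))) \<partial>M)"
      by (intro Bochner_Integration.integral_cong refl)
        (simp add: u_def int_g algebra_simps sum_distrib_left)
    also have "\<dots> = exp (real k * real n) * ((\<integral>\<omega>. T \<omega> * expn (\<integral>\<^sup>+y. g n y \<partial>\<zeta> \<omega>) \<partial>M)
          - (\<Sum>j<k. \<integral>\<omega>. T \<omega> * I j \<omega> * expn (\<integral>\<^sup>+y. g n y \<partial>\<zeta> \<omega>) \<partial>M))"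
    proof -
      have i1: "integrable M (\<lambda>\<omega>. T \<omega> * expn (\<integral>\<^sup>+y. g n y \<partial>\<zeta> \<omega>))"
        by (rule bnd) auto
      have i2: "integrable M (\<lambda>\<omega>. T \<omega> * I j \<omega> * expn (\<integral>\<^sup>+y. g n y \<partial>\<zeta> \<omega>))" for j
        unfolding mult.assoc by (rule bnd) (auto simp: IL)
      show ?thesis using i1 i2 by simp
    qed
    also have "(\<integral>\<omega>. T \<omega> * expn (\<integral>\<^sup>+y. g n y \<partial>\<zeta> \<omega>) \<partial>M) = 0"
      by (rule zero[OF g])
    also have "(\<Sum>j<k. \<integral>\<omega>. T \<omega> * I j \<omega> * expn (\<integral>\<^sup>+y. g n y \<partial>\<zeta> \<omega>) \<partial>M) = 0"
      using less.IH[OF _ g] by (intro sum.neutral) (simp add: I_def N_def)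
    finally show ?thesis by simp
  qed
  have "(\<lambda>n. \<integral>\<omega>. T \<omega> * u n \<omega> * expn (\<integral>\<^sup>+y. f y \<partial>\<zeta> \<omega>) \<partial>M) \<longlonglongrightarrow>
      (\<integral>\<omega>. T \<omega> * I k \<omega> * expn (\<integral>\<^sup>+y. f y \<partial>\<zeta> \<omega>) \<partial>M)"
  proof (rule integral_dominated_convergence[where w="\<lambda>\<omega>. \<bar>T \<omega>\<bar>"])
    show "integrable M (\<lambda>\<omega>. \<bar>T \<omega>\<bar>)" using T by simp
    show "AE \<omega> in M. (\<lambda>n. T \<omega> * u n \<omega> * expn (\<integral>\<^sup>+y. f y \<partial>\<zeta> \<omega>)) \<longlonglongrightarrow> T \<omega> * I k \<omega> * expn (\<integral>\<^sup>+y. f y \<partial>\<zeta> \<omega>)"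
      by (intro AE_I2 tendsto_intros u_lim)
    show "AE \<omega> in M. norm (T \<omega> * u n \<omega> * expn (\<integral>\<^sup>+y. f y \<partial>\<zeta> \<omega>)) \<le> \<bar>T \<omega>\<bar>" for n
    proof (rule AE_I2)
      fix \<omega> assume "\<omega> \<in> space M"
      then have "\<bar>u n \<omega>\<bar> * \<bar>expn (\<integral>\<^sup>+y. f y \<partial>\<zeta> \<omega>)\<bar> \<le> 1 * 1"
        by (intro mult_mono u_bound) auto
      then show "norm (T \<omega> * u n \<omega> * expn (\<integral>\<^sup>+y. f y \<partial>\<zeta> \<omega>)) \<le> \<bar>T \<omega>\<bar>"
        using mult_left_mono[of _ 1 "\<bar>T \<omega>\<bar>"] by (simp add: abs_mult mult.assoc)
    qed
    show "(\<lambda>\<omega>. T \<omega> * u n \<omega> * expn (\<integral>\<^sup>+y. f y \<partial>\<zeta> \<omega>)) \<in> borel_measurable M" for n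
      unfolding u_def by measurable
  qed measurable
  then show ?case
    using LIMSEQ_unique[OF _ tendsto_const[of 0]] by (simp add: zero_n I_def N_def)
qed

text \<open>Sets that prescribe finitely many finite counts. They are closed under intersection; the value \<open>\<infinity>\<close>
  of a count is the complement of the countably many finite ones.\<close>

definition count_cylinder :: "'a measure \<Rightarrow> ('a set \<times> nat) set \<Rightarrow> 'a measure set" where
  "count_cylinder E Q = {\<mu> \<in> point_measures E. \<forall>(G, k)\<in>Q. emeasure \<mu> G = of_nat k}"

lemma sets_Npoint_count_cylinder:
  "sets (Npoint E) = sigma_sets (point_measures E) {count_cylinder E Q | Q. finite Q \<and> fst ` Q \<subseteq> sets E}"
    (is "_ = sigma_sets ?\<Omega> ?P")
proof (rule antisym)
  have P: "?P \<subseteq> Pow ?\<Omega>" by (auto simp: count_cylinder_def)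
  let ?N = "sigma ?\<Omega> ?P"
  have sp: "space ?N = ?\<Omega>" and st: "sets ?N = sigma_sets ?\<Omega> ?P"
    using P by (simp_all add: space_measure_of sets_measure_of)
  have single: "{\<mu> \<in> ?\<Omega>. emeasure \<mu> G = of_nat k} \<in> sets ?N" if "G \<in> sets E" for G k
  proof -
    have "count_cylinder E {(G, k)} \<in> ?P"
      using that by (intro CollectI exI[of _ "{(G, k)}"]) simp
    then have "count_cylinder E {(G, k)} \<in> sets ?N" unfolding st by (rule sigma_sets.Basic)
    moreover have "count_cylinder E {(G, k)} = {\<mu> \<in> ?\<Omega>. emeasure \<mu> G = of_nat k}"
      unfolding count_cylinder_def by auto
    ultimately show ?thesis by (rule back_subst[of "\<lambda>A. A \<in> sets ?N"])
  qed
  have "{\<mu> \<in> ?\<Omega>. emeasure \<mu> G \<in> S} \<in> sets ?N" if G: "G \<in> sets E" for G and S :: "ennreal set"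
  proof -
    let ?A = "\<lambda>k::nat. {\<mu> \<in> ?\<Omega>. emeasure \<mu> G = of_nat k}"
    have nat: "emeasure \<mu> G = \<infinity> \<longleftrightarrow> (\<forall>k. \<mu> \<notin> ?A k)" if "\<mu> \<in> ?\<Omega>" for \<mu>
      using that G by (auto simp: point_measures_def elim!: Nats_cases)
    have "{\<mu> \<in> ?\<Omega>. emeasure \<mu> G \<in> S} =
        (\<Union>k\<in>{k. of_nat k \<in> S}. ?A k) \<union> (if \<infinity> \<in> S then space ?N - (\<Union>k. ?A k) else {})"
    proof (intro set_eqI)
      fix \<mu>
      show "\<mu> \<in> {\<mu> \<in> ?\<Omega>. emeasure \<mu> G \<in> S} \<longleftrightarrow>
        \<mu> \<in> (\<Union>k\<in>{k. of_nat k \<in> S}. ?A k) \<union> (if \<infinity> \<in> S then space ?N - (\<Union>k. ?A k) else {})"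
        unfolding sp using nat[of \<mu>] by (cases "\<mu> \<in> ?\<Omega>") auto
    qed
    also have "\<dots> \<in> sets ?N"
      using single[OF G] by (intro sets.Un sets.countable_UN' sets.Diff sets.top) auto
    finally show ?thesis .
  qed
  then show "sets (Npoint E) \<subseteq> sigma_sets ?\<Omega> ?P"
    unfolding sets_Npoint st[symmetric] using sp
    by (intro sets.sigma_sets_subset[of _ ?N, unfolded sp]) auto
  have "count_cylinder E Q \<in> sets (Npoint E)" if "finite Q" "fst ` Q \<subseteq> sets E" for Q
  proof -
    have "{\<mu> \<in> space (Npoint E). \<forall>q\<in>Q. emeasure \<mu> (fst q) = of_nat (snd q)} \<in> sets (Npoint E)"
    proof (rule sets.sets_Collect_finite_All[OF _ that(1)])
      fix q assume "q \<in> Q"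
      then have [measurable]: "(\<lambda>\<mu>. emeasure \<mu> (fst q)) \<in> borel_measurable (Npoint E)"
        using that(2) by (intro measurable_emeasure_Npoint) auto
      show "{\<mu> \<in> space (Npoint E). emeasure \<mu> (fst q) = of_nat (snd q)} \<in> sets (Npoint E)"
        by measurable
    qed
    then show ?thesis by (simp add: count_cylinder_def case_prod_beta)
  qed
  then show "sigma_sets ?\<Omega> ?P \<subseteq> sets (Npoint E)"
    using sets.sigma_sets_subset[of ?P "Npoint E"] by auto
qed

text \<open>A monotone class theorem: an integrable \<open>T\<close> that is orthogonal to all Laplace functionals of \<open>\<zeta>\<close> is
  orthogonal to all events of \<open>\<zeta>\<close>. The count cylinders form an intersection-stable generator, to which
  the preceding lemma applies one count at a time.\<close>

lemma integral_Npoint_eq_0: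
  assumes "prob_space M" and \<zeta>: "\<zeta> \<in> M \<rightarrow>\<^sub>M Npoint E"
    and T: "integrable M (T :: _ \<Rightarrow> real)"
    and zero: "\<And>f. f \<in> borel_measurable E \<Longrightarrow> (\<integral>\<omega>. T \<omega> * expn (\<integral>\<^sup>+y. f y \<partial>\<zeta> \<omega>) \<partial>M) = 0"
    and H: "H \<in> sets (Npoint E)"
  shows "(\<integral>\<omega>. T \<omega> * indicator H (\<zeta> \<omega>) \<partial>M) = 0"
proof -
  interpret prob_space M by fact
  let ?P = "{count_cylinder E Q | Q. finite Q \<and> fst ` Q \<subseteq> sets E}"
  have [measurable]: "T \<in> borel_measurable M" using T by (rule borel_measurable_integrable)
  note [measurable] = \<zeta>
  have bnd: "integrable M (\<lambda>\<omega>. T \<omega> * indicator A (\<zeta> \<omega>))" if "A \<in> sets (Npoint E)" for A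
  proof (rule Bochner_Integration.integrable_bound[OF T])
    show "(\<lambda>\<omega>. T \<omega> * indicator A (\<zeta> \<omega>)) \<in> borel_measurable M" using that by measurable
  qed (auto simp: indicator_def)
  have cyl: "(\<integral>\<omega>. T \<omega> * indicator (count_cylinder E Q) (\<zeta> \<omega>) * expn (\<integral>\<^sup>+y. f y \<partial>\<zeta> \<omega>) \<partial>M) = 0"
    if "finite Q" "fst ` Q \<subseteq> sets E" "f \<in> borel_measurable E" for Q f
    using that
  proof (induction Q arbitrary: f rule: finite_induct)
    case empty
    have "(\<integral>\<omega>. T \<omega> * indicator (count_cylinder E {}) (\<zeta> \<omega>) * expn (\<integral>\<^sup>+y. f y \<partial>\<zeta> \<omega>) \<partial>M) =
        (\<integral>\<omega>. T \<omega> * expn (\<integral>\<^sup>+y. f y \<partial>\<zeta> \<omega>) \<partial>M)"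
      using measurable_space[OF \<zeta>]
      by (intro Bochner_Integration.integral_cong) (auto simp: count_cylinder_def)
    then show ?case using zero[OF empty(2)] by simp
  next
    case (insert q Q)
    obtain G k where q: "q = (G, k)" by (cases q)
    have Q: "count_cylinder E Q \<in> sets (Npoint E)"
      unfolding sets_Npoint_count_cylinder using insert by (intro sigma_sets.Basic) auto
    have "(\<integral>\<omega>. (T \<omega> * indicator (count_cylinder E Q) (\<zeta> \<omega>)) * indicator {\<omega>. emeasure (\<zeta> \<omega>) G = of_nat k} \<omega>
        * expn (\<integral>\<^sup>+y. f y \<partial>\<zeta> \<omega>) \<partial>M) = 0"
      using insert q by (intro integral_expn_of_nat_eq_0[OF \<open>prob_space M\<close> \<zeta> bnd[OF Q]]) auto
    moreover have "indicator (count_cylinder E (insert q Q)) (\<zeta> \<omega>) =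
        (indicator (count_cylinder E Q) (\<zeta> \<omega>) * indicator {\<omega>. emeasure (\<zeta> \<omega>) G = of_nat k} \<omega> :: real)" for \<omega>
      by (auto simp: count_cylinder_def q indicator_def)
    ultimately show ?case by (simp add: mult.assoc)
  qed
  have stable: "Int_stable ?P"
  proof (rule Int_stableI)
    fix a b assume "a \<in> ?P" "b \<in> ?P"
    then obtain Q R where "a = count_cylinder E Q" "b = count_cylinder E R" "finite Q" "finite R"
      "fst ` Q \<subseteq> sets E" "fst ` R \<subseteq> sets E" by auto
    then show "a \<inter> b \<in> ?P"
      by (auto simp: count_cylinder_def intro!: exI[of _ "Q \<union> R"])
  qed
  have sub: "?P \<subseteq> Pow (point_measures E)" by (auto simp: count_cylinder_def)
  show ?thesis
    using H[unfolded sets_Npoint_count_cylinder]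
  proof (induction rule: sigma_sets_induct_disjoint[OF stable sub, consumes 1, case_names basic empty compl union])
    case (basic A)
    then obtain Q where "A = count_cylinder E Q" "finite Q" "fst ` Q \<subseteq> sets E" by auto
    then show ?case using cyl[of Q "\<lambda>_. 0"] by simp
  next
    case empty
    then show ?case by simp
  next
    case (compl A)
    then have A: "A \<in> sets (Npoint E)" by (simp add: sets_Npoint_count_cylinder)
    have "(\<integral>\<omega>. T \<omega> * indicator (point_measures E - A) (\<zeta> \<omega>) \<partial>M) = (\<integral>\<omega>. T \<omega> - T \<omega> * indicator A (\<zeta> \<omega>) \<partial>M)"
      using measurable_space[OF \<zeta>]
      by (intro Bochner_Integration.integral_cong) (auto simp: indicator_def)
    also have "\<dots> = (\<integral>\<omega>. T \<omega> \<partial>M) - 0"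
      using compl(2) bnd[OF A] T by simp
    also have "(\<integral>\<omega>. T \<omega> \<partial>M) = 0"
      using zero[of "\<lambda>_. 0"] by simp
    finally show ?case by simp
  next
    case (union A)
    then have A: "A i \<in> sets (Npoint E)" for i by (auto simp: sets_Npoint_count_cylinder)
    let ?B = "\<lambda>i. \<zeta> -` A i \<inter> space M"
    have eq: "(LINT \<omega>:(\<zeta> -` C \<inter> space M)|M. T \<omega>) = (\<integral>\<omega>. T \<omega> * indicator C (\<zeta> \<omega>) \<partial>M)" for C
      unfolding set_lebesgue_integral_def
      by (intro Bochner_Integration.integral_cong) (auto simp: indicator_def)
    have "(LINT \<omega>:(\<Union>i. ?B i)|M. T \<omega>) = (\<Sum>i. (LINT \<omega>:(?B i)|M. T \<omega>))"
    proof (rule lebesgue_integral_countable_add)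
      show "?B i \<in> sets M" for i using A by measurable
      show "?B i \<inter> ?B j = {}" if "i \<noteq> j" for i j
        using union(1) that by (auto simp: disjoint_family_on_def)
      show "set_integrable M (\<Union>i. ?B i) T"
        unfolding set_integrable_def using A T by (intro integrable_mult_indicator) measurable
    qed
    also have "(\<Union>i. ?B i) = \<zeta> -` (\<Union>i. A i) \<inter> space M" by auto
    finally show ?case using union(3) by (simp add: eq)
  qed
qed

text \<open>The conditional expectation of \<open>T\<close> given \<open>\<zeta>\<close> vanishes.\<close>

lemma integral_bounded_function_eq_0:
  assumes "prob_space M" and \<zeta>: "\<zeta> \<in> M \<rightarrow>\<^sub>M N"
    and T: "integrable M (T :: _ \<Rightarrow> real)"
    and zero: "\<And>F. F \<in> sets N \<Longrightarrow> (\<integral>\<omega>. T \<omega> * indicator F (\<zeta> \<omega>) \<partial>M) = 0"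
    and v: "v \<in> borel_measurable N" "\<And>x. \<bar>v x\<bar> \<le> 1"
  shows "(\<integral>\<omega>. T \<omega> * v (\<zeta> \<omega>) \<partial>M) = 0"
proof -
  interpret prob_space M by fact
  let ?S = "vimage_algebra (space M) \<zeta> N"
  have [measurable]: "T \<in> borel_measurable M" using T by (rule borel_measurable_integrable)
  have "subalgebra M ?S"
    using \<zeta> by (auto simp: subalgebra_def sets_vimage_algebra2 measurable_def)
  then interpret finite_measure_subalgebra M ?S by unfold_locales
  have vS: "(\<lambda>\<omega>. v (\<zeta> \<omega>)) \<in> borel_measurable ?S"
    using measurable_space[OF \<zeta>] by (intro measurable_compose[OF measurable_vimage_algebra1 v(1)]) auto
  have "AE \<omega> in M. real_cond_exp M ?S T \<omega> = 0"
  proof (rule real_cond_exp_charact)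
    fix A assume "A \<in> sets ?S"
    then obtain F where F: "F \<in> sets N" "A = \<zeta> -` F \<inter> space M"
      using \<zeta> by (auto simp: sets_vimage_algebra2 measurable_def)
    have "(LINT \<omega>:A|M. T \<omega>) = (\<integral>\<omega>. T \<omega> * indicator F (\<zeta> \<omega>) \<partial>M)"
      unfolding set_lebesgue_integral_def F(2)
      by (intro Bochner_Integration.integral_cong) (auto simp: indicator_def)
    then show "(LINT \<omega>:A|M. T \<omega>) = (LINT \<omega>:A|M. 0)"
      using zero[OF F(1)] by simp
  qed (use T in auto)
  then have "(\<integral>\<omega>. v (\<zeta> \<omega>) * real_cond_exp M ?S T \<omega> \<partial>M) = 0"
    by (intro integral_eq_zero_AE) auto
  moreover have "(\<integral>\<omega>. v (\<zeta> \<omega>) * real_cond_exp M ?S T \<omega> \<partial>M) = (\<integral>\<omega>. v (\<zeta> \<omega>) * T \<omega> \<partial>M)"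
  proof (rule real_cond_exp_intg(2)[OF _ vS])
    show "integrable M (\<lambda>\<omega>. v (\<zeta> \<omega>) * T \<omega>)"
    proof (rule Bochner_Integration.integrable_bound[OF T])
      show "(\<lambda>\<omega>. v (\<zeta> \<omega>) * T \<omega>) \<in> borel_measurable M"
        using measurable_compose[OF \<zeta> v(1)] by measurable
      show "AE \<omega> in M. norm (v (\<zeta> \<omega>) * T \<omega>) \<le> norm (T \<omega>)"
        using v(2) by (intro AE_I2) (simp add: abs_mult mult_left_le_one_le)
    qed
  qed measurable
  ultimately show ?thesis by (simp add: mult.commute)
qed

section \<open>Conditional independence through conditional expectations\<close>

text \<open>The product formula of conditional independence for a single pair of random variables.\<close>

definition cond_uncorrelated :: "'w measure \<Rightarrow> 'w measure \<Rightarrow> ('w \<Rightarrow> real) \<Rightarrow> ('w \<Rightarrow> real) \<Rightarrow> bool" where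
  "cond_uncorrelated M S U W \<longleftrightarrow>
    (AE \<omega> in M. real_cond_exp M S (\<lambda>\<omega>. U \<omega> * W \<omega>) \<omega> = real_cond_exp M S U \<omega> * real_cond_exp M S W \<omega>)"

lemma cond_uncorrelated_commute: "cond_uncorrelated M S U W \<longleftrightarrow> cond_uncorrelated M S W U"
  by (simp add: cond_uncorrelated_def mult.commute)

context finite_measure_subalgebra
begin

lemma integrable_mult_bounded:
  assumes T: "integrable M (T :: _ \<Rightarrow> real)" and [measurable]: "u \<in> borel_measurable M"
    and u: "\<And>\<omega>. \<omega> \<in> space M \<Longrightarrow> \<bar>u \<omega>\<bar> \<le> 1"
  shows "integrable M (\<lambda>\<omega>. T \<omega> * u \<omega>)"
proof (rule Bochner_Integration.integrable_bound[OF T])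
  show "(\<lambda>\<omega>. T \<omega> * u \<omega>) \<in> borel_measurable M" using T by measurable
  show "AE \<omega> in M. norm (T \<omega> * u \<omega>) \<le> norm (T \<omega>)"
    using u by (intro AE_I2) (simp add: abs_mult mult_left_le)
qed

lemma integrable_bounded_1:
  assumes "(u :: _ \<Rightarrow> real) \<in> borel_measurable M" "\<And>\<omega>. \<omega> \<in> space M \<Longrightarrow> \<bar>u \<omega>\<bar> \<le> 1"
  shows "integrable M u"
  using assms by (intro integrable_const_bound[where B=1] AE_I2) auto

text \<open>The product formula says that \<open>(W - E[W | F]) U\<close> has conditional expectation zero. In this form it is
  linear in \<open>U\<close> for fixed \<open>W\<close>, and it is a statement that \<open>U\<close> is orthogonal to certain integrable functions,
  which is what the monotone class results speak about.\<close>

lemma cond_uncorrelated_iff: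
  assumes U: "U \<in> borel_measurable M" "\<And>\<omega>. \<omega> \<in> space M \<Longrightarrow> \<bar>U \<omega>\<bar> \<le> 1"
    and W: "W \<in> borel_measurable M" "\<And>\<omega>. \<omega> \<in> space M \<Longrightarrow> \<bar>W \<omega>\<bar> \<le> 1"
    and p: "p \<in> borel_measurable F" "AE \<omega> in M. real_cond_exp M F W \<omega> = p \<omega>"
  shows "cond_uncorrelated M F U W \<longleftrightarrow>
    (\<forall>H\<in>sets F. (\<integral>\<omega>. (indicator H \<omega> * (W \<omega> - p \<omega>)) * U \<omega> \<partial>M) = 0)"
    and "H \<in> sets F \<Longrightarrow> integrable M (\<lambda>\<omega>. indicator H \<omega> * (W \<omega> - p \<omega>))"
proof -
  note [measurable] = U(1) W(1) p(1)
  have pM [measurable]: "p \<in> borel_measurable M" using measurable_from_subalg[OF subalg p(1)] .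
  have intW: "integrable M W" using W by (rule integrable_bounded_1)
  have intp: "integrable M p"
    using integrable_cong_AE[OF _ pM p(2)] real_cond_exp_int(1)[OF intW] by simp
  show int: "integrable M (\<lambda>\<omega>. indicator H \<omega> * (W \<omega> - p \<omega>))" if "H \<in> sets F" for H
    using that subalg intW intp by (intro integrable_real_mult_indicator[of H M, simplified mult.commute[of _ "indicator H _"]] Bochner_Integration.integrable_diff)
      (auto simp: subalgebra_def)
  define D where "D \<omega> = U \<omega> * W \<omega> - p \<omega> * U \<omega>" for \<omega>
  have i1: "integrable M (\<lambda>\<omega>. U \<omega> * W \<omega>)"
    using integrable_mult_bounded[OF integrable_bounded_1[OF U] W] .
  have i2: "integrable M (\<lambda>\<omega>. p \<omega> * U \<omega>)"
    using integrable_mult_bounded[OF intp U] .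
  have iD: "integrable M D" unfolding D_def using i1 i2 by simp
  have eq: "AE \<omega> in M. real_cond_exp M F D \<omega> = real_cond_exp M F (\<lambda>\<omega>. U \<omega> * W \<omega>) \<omega>
      - real_cond_exp M F U \<omega> * real_cond_exp M F W \<omega>"
    using real_cond_exp_diff[OF i1 i2] real_cond_exp_mult[OF p(1) U(1) i2] p(2)
    unfolding D_def by eventually_elim simp
  have set: "(\<integral>\<omega>. (indicator H \<omega> * (W \<omega> - p \<omega>)) * U \<omega> \<partial>M) = (LINT \<omega>:H|M. D \<omega>)" for H
    unfolding set_lebesgue_integral_def
    by (intro Bochner_Integration.integral_cong) (auto simp: D_def algebra_simps)
  show "cond_uncorrelated M F U W \<longleftrightarrow>
    (\<forall>H\<in>sets F. (\<integral>\<omega>. (indicator H \<omega> * (W \<omega> - p \<omega>)) * U \<omega> \<partial>M) = 0)"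
  proof
    assume "cond_uncorrelated M F U W"
    then have z: "AE \<omega> in M. real_cond_exp M F D \<omega> = 0"
      using eq unfolding cond_uncorrelated_def by eventually_elim simp
    show "\<forall>H\<in>sets F. (\<integral>\<omega>. (indicator H \<omega> * (W \<omega> - p \<omega>)) * U \<omega> \<partial>M) = 0"
    proof
      fix H assume H: "H \<in> sets F"
      have "(LINT \<omega>:H|M. D \<omega>) = (LINT \<omega>:H|M. real_cond_exp M F D \<omega>)"
        by (rule real_cond_exp_intA[OF iD H])
      also have "\<dots> = 0"
        unfolding set_lebesgue_integral_def using z
        by (intro integral_eq_zero_AE) auto
      finally show "(\<integral>\<omega>. (indicator H \<omega> * (W \<omega> - p \<omega>)) * U \<omega> \<partial>M) = 0"
        by (simp add: set)
    qed
  next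
    assume "\<forall>H\<in>sets F. (\<integral>\<omega>. (indicator H \<omega> * (W \<omega> - p \<omega>)) * U \<omega> \<partial>M) = 0"
    then have "AE \<omega> in M. real_cond_exp M F D \<omega> = 0"
      using iD by (intro real_cond_exp_charact) (auto simp: set)
    then show "cond_uncorrelated M F U W"
      using eq unfolding cond_uncorrelated_def by eventually_elim simp
  qed
qed

lemma cond_uncorrelated_extend_left:
  assumes \<U>: "\<And>u. u \<in> \<U> \<Longrightarrow> u \<in> borel_measurable M" "\<And>u \<omega>. u \<in> \<U> \<Longrightarrow> \<omega> \<in> space M \<Longrightarrow> \<bar>u \<omega>\<bar> \<le> 1"
    and W: "W \<in> borel_measurable M" "\<And>\<omega>. \<omega> \<in> space M \<Longrightarrow> \<bar>W \<omega>\<bar> \<le> 1"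
    and U: "U \<in> borel_measurable M" "\<And>\<omega>. \<omega> \<in> space M \<Longrightarrow> \<bar>U \<omega>\<bar> \<le> 1"
    and ext: "\<And>T :: _ \<Rightarrow> real. integrable M T \<Longrightarrow> (\<And>u. u \<in> \<U> \<Longrightarrow> (\<integral>\<omega>. T \<omega> * u \<omega> \<partial>M) = 0) \<Longrightarrow> (\<integral>\<omega>. T \<omega> * U \<omega> \<partial>M) = 0"
    and uncorr: "\<And>u. u \<in> \<U> \<Longrightarrow> cond_uncorrelated M F u W"
  shows "cond_uncorrelated M F U W"
proof -
  have p: "real_cond_exp M F W \<in> borel_measurable F" "AE \<omega> in M. real_cond_exp M F W \<omega> = real_cond_exp M F W \<omega>"
    by auto
  have "\<forall>H\<in>sets F. (\<integral>\<omega>. indicator H \<omega> * (W \<omega> - real_cond_exp M F W \<omega>) * U \<omega> \<partial>M) = 0"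
  proof
    fix H assume H: "H \<in> sets F"
    show "(\<integral>\<omega>. indicator H \<omega> * (W \<omega> - real_cond_exp M F W \<omega>) * U \<omega> \<partial>M) = 0"
    proof (rule ext)
      show "integrable M (\<lambda>\<omega>. indicator H \<omega> * (W \<omega> - real_cond_exp M F W \<omega>))"
        using cond_uncorrelated_iff(2)[OF U W p H] .
      fix u assume u: "u \<in> \<U>"
      show "(\<integral>\<omega>. indicator H \<omega> * (W \<omega> - real_cond_exp M F W \<omega>) * u \<omega> \<partial>M) = 0"
        using uncorr[OF u] H cond_uncorrelated_iff(1)[OF \<U>(1)[OF u] \<U>(2)[OF u] W p] by blast
    qed
  qed
  then show ?thesis using cond_uncorrelated_iff(1)[OF U W p] by simp
qed

text \<open>The product formula is symmetric, so the two classes can be enlarged one after the other.\<close>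

lemma cond_uncorrelated_extend:
  assumes \<U>: "\<And>u. u \<in> \<U> \<Longrightarrow> u \<in> borel_measurable M" "\<And>u \<omega>. u \<in> \<U> \<Longrightarrow> \<omega> \<in> space M \<Longrightarrow> \<bar>u \<omega>\<bar> \<le> 1"
    and \<W>: "\<And>w. w \<in> \<W> \<Longrightarrow> w \<in> borel_measurable M" "\<And>w \<omega>. w \<in> \<W> \<Longrightarrow> \<omega> \<in> space M \<Longrightarrow> \<bar>w \<omega>\<bar> \<le> 1"
    and U: "U \<in> borel_measurable M" "\<And>\<omega>. \<omega> \<in> space M \<Longrightarrow> \<bar>U \<omega>\<bar> \<le> 1"
    and W: "W \<in> borel_measurable M" "\<And>\<omega>. \<omega> \<in> space M \<Longrightarrow> \<bar>W \<omega>\<bar> \<le> 1"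
    and extU: "\<And>T :: _ \<Rightarrow> real. integrable M T \<Longrightarrow> (\<And>u. u \<in> \<U> \<Longrightarrow> (\<integral>\<omega>. T \<omega> * u \<omega> \<partial>M) = 0) \<Longrightarrow> (\<integral>\<omega>. T \<omega> * U \<omega> \<partial>M) = 0"
    and extW: "\<And>T :: _ \<Rightarrow> real. integrable M T \<Longrightarrow> (\<And>w. w \<in> \<W> \<Longrightarrow> (\<integral>\<omega>. T \<omega> * w \<omega> \<partial>M) = 0) \<Longrightarrow> (\<integral>\<omega>. T \<omega> * W \<omega> \<partial>M) = 0"
    and uncorr: "\<And>u w. u \<in> \<U> \<Longrightarrow> w \<in> \<W> \<Longrightarrow> cond_uncorrelated M F u w"
  shows "cond_uncorrelated M F U W"
proof -
  have "cond_uncorrelated M F w U" if w: "w \<in> \<W>" for w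
    using uncorr w unfolding cond_uncorrelated_commute[of M F w U]
    by (intro cond_uncorrelated_extend_left[where \<U>=\<U> and U=U and W=w] \<U> \<W>[OF w] U extU) auto
  then show ?thesis
    unfolding cond_uncorrelated_commute[of M F U W]
    by (intro cond_uncorrelated_extend_left[where \<U>=\<W> and U=W and W=U] \<W> U W extW) auto
qed

end

lemma subalgebra_vimage:
  assumes "Z \<in> M \<rightarrow>\<^sub>M N"
  shows "subalgebra M (vimage_algebra (space M) Z N)"
    and "sets (vimage_algebra (space M) Z N) = {Z -` H \<inter> space M | H. H \<in> sets N}"
  using assms by (auto simp: subalgebra_def sets_vimage_algebra2 measurable_def)

lemma measurable_vimage_compose:
  assumes "Z \<in> M \<rightarrow>\<^sub>M N" "p \<in> N \<rightarrow>\<^sub>M K"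
  shows "(\<lambda>\<omega>. p (Z \<omega>)) \<in> vimage_algebra (space M) Z N \<rightarrow>\<^sub>M K"
  using measurable_space[OF assms(1)] by (intro measurable_compose[OF measurable_vimage_algebra1 assms(2)]) auto

text \<open>The two variables \<open>X\<close>, \<open>Y\<close> have the same value type because \<open>indep_var\<close> asks for it.\<close>

locale three_variables = prob_space M for M :: "'w measure" and NX :: "'a measure" and X and NY :: "'a measure" and Y and NZ :: "'c measure" and Z +
  assumes X [measurable]: "X \<in> M \<rightarrow>\<^sub>M NX" and Y [measurable]: "Y \<in> M \<rightarrow>\<^sub>M NY" and Z [measurable]: "Z \<in> M \<rightarrow>\<^sub>M NZ"
begin

abbreviation "\<sigma>Z \<equiv> vimage_algebra (space M) Z NZ"

sublocale finite_measure_subalgebra M \<sigma>Z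
  using subalgebra_vimage[OF Z] by unfold_locales

lemma cond_indep_var_iff:
  "cond_indep_var M NX X NY Y NZ Z \<longleftrightarrow>
    (\<forall>F\<in>sets NX. \<forall>G\<in>sets NY. cond_uncorrelated M \<sigma>Z (\<lambda>\<omega>. indicator F (X \<omega>)) (\<lambda>\<omega>. indicator G (Y \<omega>)))"
proof -
  have "(AE \<omega> in M.
          real_cond_exp M \<sigma>Z (indicator {w \<in> space M. X w \<in> F \<and> Y w \<in> G}) \<omega> =
          real_cond_exp M \<sigma>Z (indicator {w \<in> space M. X w \<in> F}) \<omega> *
          real_cond_exp M \<sigma>Z (indicator {w \<in> space M. Y w \<in> G}) \<omega>) \<longleftrightarrow>
      cond_uncorrelated M \<sigma>Z (\<lambda>\<omega>. indicator F (X \<omega>)) (\<lambda>\<omega>. indicator G (Y \<omega>))"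
    if [measurable]: "F \<in> sets NX" "G \<in> sets NY" for F G
  proof -
    have "AE \<omega> in M. real_cond_exp M \<sigma>Z (indicator {w \<in> space M. X w \<in> F \<and> Y w \<in> G}) \<omega> =
        real_cond_exp M \<sigma>Z (\<lambda>\<omega>. indicator F (X \<omega>) * indicator G (Y \<omega>)) \<omega>"
      by (rule real_cond_exp_cong) (auto simp: indicator_def)
    moreover have "AE \<omega> in M. real_cond_exp M \<sigma>Z (indicator {w \<in> space M. X w \<in> F}) \<omega> =
        real_cond_exp M \<sigma>Z (\<lambda>\<omega>. indicator F (X \<omega>)) \<omega>"
      by (rule real_cond_exp_cong) (auto simp: indicator_def)
    moreover have "AE \<omega> in M. real_cond_exp M \<sigma>Z (indicator {w \<in> space M. Y w \<in> G}) \<omega> =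
        real_cond_exp M \<sigma>Z (\<lambda>\<omega>. indicator G (Y \<omega>)) \<omega>"
      by (rule real_cond_exp_cong) (auto simp: indicator_def)
    ultimately show ?thesis
      unfolding cond_uncorrelated_def
    proof (intro iffI, goal_cases)
      case 1
      from 1(1-4) show ?case by eventually_elim (simp only:)
    next
      case 2
      from 2(1-4) show ?case by eventually_elim (simp only:)
    qed
  qed
  then show ?thesis
    unfolding cond_indep_var_def Let_def by simp
qed

lemma integral_indicator_Z:
  "(\<forall>H\<in>sets \<sigma>Z. P (indicator H)) \<longleftrightarrow> (\<forall>H\<in>sets NZ. P (indicator (Z -` H \<inter> space M)))"
  unfolding subalgebra_vimage(2)[OF Z] by blast

text \<open>The conditional expectation of the indicator of \<open>X \<in> F\<close> may be replaced by any function \<open>p\<close> of \<open>Z\<close> that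
  integrates correctly over the events of \<open>Z\<close>: conditional independence says that \<open>p\<close> still integrates correctly
  when an event of \<open>Y\<close> is added.\<close>

lemma cond_uncorrelated_version_iff:
  assumes F [measurable]: "F \<in> sets NX" and G [measurable]: "G \<in> sets NY"
    and p [measurable]: "p \<in> borel_measurable NZ" and p1: "\<And>z. \<bar>p z :: real\<bar> \<le> 1"
    and version: "\<And>H. H \<in> sets NZ \<Longrightarrow>
      (\<integral>\<omega>. indicator F (X \<omega>) * indicator H (Z \<omega>) \<partial>M) = (\<integral>\<omega>. p (Z \<omega>) * indicator H (Z \<omega>) \<partial>M)"
  shows "cond_uncorrelated M \<sigma>Z (\<lambda>\<omega>. indicator F (X \<omega>)) (\<lambda>\<omega>. indicator G (Y \<omega>)) \<longleftrightarrow>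
    (\<forall>H\<in>sets NZ. (\<integral>\<omega>. indicator F (X \<omega>) * indicator G (Y \<omega>) * indicator H (Z \<omega>) \<partial>M) =
      (\<integral>\<omega>. p (Z \<omega>) * indicator G (Y \<omega>) * indicator H (Z \<omega>) \<partial>M))"
proof -
  have pZ: "(\<lambda>\<omega>. p (Z \<omega>)) \<in> borel_measurable \<sigma>Z"
    by (rule measurable_vimage_compose[OF Z p])
  have AE: "AE \<omega> in M. real_cond_exp M \<sigma>Z (\<lambda>\<omega>. indicator F (X \<omega>)) \<omega> = p (Z \<omega>)"
  proof (rule real_cond_exp_charact[OF _ _ _ pZ])
    fix A assume "A \<in> sets \<sigma>Z"
    then obtain H where H: "H \<in> sets NZ" "A = Z -` H \<inter> space M"
      using subalgebra_vimage(2)[OF Z] by auto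
    have "(LINT \<omega>:A|M. u \<omega>) = (\<integral>\<omega>. u \<omega> * indicator H (Z \<omega>) \<partial>M)" for u :: "'w \<Rightarrow> real"
      unfolding set_lebesgue_integral_def H(2)
      by (intro Bochner_Integration.integral_cong) (auto simp: indicator_def)
    then show "(LINT \<omega>:A|M. indicator F (X \<omega>)) = (LINT \<omega>:A|M. p (Z \<omega>))"
      using version[OF H(1)] by simp
  qed (auto intro!: integrable_bounded_1 p1)
  have "(\<integral>\<omega>. indicator (Z -` H \<inter> space M) \<omega> * (indicator F (X \<omega>) - p (Z \<omega>)) * indicator G (Y \<omega>) \<partial>M) = 0 \<longleftrightarrow>
      (\<integral>\<omega>. indicator F (X \<omega>) * indicator G (Y \<omega>) * indicator H (Z \<omega>) \<partial>M) =
      (\<integral>\<omega>. p (Z \<omega>) * indicator G (Y \<omega>) * indicator H (Z \<omega>) \<partial>M)" if [measurable]: "H \<in> sets NZ" for H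
  proof -
    have "(\<integral>\<omega>. indicator (Z -` H \<inter> space M) \<omega> * (indicator F (X \<omega>) - p (Z \<omega>)) * indicator G (Y \<omega>) \<partial>M) =
        (\<integral>\<omega>. indicator F (X \<omega>) * indicator G (Y \<omega>) * indicator H (Z \<omega>) - p (Z \<omega>) * indicator G (Y \<omega>) * indicator H (Z \<omega>) \<partial>M)"
      by (intro Bochner_Integration.integral_cong) (auto simp: indicator_def)
    also have "\<dots> = (\<integral>\<omega>. indicator F (X \<omega>) * indicator G (Y \<omega>) * indicator H (Z \<omega>) \<partial>M) -
      (\<integral>\<omega>. p (Z \<omega>) * indicator G (Y \<omega>) * indicator H (Z \<omega>) \<partial>M)"
      using p1 by (intro Bochner_Integration.integral_diff integrable_bounded_1) (auto simp: indicator_def)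
    finally show ?thesis by simp
  qed
  moreover have "cond_uncorrelated M \<sigma>Z (\<lambda>\<omega>. indicator F (X \<omega>)) (\<lambda>\<omega>. indicator G (Y \<omega>)) \<longleftrightarrow>
    (\<forall>H\<in>sets \<sigma>Z. (\<integral>\<omega>. indicator H \<omega> * (indicator F (X \<omega>) - p (Z \<omega>)) * indicator G (Y \<omega>) \<partial>M) = 0)"
    by (subst cond_uncorrelated_commute, rule cond_uncorrelated_iff(1)[OF _ _ _ _ pZ AE]) auto
  ultimately show ?thesis
    unfolding integral_indicator_Z[of "\<lambda>u. (\<integral>\<omega>. u \<omega> * (indicator F (X \<omega>) - p (Z \<omega>)) * indicator G (Y \<omega>) \<partial>M) = 0"]
    by simp
qed

lemma indep_var_iff_integral:
  "indep_var NX X NY Y \<longleftrightarrow> (\<forall>F\<in>sets NX. \<forall>G\<in>sets NY.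
    (\<integral>\<omega>. indicat_real F (X \<omega>) * indicator G (Y \<omega>) \<partial>M) =
    (\<integral>\<omega>. indicat_real F (X \<omega>) \<partial>M) * (\<integral>\<omega>. indicat_real G (Y \<omega>) \<partial>M))"
proof -
  let ?SX = "{X -` F \<inter> space M | F. F \<in> sets NX}" and ?SY = "{Y -` G \<inter> space M | G. G \<in> sets NY}"
  have indX: "(\<integral>\<omega>. indicat_real F (X \<omega>) \<partial>M) = prob (X -` F \<inter> space M)" if "F \<in> sets NX" for F
  proof -
    have "(\<integral>\<omega>. indicat_real F (X \<omega>) \<partial>M) = (\<integral>\<omega>. indicator (X -` F \<inter> space M) \<omega> \<partial>M)"
      by (intro Bochner_Integration.integral_cong) (auto simp: indicator_def)
    then show ?thesis using that by simp
  qed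
  have indY: "(\<integral>\<omega>. indicat_real G (Y \<omega>) \<partial>M) = prob (Y -` G \<inter> space M)" if "G \<in> sets NY" for G
  proof -
    have "(\<integral>\<omega>. indicat_real G (Y \<omega>) \<partial>M) = (\<integral>\<omega>. indicator (Y -` G \<inter> space M) \<omega> \<partial>M)"
      by (intro Bochner_Integration.integral_cong) (auto simp: indicator_def)
    then show ?thesis using that by simp
  qed
  have indXY: "(\<integral>\<omega>. indicat_real F (X \<omega>) * indicator G (Y \<omega>) \<partial>M) =
      prob ((X -` F \<inter> space M) \<inter> (Y -` G \<inter> space M))" if [measurable]: "F \<in> sets NX" "G \<in> sets NY" for F G
  proof -
    have "(\<integral>\<omega>. indicat_real F (X \<omega>) * indicator G (Y \<omega>) \<partial>M) =
        (\<integral>\<omega>. indicator ((X -` F \<inter> space M) \<inter> (Y -` G \<inter> space M)) \<omega> \<partial>M)"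
      by (intro Bochner_Integration.integral_cong) (auto simp: indicator_def)
    then show ?thesis by simp
  qed
  have sX: "sigma_sets (space M) ?SX = ?SX" and sY: "sigma_sets (space M) ?SY = ?SY"
    using sets.sigma_sets_eq[of "vimage_algebra (space M) X NX"] sets.sigma_sets_eq[of "vimage_algebra (space M) Y NY"]
    by (simp_all add: subalgebra_vimage(2)[OF X] subalgebra_vimage(2)[OF Y])
  have "?SX \<subseteq> events" "?SY \<subseteq> events" by auto
  then have "indep_var NX X NY Y \<longleftrightarrow> (\<forall>a\<in>?SX. \<forall>b\<in>?SY. prob (a \<inter> b) = prob a * prob b)"
    unfolding indep_var_eq indep_sets2_eq sX sY using X Y by simp
  moreover have "(\<forall>a\<in>?SX. P a) \<longleftrightarrow> (\<forall>F\<in>sets NX. P (X -` F \<inter> space M))"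
    "(\<forall>b\<in>?SY. P b) \<longleftrightarrow> (\<forall>G\<in>sets NY. P (Y -` G \<inter> space M))" for P by auto
  ultimately show ?thesis by (simp add: indX indY indXY)
qed

text \<open>If every event of \<open>Z\<close> has probability \<open>0\<close> or \<open>1\<close>, conditional expectations given \<open>Z\<close> are constants.\<close>

lemma cond_indep_var_trivial:
  assumes trivial: "\<And>H. H \<in> sets NZ \<Longrightarrow> (AE \<omega> in M. Z \<omega> \<in> H) \<or> (AE \<omega> in M. Z \<omega> \<notin> H)"
  shows "cond_indep_var M NX X NY Y NZ Z \<longleftrightarrow> indep_var NX X NY Y"
proof -
  have cexp: "AE \<omega> in M. real_cond_exp M \<sigma>Z U \<omega> = expectation U"
    if U [measurable]: "U \<in> borel_measurable M" and U1: "\<And>\<omega>. \<bar>U \<omega>\<bar> \<le> 1" for U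
  proof (rule real_cond_exp_charact)
    fix S assume "S \<in> sets \<sigma>Z"
    then obtain H where H [measurable]: "H \<in> sets NZ" and S: "S = Z -` H \<inter> space M"
      using subalgebra_vimage(2)[OF Z] by auto
    have [measurable]: "S \<in> sets M" unfolding S by measurable
    have "\<exists>c. AE \<omega> in M. indicator S \<omega> = (c :: real)"
      using trivial[OF H]
    proof
      assume "AE \<omega> in M. Z \<omega> \<in> H"
      then have "AE \<omega> in M. indicator S \<omega> = (1 :: real)" using AE_space by eventually_elim (simp add: S)
      then show ?thesis ..
    next
      assume "AE \<omega> in M. Z \<omega> \<notin> H"
      then have "AE \<omega> in M. indicator S \<omega> = (0 :: real)" by eventually_elim (simp add: S)
      then show ?thesis ..
    qed
    then obtain c :: real where c: "AE \<omega> in M. indicator S \<omega> = c" by blast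
    have "(LINT \<omega>:S|M. u \<omega>) = c * expectation u" if [measurable]: "u \<in> borel_measurable M" for u
    proof -
      have "(LINT \<omega>:S|M. u \<omega>) = (\<integral>\<omega>. c * u \<omega> \<partial>M)"
        unfolding set_lebesgue_integral_def
      proof (rule integral_cong_AE)
        show "AE \<omega> in M. indicator S \<omega> *\<^sub>R u \<omega> = c * u \<omega>" using c by eventually_elim simp
      qed measurable
      then show ?thesis by simp
    qed
    then show "(LINT \<omega>:S|M. U \<omega>) = (LINT \<omega>:S|M. expectation U)" by (simp add: prob_space)
  qed (use U U1 in \<open>auto intro: integrable_bounded_1\<close>)
  have "cond_uncorrelated M \<sigma>Z U W \<longleftrightarrow> (\<integral>\<omega>. U \<omega> * W \<omega> \<partial>M) = expectation U * expectation W"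
    if [measurable]: "U \<in> borel_measurable M" "W \<in> borel_measurable M" and le: "\<And>\<omega>. \<bar>U \<omega>\<bar> \<le> 1" "\<And>\<omega>. \<bar>W \<omega>\<bar> \<le> 1" for U W
  proof -
    have "\<bar>U \<omega> * W \<omega>\<bar> \<le> 1" for \<omega> using mult_mono[OF le] by (simp add: abs_mult)
    then have "AE \<omega> in M. real_cond_exp M \<sigma>Z (\<lambda>\<omega>. U \<omega> * W \<omega>) \<omega> = (\<integral>\<omega>. U \<omega> * W \<omega> \<partial>M)"
      by (intro cexp) auto
    moreover have "AE \<omega> in M. real_cond_exp M \<sigma>Z U \<omega> = expectation U" "AE \<omega> in M. real_cond_exp M \<sigma>Z W \<omega> = expectation W"
      using le by (auto intro!: cexp)
    ultimately have "AE \<omega> in M. (real_cond_exp M \<sigma>Z (\<lambda>\<omega>. U \<omega> * W \<omega>) \<omega> = real_cond_exp M \<sigma>Z U \<omega> * real_cond_exp M \<sigma>Z W \<omega>) \<longleftrightarrow>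
        (\<integral>\<omega>. U \<omega> * W \<omega> \<partial>M) = expectation U * expectation W"
      by eventually_elim simp
    note eq = this
    show ?thesis
    proof
      assume "cond_uncorrelated M \<sigma>Z U W"
      with eq have "AE \<omega> in M. (\<integral>\<omega>. U \<omega> * W \<omega> \<partial>M) = expectation U * expectation W"
        unfolding cond_uncorrelated_def by eventually_elim simp
      then show "(\<integral>\<omega>. U \<omega> * W \<omega> \<partial>M) = expectation U * expectation W" by simp
    next
      assume "(\<integral>\<omega>. U \<omega> * W \<omega> \<partial>M) = expectation U * expectation W"
      with eq show "cond_uncorrelated M \<sigma>Z U W" unfolding cond_uncorrelated_def by simp
    qed
  qed
  then show ?thesis
    unfolding cond_indep_var_iff indep_var_iff_integral by simp
qed

end

lemma ennreal_mult_le_1: "x \<le> 1 \<Longrightarrow> y \<le> 1 \<Longrightarrow> x * y \<le> (1 :: ennreal)"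
  using mult_mono[of x 1 y 1] by simp

lemma enn2real_indicator: "enn2real (indicator S x) = indicator S x"
  by (simp add: indicator_def)

lemma indicator_le_1_ennreal: "indicator S x \<le> (1 :: ennreal)"
  by (simp add: indicator_def)

lemma (in prob_space) nn_integral_eq_integral_bounded:
  assumes "u \<in> borel_measurable M" "\<And>\<omega>. u \<omega> \<le> (1 :: ennreal)"
  shows "(\<integral>\<^sup>+\<omega>. u \<omega> \<partial>M) = ennreal (\<integral>\<omega>. enn2real (u \<omega>) \<partial>M)"
proof -
  have fin: "u \<omega> < \<top>" for \<omega> using assms(2)[of \<omega>] by (metis ennreal_one_less_top le_less_trans)
  have "enn2real (u \<omega>) \<le> 1" for \<omega> using enn2real_mono[OF assms(2)] by simp
  then have "integrable M (\<lambda>\<omega>. enn2real (u \<omega>))"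
    using assms(1) by (intro integrable_const_bound[where B=1]) auto
  then have "(\<integral>\<^sup>+\<omega>. ennreal (enn2real (u \<omega>)) \<partial>M) = ennreal (\<integral>\<omega>. enn2real (u \<omega>) \<partial>M)"
    by (rule nn_integral_eq_integral) auto
  then show ?thesis using fin by simp
qed

context three_variables
begin

lemma nn_integral_eq_iff:
  assumes "u \<in> borel_measurable M" "\<And>\<omega>. u \<omega> \<le> (1 :: ennreal)" "v \<in> borel_measurable M" "\<And>\<omega>. v \<omega> \<le> (1 :: ennreal)"
  shows "(\<integral>\<^sup>+\<omega>. u \<omega> \<partial>M) = (\<integral>\<^sup>+\<omega>. v \<omega> \<partial>M) \<longleftrightarrow> (\<integral>\<omega>. enn2real (u \<omega>) \<partial>M) = (\<integral>\<omega>. enn2real (v \<omega>) \<partial>M)"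
proof -
  have "0 \<le> (\<integral>\<omega>. enn2real (w \<omega>) \<partial>M)" for w by (rule integral_nonneg_AE) simp
  then show ?thesis
    unfolding nn_integral_eq_integral_bounded[OF assms(1,2)] nn_integral_eq_integral_bounded[OF assms(3,4)]
    by (simp add: ennreal_inj)
qed

lemma cond_uncorrelated_version_iff_nn:
  assumes F [measurable]: "F \<in> sets NX" and G [measurable]: "G \<in> sets NY"
    and p [measurable]: "p \<in> borel_measurable NZ" and p1: "\<And>z. p z \<le> (1 :: ennreal)"
    and version: "\<And>H. H \<in> sets NZ \<Longrightarrow>
      (\<integral>\<^sup>+\<omega>. indicator F (X \<omega>) * indicator H (Z \<omega>) \<partial>M) = (\<integral>\<^sup>+\<omega>. p (Z \<omega>) * indicator H (Z \<omega>) \<partial>M)"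
  shows "cond_uncorrelated M \<sigma>Z (\<lambda>\<omega>. indicator F (X \<omega>)) (\<lambda>\<omega>. indicator G (Y \<omega>)) \<longleftrightarrow>
    (\<forall>H\<in>sets NZ. (\<integral>\<^sup>+\<omega>. indicator F (X \<omega>) * indicator G (Y \<omega>) * indicator H (Z \<omega>) \<partial>M) =
      (\<integral>\<^sup>+\<omega>. p (Z \<omega>) * indicator G (Y \<omega>) * indicator H (Z \<omega>) \<partial>M))"
proof -
  have p': "\<bar>enn2real (p z)\<bar> \<le> 1" for z using enn2real_mono[OF p1[of z]] by simp
  note le = ennreal_mult_le_1 indicator_le_1_ennreal p1
  have "(\<integral>\<omega>. indicator F (X \<omega>) * indicator H (Z \<omega>) \<partial>M) = (\<integral>\<omega>. enn2real (p (Z \<omega>)) * indicator H (Z \<omega>) \<partial>M)"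
    if H [measurable]: "H \<in> sets NZ" for H
    using version[OF H] by (subst (asm) nn_integral_eq_iff) (auto intro!: le simp: enn2real_mult enn2real_indicator)
  note iff = cond_uncorrelated_version_iff[OF F G _ p' this]
  have "(\<integral>\<^sup>+\<omega>. indicator F (X \<omega>) * indicator G (Y \<omega>) * indicator H (Z \<omega>) \<partial>M) =
      (\<integral>\<^sup>+\<omega>. p (Z \<omega>) * indicator G (Y \<omega>) * indicator H (Z \<omega>) \<partial>M) \<longleftrightarrow>
    (\<integral>\<omega>. indicator F (X \<omega>) * indicator G (Y \<omega>) * indicator H (Z \<omega>) \<partial>M) =
      (\<integral>\<omega>. enn2real (p (Z \<omega>)) * indicator G (Y \<omega>) * indicator H (Z \<omega>) \<partial>M)" if [measurable]: "H \<in> sets NZ" for H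
    by (subst nn_integral_eq_iff) (auto intro!: le simp: enn2real_mult enn2real_indicator)
  then show ?thesis using iff by simp
qed

text \<open>Conditional independence in terms of versions with values in \<open>[0, \<infinity>]\<close>, as they arise from \<open>\<Lambda>\<close>.\<close>

lemma cond_indep_varD:
  assumes "cond_indep_var M NX X NY Y NZ Z"
    and "F \<in> sets NX" "G \<in> sets NY" "p \<in> borel_measurable NZ" "\<And>z. p z \<le> (1 :: ennreal)"
    and "\<And>H. H \<in> sets NZ \<Longrightarrow>
      (\<integral>\<^sup>+\<omega>. indicator F (X \<omega>) * indicator H (Z \<omega>) \<partial>M) = (\<integral>\<^sup>+\<omega>. p (Z \<omega>) * indicator H (Z \<omega>) \<partial>M)"
    and "H \<in> sets NZ"
  shows "(\<integral>\<^sup>+\<omega>. indicator F (X \<omega>) * indicator G (Y \<omega>) * indicator H (Z \<omega>) \<partial>M) =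
      (\<integral>\<^sup>+\<omega>. p (Z \<omega>) * indicator G (Y \<omega>) * indicator H (Z \<omega>) \<partial>M)"
  using assms(1) cond_uncorrelated_version_iff_nn[OF assms(2-6)] assms(2,3,7) by (simp add: cond_indep_var_iff)

lemma cond_indep_varI:
  assumes "\<And>F. F \<in> sets NX \<Longrightarrow> \<exists>p. p \<in> borel_measurable NZ \<and> (\<forall>z. p z \<le> (1 :: ennreal)) \<and>
    (\<forall>G\<in>sets NY. \<forall>H\<in>sets NZ. (\<integral>\<^sup>+\<omega>. indicator F (X \<omega>) * indicator G (Y \<omega>) * indicator H (Z \<omega>) \<partial>M) =
      (\<integral>\<^sup>+\<omega>. p (Z \<omega>) * indicator G (Y \<omega>) * indicator H (Z \<omega>) \<partial>M))"
  shows "cond_indep_var M NX X NY Y NZ Z"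
  unfolding cond_indep_var_iff
proof (intro ballI)
  fix F G assume F: "F \<in> sets NX" and G: "G \<in> sets NY"
  obtain p where p: "p \<in> borel_measurable NZ" "\<And>z. p z \<le> (1 :: ennreal)"
    and eq: "\<And>G H. G \<in> sets NY \<Longrightarrow> H \<in> sets NZ \<Longrightarrow> (\<integral>\<^sup>+\<omega>. indicator F (X \<omega>) * indicator G (Y \<omega>) * indicator H (Z \<omega>) \<partial>M) =
      (\<integral>\<^sup>+\<omega>. p (Z \<omega>) * indicator G (Y \<omega>) * indicator H (Z \<omega>) \<partial>M)"
    using assms[OF F] by blast
  have "(\<integral>\<^sup>+\<omega>. u \<omega> * indicator (space NY) (Y \<omega>) * v \<omega> \<partial>M) = (\<integral>\<^sup>+\<omega>. u \<omega> * v \<omega> \<partial>M)" for u v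
    using measurable_space[OF Y] by (intro nn_integral_cong) simp
  then have "(\<integral>\<^sup>+\<omega>. indicator F (X \<omega>) * indicator H (Z \<omega>) \<partial>M) = (\<integral>\<^sup>+\<omega>. p (Z \<omega>) * indicator H (Z \<omega>) \<partial>M)" if "H \<in> sets NZ" for H
    using eq[OF sets.top that] by simp
  then show "cond_uncorrelated M \<sigma>Z (\<lambda>\<omega>. indicator F (X \<omega>)) (\<lambda>\<omega>. indicator G (Y \<omega>))"
    using cond_uncorrelated_version_iff_nn[OF F G p] eq[OF G] by blast
qed

end

text \<open>Conditional independence of point processes may be tested on Laplace functionals: these and the
  indicators of events are orthogonal to the same integrable functions.\<close>

lemma cond_indep_Npoint_iff:
  assumes M: "prob_space M" and X: "X \<in> M \<rightarrow>\<^sub>M Npoint (E1 :: 'a measure)" and Y: "Y \<in> M \<rightarrow>\<^sub>M Npoint (E2 :: 'a measure)" and Z: "Z \<in> M \<rightarrow>\<^sub>M NZ"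
  shows "cond_indep_var M (Npoint E1) X (Npoint E2) Y NZ Z \<longleftrightarrow>
    (\<forall>f\<in>borel_measurable E1. \<forall>g\<in>borel_measurable E2.
      cond_uncorrelated M (vimage_algebra (space M) Z NZ)
        (\<lambda>\<omega>. expn (\<integral>\<^sup>+y. f y \<partial>X \<omega>)) (\<lambda>\<omega>. expn (\<integral>\<^sup>+y. g y \<partial>Y \<omega>)))"
proof -
  interpret three_variables M "Npoint E1" X "Npoint E2" Y NZ Z
    using assms by (simp add: three_variables_def three_variables_axioms_def)
  define LX where "LX = (\<lambda>f \<omega>. expn (\<integral>\<^sup>+y. f y \<partial>X \<omega>)) ` borel_measurable E1"
  define LY where "LY = (\<lambda>g \<omega>. expn (\<integral>\<^sup>+y. g y \<partial>Y \<omega>)) ` borel_measurable E2"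
  define IX where "IX = (\<lambda>F \<omega>. indicator F (X \<omega>) :: real) ` sets (Npoint E1)"
  define IY where "IY = (\<lambda>G \<omega>. indicator G (Y \<omega>) :: real) ` sets (Npoint E2)"
  note mX = measurable_nn_integral_process[OF X] and mY = measurable_nn_integral_process[OF Y]
  have LX: "u \<in> borel_measurable M" "\<bar>u \<omega>\<bar> \<le> 1" if "u \<in> LX" for u \<omega>
    using that mX by (auto simp: LX_def)
  have LY: "u \<in> borel_measurable M" "\<bar>u \<omega>\<bar> \<le> 1" if "u \<in> LY" for u \<omega>
    using that mY by (auto simp: LY_def)
  have IX: "u \<in> borel_measurable M" "\<bar>u \<omega>\<bar> \<le> 1" if "u \<in> IX" for u \<omega>
    using that X by (auto simp: IX_def)
  have IY: "u \<in> borel_measurable M" "\<bar>u \<omega>\<bar> \<le> 1" if "u \<in> IY" for u \<omega>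
    using that Y by (auto simp: IY_def)
  have "(\<forall>u\<in>IX. \<forall>w\<in>IY. cond_uncorrelated M \<sigma>Z u w) \<longleftrightarrow> (\<forall>u\<in>LX. \<forall>w\<in>LY. cond_uncorrelated M \<sigma>Z u w)"
  proof (intro iffI ballI)
    fix u w assume uw: "u \<in> LX" "w \<in> LY" and unc: "\<forall>u\<in>IX. \<forall>w\<in>IY. cond_uncorrelated M \<sigma>Z u w"
    show "cond_uncorrelated M \<sigma>Z u w"
    proof (rule cond_uncorrelated_extend[of IX IY])
      fix T :: "_ \<Rightarrow> real" assume T: "integrable M T" and "\<And>u. u \<in> IX \<Longrightarrow> (\<integral>\<omega>. T \<omega> * u \<omega> \<partial>M) = 0"
      then have z: "(\<integral>\<omega>. T \<omega> * indicator F (X \<omega>) \<partial>M) = 0" if "F \<in> sets (Npoint E1)" for F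
        using that by (auto simp: IX_def)
      obtain f where f: "f \<in> borel_measurable E1" "u = (\<lambda>\<omega>. expn (\<integral>\<^sup>+y. f y \<partial>X \<omega>))"
        using uw(1) by (auto simp: LX_def)
      show "(\<integral>\<omega>. T \<omega> * u \<omega> \<partial>M) = 0"
        unfolding f(2) using measurable_nn_integral_Npoint[OF f(1)]
        by (intro integral_bounded_function_eq_0[OF M X T z, of "\<lambda>\<mu>. expn (\<integral>\<^sup>+y. f y \<partial>\<mu>)"]) auto
    next
      fix T :: "_ \<Rightarrow> real" assume T: "integrable M T" and "\<And>w. w \<in> IY \<Longrightarrow> (\<integral>\<omega>. T \<omega> * w \<omega> \<partial>M) = 0"
      then have z: "(\<integral>\<omega>. T \<omega> * indicator F (Y \<omega>) \<partial>M) = 0" if "F \<in> sets (Npoint E2)" for F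
        using that by (auto simp: IY_def)
      obtain f where f: "f \<in> borel_measurable E2" "w = (\<lambda>\<omega>. expn (\<integral>\<^sup>+y. f y \<partial>Y \<omega>))"
        using uw(2) by (auto simp: LY_def)
      show "(\<integral>\<omega>. T \<omega> * w \<omega> \<partial>M) = 0"
        unfolding f(2) using measurable_nn_integral_Npoint[OF f(1)]
        by (intro integral_bounded_function_eq_0[OF M Y T z, of "\<lambda>\<mu>. expn (\<integral>\<^sup>+y. f y \<partial>\<mu>)"]) auto
    qed (use uw unc IX IY LX LY in auto)
  next
    fix u w assume uw: "u \<in> IX" "w \<in> IY" and unc: "\<forall>u\<in>LX. \<forall>w\<in>LY. cond_uncorrelated M \<sigma>Z u w"
    show "cond_uncorrelated M \<sigma>Z u w"
    proof (rule cond_uncorrelated_extend[of LX LY])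
      fix T :: "_ \<Rightarrow> real" assume T: "integrable M T" and "\<And>u. u \<in> LX \<Longrightarrow> (\<integral>\<omega>. T \<omega> * u \<omega> \<partial>M) = 0"
      then have z: "(\<integral>\<omega>. T \<omega> * expn (\<integral>\<^sup>+y. f y \<partial>X \<omega>) \<partial>M) = 0" if "f \<in> borel_measurable E1" for f
        using that by (auto simp: LX_def)
      show "(\<integral>\<omega>. T \<omega> * u \<omega> \<partial>M) = 0"
        using uw(1) integral_Npoint_eq_0[OF M X T z] by (auto simp: IX_def)
    next
      fix T :: "_ \<Rightarrow> real" assume T: "integrable M T" and "\<And>w. w \<in> LY \<Longrightarrow> (\<integral>\<omega>. T \<omega> * w \<omega> \<partial>M) = 0"
      then have z: "(\<integral>\<omega>. T \<omega> * expn (\<integral>\<^sup>+y. f y \<partial>Y \<omega>) \<partial>M) = 0" if "f \<in> borel_measurable E2" for f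
        using that by (auto simp: LY_def)
      show "(\<integral>\<omega>. T \<omega> * w \<omega> \<partial>M) = 0"
        using uw(2) integral_Npoint_eq_0[OF M Y T z] by (auto simp: IY_def)
    qed (use uw unc IX IY LX LY in auto)
  qed
  then show ?thesis
    unfolding cond_indep_var_iff by (simp add: IX_def IY_def LX_def LY_def)
qed

section \<open>Locally finite explosive measures and densities given a projection\<close>

text \<open>Two measures that agree below each member of a countable cover agree on the union. Here they are the
  images under \<open>\<pi>\<close> of the measures with densities \<open>k1\<close> and \<open>k2\<close>.\<close>

lemma nn_integral_eq_on_cover:
  fixes A :: "nat \<Rightarrow> 'b set"
  assumes \<pi> [measurable]: "\<pi> \<in> M \<rightarrow>\<^sub>M N"
    and k [measurable]: "k1 \<in> borel_measurable M" "k2 \<in> borel_measurable M"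
    and A: "\<And>n. A n \<in> sets N"
    and eq: "\<And>n H. H \<in> sets N \<Longrightarrow> H \<subseteq> A n \<Longrightarrow>
      (\<integral>\<^sup>+y. indicator H (\<pi> y) * k1 y \<partial>M) = (\<integral>\<^sup>+y. indicator H (\<pi> y) * k2 y \<partial>M)"
    and \<phi> [measurable]: "\<phi> \<in> borel_measurable N" and supp: "\<And>x. x \<in> space N \<Longrightarrow> x \<notin> (\<Union>n. A n) \<Longrightarrow> \<phi> x = 0"
  shows "(\<integral>\<^sup>+y. \<phi> (\<pi> y) * k1 y \<partial>M) = (\<integral>\<^sup>+y. \<phi> (\<pi> y) * k2 y \<partial>M)"
proof -
  let ?U = "\<Union>n. A n"
  have U [measurable]: "?U \<in> sets N" using A by auto
  define \<mu> where "\<mu> k = distr (density M (\<lambda>y. indicator ?U (\<pi> y) * k y)) N \<pi>" for k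
  have \<mu>_eq: "emeasure (\<mu> k) H = (\<integral>\<^sup>+y. indicator (H \<inter> ?U) (\<pi> y) * k y \<partial>M)"
    if [measurable]: "H \<in> sets N" "k \<in> borel_measurable M" for H k
  proof -
    have "emeasure (\<mu> k) H = (\<integral>\<^sup>+y. indicator ?U (\<pi> y) * k y * indicator (\<pi> -` H \<inter> space M) y \<partial>M)"
      unfolding \<mu>_def by (subst emeasure_distr) (simp_all add: emeasure_density)
    also have "\<dots> = (\<integral>\<^sup>+y. indicator (H \<inter> ?U) (\<pi> y) * k y \<partial>M)"
      by (intro nn_integral_cong) (auto simp: indicator_def)
    finally show ?thesis .
  qed
  have "\<mu> k1 = \<mu> k2"
  proof (rule measure_eqI)
    show "sets (\<mu> k1) = sets (\<mu> k2)" by (simp add: \<mu>_def)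
    fix H assume "H \<in> sets (\<mu> k1)"
    then have H [measurable]: "H \<in> sets N" by (simp add: \<mu>_def)
    let ?D = "\<lambda>n. H \<inter> disjointed A n"
    have D: "?D n \<in> sets N" "?D n \<subseteq> A n" for n
    proof -
      have "range A \<subseteq> sets N" using A by auto
      then have "range (disjointed A) \<subseteq> sets N" by (rule sets.range_disjointed_sets)
      then show "?D n \<in> sets N" using H by auto
      show "?D n \<subseteq> A n" using disjointed_subset[of A n] by auto
    qed
    have un: "(\<Union>n. ?D n) = H \<inter> ?U" using UN_disjointed_eq[of A] by auto
    have "emeasure (\<mu> k) H = (\<Sum>n. emeasure (\<mu> k) (?D n))" if k [measurable]: "k \<in> borel_measurable M" for k
    proof -
      have "(\<Sum>n. emeasure (\<mu> k) (?D n)) = emeasure (\<mu> k) (\<Union>n. ?D n)"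
        using D(1) disjoint_family_disjointed[of A]
        by (intro suminf_emeasure) (auto simp: \<mu>_def disjoint_family_on_def)
      also have "\<dots> = emeasure (\<mu> k) H"
        unfolding un using \<mu>_eq[OF H k] \<mu>_eq[of "H \<inter> ?U" k] k U H by (simp add: Int_assoc)
      finally show ?thesis by simp
    qed
    moreover have "emeasure (\<mu> k1) (?D n) = emeasure (\<mu> k2) (?D n)" for n
    proof -
      have "?D n \<inter> ?U = ?D n" using D(2) by blast
      then show ?thesis using \<mu>_eq[OF D(1)] eq[OF D] by simp
    qed
    ultimately show "emeasure (\<mu> k1) H = emeasure (\<mu> k2) H" by simp
  qed
  moreover have "(\<integral>\<^sup>+y. \<phi> (\<pi> y) * k y \<partial>M) = (\<integral>\<^sup>+x. \<phi> x \<partial>\<mu> k)" if [measurable]: "k \<in> borel_measurable M" for k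
  proof -
    have "(\<integral>\<^sup>+x. \<phi> x \<partial>\<mu> k) = (\<integral>\<^sup>+y. indicator ?U (\<pi> y) * k y * \<phi> (\<pi> y) \<partial>M)"
      unfolding \<mu>_def by (simp add: nn_integral_distr nn_integral_density)
    also have "\<dots> = (\<integral>\<^sup>+y. \<phi> (\<pi> y) * k y \<partial>M)"
    proof (intro nn_integral_cong)
      fix y assume "y \<in> space M"
      then have "\<pi> y \<in> space N" by (rule measurable_space[OF \<pi>])
      then show "indicator ?U (\<pi> y) * k y * \<phi> (\<pi> y) = \<phi> (\<pi> y) * k y"
        using supp[of "\<pi> y"] by (cases "\<pi> y \<in> ?U") (auto simp: mult.commute)
    qed
    finally show ?thesis by simp
  qed
  ultimately show ?thesis by simp
qed

lemma nn_integral_eq_of_sets: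
  assumes "\<pi> \<in> M \<rightarrow>\<^sub>M N" "k1 \<in> borel_measurable M" "k2 \<in> borel_measurable M"
    and "\<And>H. H \<in> sets N \<Longrightarrow>
      (\<integral>\<^sup>+y. indicator H (\<pi> y) * k1 y \<partial>M) = (\<integral>\<^sup>+y. indicator H (\<pi> y) * k2 y \<partial>M)"
    and "\<phi> \<in> borel_measurable N"
  shows "(\<integral>\<^sup>+y. \<phi> (\<pi> y) * k1 y \<partial>M) = (\<integral>\<^sup>+y. \<phi> (\<pi> y) * k2 y \<partial>M)"
proof (rule nn_integral_eq_on_cover[where A="\<lambda>_. space N", OF assms(1-3) sets.top assms(4) assms(5)])
  fix x assume "x \<in> space N" "x \<notin> (\<Union>n::nat. space N)"
  then show "\<phi> x = 0" by simp
qed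

lemma space_Reuc: "space (Reuc I) = PiE I (\<lambda>_. UNIV)"
  by (simp add: Reuc_def space_PiM)

lemma origin_in_space [simp]: "origin I \<in> space (Reuc I)"
  by (simp add: space_Reuc origin_def)

lemma restrict_in_space [simp]: "restrict y I \<in> space (Reuc I)"
  by (simp add: space_Reuc)

lemma restrict_eq_origin_iff: "restrict y I = origin I \<longleftrightarrow> (\<forall>v\<in>I. y v = 0)"
  by (auto simp: origin_def fun_eq_iff restrict_def)

lemma origin_sets [simp]:
  assumes "finite I"
  shows "{origin I} \<in> sets (Reuc I)"
proof -
  have "{origin I} = space (Reuc I) - space (Epunct I)"
    by (auto simp: Epunct_def space_restrict_space)
  then show ?thesis using sets.compl_sets[OF space_Epunct_in_sets[OF assms]] by simp
qed

text \<open>The layers exhaust the complement of the origin and stay away from it, so a locally finite measure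
  has finite mass on them.\<close>

definition layer :: "'v set \<Rightarrow> nat \<Rightarrow> ('v \<Rightarrow> real) set" where
  "layer I n = {z \<in> space (Reuc I). \<exists>v\<in>I. 1 / real (Suc n) < \<bar>z v\<bar>}"

lemma measurable_coord: "v \<in> I \<Longrightarrow> (\<lambda>y. y v) \<in> borel_measurable (Reuc I)"
  unfolding Reuc_def by measurable

lemma layer_sets [simp]: "finite I \<Longrightarrow> layer I n \<in> sets (Reuc I)"
  unfolding layer_def
proof (intro sets.sets_Collect_finite_Ex)
  fix v assume "v \<in> I"
  then have [measurable]: "(\<lambda>y. y v) \<in> borel_measurable (Reuc I)" by (rule measurable_coord)
  show "{z \<in> space (Reuc I). 1 / real (Suc n) < \<bar>z v\<bar>} \<in> sets (Reuc I)" by measurable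
qed

lemma origin_notin_layer [simp]: "origin I \<notin> layer I n"
  by (auto simp: layer_def origin_def)

lemma UN_layer: "(\<Union>n. layer I n) = space (Reuc I) - {origin I}"
proof (intro set_eqI iffI)
  fix z assume z: "z \<in> space (Reuc I) - {origin I}"
  then have "restrict z I = z" by (auto simp: space_Reuc PiE_def extensional_restrict)
  then have "\<exists>v\<in>I. z v \<noteq> 0"
    using z restrict_eq_origin_iff[of z I] by auto
  then obtain v where v: "v \<in> I" "z v \<noteq> 0" by blast
  then obtain n where "inverse (real (Suc n)) < \<bar>z v\<bar>"
    using reals_Archimedean[of "\<bar>z v\<bar>"] by auto
  then show "z \<in> (\<Union>n. layer I n)"
    using v z by (auto simp: layer_def inverse_eq_divide)
qed (auto simp: layer_def origin_def)

text \<open>The function \<open>p\<close> is a version of the conditional expectation of \<open>u\<close> given \<open>y\<^sub>C\<close> under the \<open>\<sigma>\<close>-finite part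
  of \<open>\<Lambda>\<close> on \<open>y\<^sub>C \<noteq> 0\<close>. Test functions vanish at the origin because nothing is claimed there, where \<open>\<Lambda>\<close>
  may have an atom of infinite mass.\<close>

definition cond_version :: "('v \<Rightarrow> real) measure \<Rightarrow> 'v set \<Rightarrow> (('v \<Rightarrow> real) \<Rightarrow> ennreal) \<Rightarrow> (('v \<Rightarrow> real) \<Rightarrow> ennreal) \<Rightarrow> bool" where
  "cond_version \<Lambda> C u p \<longleftrightarrow> p \<in> borel_measurable (Reuc C) \<and>
    (\<forall>\<phi>\<in>borel_measurable (Reuc C). \<phi> (origin C) = 0 \<longrightarrow>
      (\<integral>\<^sup>+y. \<phi> (restrict y C) * u y \<partial>\<Lambda>) = (\<integral>\<^sup>+y. \<phi> (restrict y C) * p (restrict y C) \<partial>\<Lambda>))"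

text \<open>The property that links both notions of conditional independence. The second part says that a
  version of the conditional probability of \<open>y\<^sub>A \<in> F\<close> given \<open>y\<^sub>C\<close> remains one when \<open>y\<^sub>B \<in> G\<close> is known in addition.\<close>

definition factorizes :: "('v \<Rightarrow> real) measure \<Rightarrow> 'v set \<Rightarrow> 'v set \<Rightarrow> 'v set \<Rightarrow> bool" where
  "factorizes \<Lambda> A B C \<longleftrightarrow>
    emeasure \<Lambda> {y \<in> space \<Lambda>. restrict y C = origin C \<and> restrict y A \<noteq> origin A \<and> restrict y B \<noteq> origin B} = 0 \<and>
    (\<forall>F\<in>sets (Reuc A). \<exists>p\<in>borel_measurable (Reuc C). \<forall>G\<in>sets (Reuc B). \<forall>H\<in>sets (Reuc C). origin C \<notin> H \<longrightarrow>
      (\<integral>\<^sup>+y. indicator H (restrict y C) * (indicator G (restrict y B) * indicator F (restrict y A)) \<partial>\<Lambda>) =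
      (\<integral>\<^sup>+y. indicator H (restrict y C) * (indicator G (restrict y B) * p (restrict y C)) \<partial>\<Lambda>))"

locale explosive_measure =
  fixes V :: "'v set" and \<Lambda> :: "('v \<Rightarrow> real) measure"
  assumes finite_V: "finite V"
    and sets_\<Lambda>: "sets \<Lambda> = sets (Epunct V)"
    and locally_finite: "\<And>G. G \<in> sets (Reuc V) \<Longrightarrow> origin V \<notin> Rtop V closure_of G \<Longrightarrow> emeasure \<Lambda> G < \<infinity>"
    and explosive: "\<And>D v. D \<subseteq> V \<Longrightarrow> v \<in> D \<Longrightarrow>
           emeasure \<Lambda> {y \<in> space (Epunct V). y v \<noteq> 0 \<and> restrict y (V - D) = origin (V - D)} \<in> {0, \<infinity>}"
begin

abbreviation lambda_integral :: "(('v \<Rightarrow> real) \<Rightarrow> ennreal) \<Rightarrow> ennreal" (binder "LI " 10) where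
  "lambda_integral f \<equiv> integral\<^sup>N \<Lambda> f"

lemma space_\<Lambda>: "space \<Lambda> = space (Epunct V)"
  using sets_\<Lambda> by (rule sets_eq_imp_space_eq)

lemma space_\<Lambda>_alt: "space \<Lambda> = space (Reuc V) - {origin V}"
  by (auto simp: space_\<Lambda> Epunct_def space_restrict_space)

lemma space_\<Lambda>_sets: "space \<Lambda> \<in> sets (Reuc V)"
  unfolding space_\<Lambda> by (rule space_Epunct_in_sets[OF finite_V])

lemma sets_\<Lambda>_iff: "S \<in> sets \<Lambda> \<longleftrightarrow> S \<in> sets (Reuc V) \<and> S \<subseteq> space \<Lambda>"
  using space_\<Lambda>_sets unfolding sets_\<Lambda> space_\<Lambda>
  by (subst Epunct_def, subst sets_restrict_space_iff) (auto simp: Epunct_def space_restrict_space)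

lemma finite_sub: "I \<subseteq> V \<Longrightarrow> finite I"
  using finite_V finite_subset by blast

lemma measurable_restrict_\<Lambda> [measurable]: "I \<subseteq> V \<Longrightarrow> (\<lambda>y. restrict y I) \<in> \<Lambda> \<rightarrow>\<^sub>M Reuc I"
  by (rule measurable_restrict_Epunct[OF sets_\<Lambda>])

lemma measurable_coord_\<Lambda>: "v \<in> V \<Longrightarrow> (\<lambda>y. y v) \<in> borel_measurable \<Lambda>"
  using measurable_coord[of v V] unfolding Epunct_def
  by (simp add: measurable_cong_sets[OF sets_\<Lambda> refl] Epunct_def measurable_restrict_space1)

lemma sets_restrict_preimage:
  assumes "I \<subseteq> V" "F \<in> sets (Reuc I)"
  shows "{y \<in> space \<Lambda>. restrict y I \<in> F} \<in> sets \<Lambda>"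
  using measurable_sets[OF measurable_restrict_\<Lambda>[OF assms(1)] assms(2)] by (simp add: vimage_def Int_def conj_commute)

lemma origin_notin_closure:
  assumes I: "I \<subseteq> V" and G: "\<And>y. y \<in> G \<Longrightarrow> restrict y I \<in> layer I n"
  shows "origin V \<notin> Rtop V closure_of G"
proof -
  let ?U = "PiE V (\<lambda>v. if v \<in> I then {x. \<bar>x\<bar> < 1 / real (Suc n)} else UNIV)"
  have "open {x :: real. \<bar>x\<bar> < 1 / real (Suc n)}"
    by (intro open_Collect_less continuous_intros)
  then have "openin (Rtop V) ?U"
    using finite_V by (subst openin_PiE) auto
  moreover have "origin V \<in> ?U" by (auto simp: origin_def)
  moreover have "G \<inter> ?U = {}"
  proof -
    have False if yG: "y \<in> G" and yU: "y \<in> ?U" for y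
    proof -
      obtain v where v: "v \<in> I" "1 / real (Suc n) < \<bar>y v\<bar>"
        using G[OF yG] by (auto simp: layer_def simp del: of_nat_Suc)
      then have "y v \<in> {x. \<bar>x\<bar> < 1 / real (Suc n)}"
        using PiE_mem[OF yU, of v] I by auto
      then show False using v by simp
    qed
    then show ?thesis by blast
  qed
  ultimately show ?thesis unfolding in_closure_of by blast
qed

lemma emeasure_layer_finite:
  assumes I: "I \<subseteq> V"
  shows "emeasure \<Lambda> {y \<in> space \<Lambda>. restrict y I \<in> layer I n} < \<infinity>"
proof (rule locally_finite)
  show "{y \<in> space \<Lambda>. restrict y I \<in> layer I n} \<in> sets (Reuc V)"
    using sets_restrict_preimage[OF I layer_sets[OF finite_sub[OF I]]] by (simp add: sets_\<Lambda>_iff)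
  show "origin V \<notin> Rtop V closure_of {y \<in> space \<Lambda>. restrict y I \<in> layer I n}"
    by (rule origin_notin_closure[OF I, where n=n]) simp
qed

text \<open>The set is the union of its parts on which some \<open>y\<^sub>v\<close>, \<open>v \<in> V - I\<close>, does not vanish; explosiveness gives
  each of them mass \<open>0\<close> or \<open>\<infinity>\<close>.\<close>

lemma emeasure_restrict_origin:
  assumes I: "I \<subseteq> V"
  shows "emeasure \<Lambda> {y \<in> space \<Lambda>. restrict y I = origin I} \<in> {0, \<infinity>}"
proof -
  define S where "S v = {y \<in> space (Epunct V). y v \<noteq> 0 \<and> restrict y (V - (V - I)) = origin (V - (V - I))}" for v
  have VI: "V - (V - I) = I" using I by auto
  have S: "emeasure \<Lambda> (S v) \<in> {0, \<infinity>}" if "v \<in> V - I" for v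
    unfolding S_def using that by (intro explosive) auto
  have Sm: "S v \<in> sets \<Lambda>" if "v \<in> V" for v
  proof -
    note [measurable] = measurable_coord_\<Lambda>[OF that] measurable_restrict_\<Lambda>[OF I] origin_sets[OF finite_sub[OF I]]
    have "S v = {y \<in> space \<Lambda>. y v \<noteq> 0 \<and> restrict y I \<in> {origin I}}"
      by (simp add: S_def VI space_\<Lambda>)
    also have "\<dots> \<in> sets \<Lambda>" by measurable
    finally show ?thesis .
  qed
  have eq: "{y \<in> space \<Lambda>. restrict y I = origin I} = (\<Union>v\<in>V - I. S v)"
  proof (intro set_eqI iffI)
    fix y assume y: "y \<in> {y \<in> space \<Lambda>. restrict y I = origin I}"
    then have "restrict y V = y" by (auto simp: space_\<Lambda>_alt space_Reuc PiE_def extensional_restrict)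
    then have "\<exists>v\<in>V. y v \<noteq> 0"
      using y restrict_eq_origin_iff[of y V] by (auto simp: space_\<Lambda>_alt)
    then show "y \<in> (\<Union>v\<in>V - I. S v)"
      using y by (auto simp: S_def VI space_\<Lambda> restrict_eq_origin_iff)
  qed (auto simp: S_def VI space_\<Lambda>)
  show ?thesis
  proof (cases "\<exists>v\<in>V - I. emeasure \<Lambda> (S v) = \<infinity>")
    case True
    then obtain v where v: "v \<in> V - I" "emeasure \<Lambda> (S v) = \<infinity>" by blast
    then have "emeasure \<Lambda> (S v) \<le> emeasure \<Lambda> (\<Union>v\<in>V - I. S v)"
      using Sm finite_V by (intro emeasure_mono) auto
    then show ?thesis using v eq by (simp add: top_unique)
  next
    case False
    then have "S v \<in> null_sets \<Lambda>" if "v \<in> V - I" for v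
      using S[OF that] Sm[of v] that by auto
    then have "(\<Union>v\<in>V - I. S v) \<in> null_sets \<Lambda>"
      using finite_V by (intro null_sets.finite_UN) auto
    then show ?thesis using eq by auto
  qed
qed

lemma lambda_integral_split:
  assumes I: "I \<subseteq> V" and k [measurable]: "k \<in> borel_measurable \<Lambda>" and T [measurable]: "T \<in> sets (Reuc I)"
  shows "(LI y. k y) = (LI y. indicator T (restrict y I) * k y) + (LI y. indicator (space (Reuc I) - T) (restrict y I) * k y)"
proof -
  note [measurable] = measurable_restrict_\<Lambda>[OF I]
  have "k y = indicator T (restrict y I) * k y + indicator (space (Reuc I) - T) (restrict y I) * k y" for y
    using restrict_in_space[of y I] by (auto simp: indicator_def)
  then have "(LI y. k y) = (LI y. indicator T (restrict y I) * k y + indicator (space (Reuc I) - T) (restrict y I) * k y)" by simp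
  also have "\<dots> = (LI y. indicator T (restrict y I) * k y) + (LI y. indicator (space (Reuc I) - T) (restrict y I) * k y)"
    by (rule nn_integral_add) measurable
  finally show ?thesis .
qed

text \<open>Conditional expectation of \<open>u\<close> given \<open>y\<^sub>C\<close> relative to the measure with density \<open>v\<close>. The images under \<open>y\<^sub>C\<close> of
  the measures with densities \<open>u\<close> and \<open>v - u\<close>, restricted to \<open>y\<^sub>C \<noteq> 0\<close>, have Radon-Nikodym densities with respect
  to the image for \<open>v\<close>. These densities sum to \<open>1\<close> almost everywhere, which bounds the first one.\<close>

lemma relative_cond_version_exists:
  assumes C: "C \<subseteq> V" and u [measurable]: "u \<in> borel_measurable \<Lambda>" and v [measurable]: "v \<in> borel_measurable \<Lambda>"
    and uv: "\<And>y. u y \<le> v y" and v1: "\<And>y. v y \<le> 1"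
  obtains p where "p \<in> borel_measurable (Reuc C)" "\<And>c. p c \<le> 1"
    "\<And>\<phi>. \<phi> \<in> borel_measurable (Reuc C) \<Longrightarrow> \<phi> (origin C) = 0 \<Longrightarrow>
      (LI y. \<phi> (restrict y C) * u y) = (LI y. \<phi> (restrict y C) * (p (restrict y C) * v y))"
proof -
  note [measurable] = measurable_restrict_\<Lambda>[OF C] origin_sets[OF finite_sub[OF C]]
  define j :: "('v \<Rightarrow> real) \<Rightarrow> ennreal" where "j = indicator (space (Reuc C) - {origin C})"
  have [measurable]: "j \<in> borel_measurable (Reuc C)" unfolding j_def by measurable
  define N where "N h = distr (density \<Lambda> (\<lambda>y. j (restrict y C) * h y)) (Reuc C) (\<lambda>y. restrict y C)" for h
  have sets_N [measurable_cong]: "sets (N h) = sets (Reuc C)" for h by (simp add: N_def)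
  have N_int: "(\<integral>\<^sup>+c. \<phi> c \<partial>N h) = (LI y. j (restrict y C) * h y * \<phi> (restrict y C))"
    if [measurable]: "\<phi> \<in> borel_measurable (Reuc C)" "h \<in> borel_measurable \<Lambda>" for \<phi> h
    unfolding N_def by (simp add: nn_integral_distr nn_integral_density)
  have N_em: "emeasure (N h) S = (LI y. j (restrict y C) * h y * indicator S (restrict y C))"
    if [measurable]: "S \<in> sets (Reuc C)" "h \<in> borel_measurable \<Lambda>" for S h
    using N_int[of "indicator S" h] sets_N by (simp add: nn_integral_indicator)
  let ?M = "N v"
  have sf: "sigma_finite_measure ?M"
  proof
    show "\<exists>A. countable A \<and> A \<subseteq> sets ?M \<and> \<Union> A = space ?M \<and> (\<forall>a\<in>A. emeasure ?M a \<noteq> \<infinity>)"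
    proof (intro exI[of _ "insert {origin C} (range (layer C))"] conjI ballI)
      show "\<Union> (insert {origin C} (range (layer C))) = space ?M"
        using UN_layer[of C] origin_in_space[of C] sets_eq_imp_space_eq[OF sets_N[of v]] by auto
      fix a assume "a \<in> insert {origin C} (range (layer C))"
      then consider "a = {origin C}" | n where "a = layer C n" by auto
      then show "emeasure ?M a \<noteq> \<infinity>"
      proof cases
        case 1
        have "emeasure ?M {origin C} = (LI y. j (restrict y C) * v y * indicator {origin C} (restrict y C))"
          by (rule N_em) auto
        also have "\<dots> = (LI y. 0)"
          by (intro nn_integral_cong) (auto simp: j_def indicator_def)
        finally show ?thesis using 1 by simp
      next
        case 2
        have [measurable]: "layer C n \<in> sets (Reuc C)" by (rule layer_sets[OF finite_sub[OF C]])
        have "emeasure ?M (layer C n) = (LI y. j (restrict y C) * v y * indicator (layer C n) (restrict y C))"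
          by (rule N_em) auto
        also have "\<dots> \<le> (LI y. indicator {y \<in> space \<Lambda>. restrict y C \<in> layer C n} y)"
          using v1 by (intro nn_integral_mono) (simp add: j_def indicator_def)
        also have "\<dots> = emeasure \<Lambda> {y \<in> space \<Lambda>. restrict y C \<in> layer C n}"
          by (rule nn_integral_indicator) (rule sets_restrict_preimage[OF C layer_sets[OF finite_sub[OF C]]])
        also have "\<dots> < \<infinity>" by (rule emeasure_layer_finite[OF C])
        finally show ?thesis using 2 by simp
      qed
    qed (use finite_sub[OF C] in \<open>auto simp: sets_N\<close>)
  qed
  interpret sigma_finite_measure ?M by (rule sf)
  have RN: "\<exists>p\<in>borel_measurable ?M. density ?M p = N h" if [measurable]: "h \<in> borel_measurable \<Lambda>" and h: "\<And>y. h y \<le> v y" for h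
  proof (rule Radon_Nikodym)
    show "absolutely_continuous ?M (N h)"
      unfolding absolutely_continuous_def
    proof
      fix S assume S: "S \<in> null_sets ?M"
      then have [measurable]: "S \<in> sets (Reuc C)" by (auto simp: sets_N)
      have "(LI y. j (restrict y C) * v y * indicator S (restrict y C)) = 0"
        using S by (subst N_em[symmetric]) auto
      then have "AE y in \<Lambda>. j (restrict y C) * v y * indicator S (restrict y C) = 0"
        by (subst (asm) nn_integral_0_iff_AE) auto
      then have "AE y in \<Lambda>. j (restrict y C) * h y * indicator S (restrict y C) = 0"
      proof eventually_elim
        case (elim y)
        have "h y = 0" if "v y = 0" using h[of y] that by simp
        then show ?case using elim by auto
      qed
      then have "emeasure (N h) S = 0"
        by (subst N_em, simp, simp, subst nn_integral_0_iff_AE) auto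
      then show "S \<in> null_sets (N h)" by (auto simp: sets_N)
    qed
  qed (simp add: sets_N)
  obtain p where p [measurable]: "p \<in> borel_measurable ?M" "density ?M p = N u" using RN[OF u uv] by blast
  obtain q where q [measurable]: "q \<in> borel_measurable ?M" "density ?M q = N (\<lambda>y. v y - u y)"
    using RN[of "\<lambda>y. v y - u y"] by (auto simp: diff_le_self_ennreal)
  have pR [measurable]: "p \<in> borel_measurable (Reuc C)" using p(1) by measurable
  have qR [measurable]: "q \<in> borel_measurable (Reuc C)" using q(1) by measurable
  have "density ?M (\<lambda>c. p c + q c) = density ?M (\<lambda>_. 1)"
  proof (rule measure_eqI)
    fix S assume "S \<in> sets (density ?M (\<lambda>c. p c + q c))"
    then have S [measurable]: "S \<in> sets (Reuc C)" by (simp add: sets_N)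
    then have SM [measurable]: "S \<in> sets ?M" by (simp add: sets_N)
    have "emeasure (density ?M (\<lambda>c. p c + q c)) S = emeasure (density ?M p) S + emeasure (density ?M q) S"
      by (simp add: emeasure_density nn_integral_add distrib_right)
    also have "\<dots> = (LI y. j (restrict y C) * u y * indicator S (restrict y C) +
        j (restrict y C) * (v y - u y) * indicator S (restrict y C))"
      unfolding p(2) q(2) by (subst (1 2) N_em, simp_all, subst nn_integral_add) auto
    also have "\<dots> = (LI y. j (restrict y C) * v y * indicator S (restrict y C))"
    proof (intro nn_integral_cong)
      fix y
      have "u y + (v y - u y) = v y" using uv[of y] by (simp add: add_diff_inverse_ennreal)
      then show "j (restrict y C) * u y * indicator S (restrict y C) + j (restrict y C) * (v y - u y) * indicator S (restrict y C)
          = j (restrict y C) * v y * indicator S (restrict y C)"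
        by (metis distrib_left distrib_right)
    qed
    also have "\<dots> = emeasure (density ?M (\<lambda>_. 1)) S"
      using N_em[OF S, of v] by (simp add: density_1)
    finally show "emeasure (density ?M (\<lambda>c. p c + q c)) S = emeasure (density ?M (\<lambda>_. 1)) S" .
  qed simp
  then have "AE c in ?M. p c + q c = 1"
    by (subst (asm) density_unique_iff) auto
  then have p1: "AE c in ?M. min (p c) 1 = p c"
    by eventually_elim (metis le_add1 min.absorb1 add.commute le_iff_add)
  show ?thesis
  proof (rule that[of "\<lambda>c. min (p c) 1"])
    show "(\<lambda>c. min (p c) 1) \<in> borel_measurable (Reuc C)" by measurable
    fix \<phi> :: "('v \<Rightarrow> real) \<Rightarrow> ennreal" assume [measurable]: "\<phi> \<in> borel_measurable (Reuc C)" and 0: "\<phi> (origin C) = 0"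
    have "\<phi> c * x = j c * x * \<phi> c" if "c \<in> space (Reuc C)" for c x
      using that 0 by (cases "c = origin C") (auto simp: j_def mult.commute)
    then have eq: "(LI y. \<phi> (restrict y C) * h y) = (LI y. j (restrict y C) * h y * \<phi> (restrict y C))" for h
      by (intro nn_integral_cong) simp
    have "(LI y. \<phi> (restrict y C) * u y) = (\<integral>\<^sup>+c. \<phi> c \<partial>density ?M p)"
      unfolding p(2) eq by (simp add: N_int)
    also have "\<dots> = (\<integral>\<^sup>+c. p c * \<phi> c \<partial>?M)" by (simp add: nn_integral_density)
    also have "\<dots> = (\<integral>\<^sup>+c. min (p c) 1 * \<phi> c \<partial>?M)"
    proof (rule nn_integral_cong_AE)
      show "AE c in ?M. p c * \<phi> c = min (p c) 1 * \<phi> c"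
        using p1 by eventually_elim simp
    qed
    also have "\<dots> = (LI y. j (restrict y C) * v y * (min (p (restrict y C)) 1 * \<phi> (restrict y C)))"
      by (rule N_int) auto
    also have "\<dots> = (LI y. \<phi> (restrict y C) * (min (p (restrict y C)) 1 * v y))"
      unfolding eq by (simp only: ac_simps)
    finally show "(LI y. \<phi> (restrict y C) * u y) = (LI y. \<phi> (restrict y C) * (min (p (restrict y C)) 1 * v y))" .
  qed simp
qed

lemma cond_version_exists:
  assumes C: "C \<subseteq> V" and u: "u \<in> borel_measurable \<Lambda>" and u1: "\<And>y. u y \<le> 1"
  obtains p where "cond_version \<Lambda> C u p" "\<And>c. p c \<le> 1"
proof (rule relative_cond_version_exists[OF C u borel_measurable_const u1 order_refl])
  fix p assume p: "p \<in> borel_measurable (Reuc C)" "\<And>c. p c \<le> 1"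
    "\<And>\<phi>. \<phi> \<in> borel_measurable (Reuc C) \<Longrightarrow> \<phi> (origin C) = 0 \<Longrightarrow>
      (LI y. \<phi> (restrict y C) * u y) = (LI y. \<phi> (restrict y C) * (p (restrict y C) * 1))"
  then have "cond_version \<Lambda> C u p" unfolding cond_version_def mult_1_right by blast
  then show thesis using that p(2) by blast
qed

lemma nn_integral_layer_finite:
  assumes I: "I \<subseteq> V" and S: "S \<in> sets (Reuc I)" "S \<subseteq> layer I n" and k: "\<And>y. k y \<le> 1"
  shows "(LI y. indicator S (restrict y I) * k y) < \<infinity>"
proof -
  have "(LI y. indicator S (restrict y I) * k y) \<le> (LI y. indicator {y \<in> space \<Lambda>. restrict y I \<in> layer I n} y)"
  proof (intro nn_integral_mono)
    fix y assume "y \<in> space \<Lambda>"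
    then show "indicator S (restrict y I) * k y \<le> indicator {y \<in> space \<Lambda>. restrict y I \<in> layer I n} y"
      using S(2) k[of y] by (auto simp: indicator_def)
  qed
  also have "\<dots> = emeasure \<Lambda> {y \<in> space \<Lambda>. restrict y I \<in> layer I n}"
    by (rule nn_integral_indicator) (rule sets_restrict_preimage[OF I layer_sets[OF finite_sub[OF I]]])
  also have "\<dots> < \<infinity>" by (rule emeasure_layer_finite[OF I])
  finally show ?thesis .
qed

lemma nn_integral_eq_off_origin:
  assumes I: "I \<subseteq> V" and k: "k1 \<in> borel_measurable \<Lambda>" "k2 \<in> borel_measurable \<Lambda>"
    and eq: "\<And>n F. F \<in> sets (Reuc I) \<Longrightarrow> F \<subseteq> layer I n \<Longrightarrow>
      (LI y. indicator F (restrict y I) * k1 y) = (LI y. indicator F (restrict y I) * k2 y)"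
    and \<phi>: "\<phi> \<in> borel_measurable (Reuc I)" "\<phi> (origin I) = 0"
  shows "(LI y. \<phi> (restrict y I) * k1 y) = (LI y. \<phi> (restrict y I) * k2 y)"
proof (rule nn_integral_eq_on_cover[where A="layer I" and N="Reuc I"])
  show "(\<lambda>y. restrict y I) \<in> \<Lambda> \<rightarrow>\<^sub>M Reuc I" by (rule measurable_restrict_\<Lambda>[OF I])
  show "layer I n \<in> sets (Reuc I)" for n by (rule layer_sets[OF finite_sub[OF I]])
  show "\<phi> x = 0" if "x \<in> space (Reuc I)" "x \<notin> (\<Union>n. layer I n)" for x
    using that \<phi>(2) by (auto simp: UN_layer)
  show "(LI y. indicator H (restrict y I) * k1 y) = (LI y. indicator H (restrict y I) * k2 y)"
    if "H \<in> sets (Reuc I)" "H \<subseteq> layer I n" for n H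
    using that by (rule eq)
qed (rule k \<phi>)+

text \<open>The origin of \<open>\<real>\<^sup>I\<close> is not covered by the layers. A set that contains it is treated through its
  complement, which is why the total integrals have to agree and be finite.\<close>

lemma nn_integral_eq_extend_origin:
  assumes I: "I \<subseteq> V" and k [measurable]: "k1 \<in> borel_measurable \<Lambda>" "k2 \<in> borel_measurable \<Lambda>"
    and eq: "\<And>n F. F \<in> sets (Reuc I) \<Longrightarrow> F \<subseteq> layer I n \<Longrightarrow>
      (LI y. indicator F (restrict y I) * k1 y) = (LI y. indicator F (restrict y I) * k2 y)"
    and total: "(LI y. k1 y) = (LI y. k2 y)" "(LI y. k1 y) < \<infinity>"
    and F: "F \<in> sets (Reuc I)"
  shows "(LI y. indicator F (restrict y I) * k1 y) = (LI y. indicator F (restrict y I) * k2 y)"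
proof (cases "origin I \<in> F")
  case False
  then show ?thesis using F by (intro nn_integral_eq_off_origin[OF I k eq]) auto
next
  case True
  note [measurable] = measurable_restrict_\<Lambda>[OF I] F
  let ?c = "space (Reuc I) - F"
  note sum = lambda_integral_split[OF I _ F]
  have c: "(LI y. indicator ?c (restrict y I) * k1 y) = (LI y. indicator ?c (restrict y I) * k2 y)"
    using True by (intro nn_integral_eq_off_origin[OF I k eq]) auto
  have "(LI y. indicator ?c (restrict y I) * k1 y) \<noteq> \<top>"
    using total(2) sum[OF k(1)] by (auto simp: less_top)
  then show ?thesis
    using total(1) unfolding sum[OF k(1)] sum[OF k(2)] c by (simp add: add.commute[of _ "LI y. indicator ?c (restrict y I) * k2 y"] ennreal_add_left_cancel)
qed

lemma cond_version_cmult: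
  assumes C: "C \<subseteq> V" and u [measurable]: "u \<in> borel_measurable \<Lambda>" and p: "cond_version \<Lambda> C u p"
  shows "cond_version \<Lambda> C (\<lambda>y. x * u y) (\<lambda>c. x * p c)"
  unfolding cond_version_def
proof (intro conjI ballI impI)
  have [measurable]: "p \<in> borel_measurable (Reuc C)" using p by (simp add: cond_version_def)
  note [measurable] = measurable_restrict_\<Lambda>[OF C]
  show "(\<lambda>c. x * p c) \<in> borel_measurable (Reuc C)" by measurable
  fix \<phi> :: "('v \<Rightarrow> real) \<Rightarrow> ennreal" assume \<phi> [measurable]: "\<phi> \<in> borel_measurable (Reuc C)" and 0: "\<phi> (origin C) = 0"
  have "(LI y. \<phi> (restrict y C) * (x * u y)) = x * (LI y. \<phi> (restrict y C) * u y)"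
    by (subst nn_integral_cmult[symmetric]) (measurable, simp only: ac_simps)
  also have "\<dots> = x * (LI y. \<phi> (restrict y C) * p (restrict y C))"
    using p \<phi> 0 by (simp add: cond_version_def)
  also have "\<dots> = (LI y. \<phi> (restrict y C) * (x * p (restrict y C)))"
    by (subst nn_integral_cmult[symmetric]) (measurable, simp only: ac_simps)
  finally show "(LI y. \<phi> (restrict y C) * (x * u y)) = (LI y. \<phi> (restrict y C) * (x * p (restrict y C)))" .
qed

text \<open>The product formula of the second part of \<open>factorizes\<close>, extended from events to functions: first in
  \<open>y\<^sub>C\<close>, then in \<open>y\<^sub>B\<close>, finally in \<open>y\<^sub>A\<close>.\<close>

lemma factorizes_product:
  assumes ABC: "A \<subseteq> V" "B \<subseteq> V" "C \<subseteq> V" and fact: "factorizes \<Lambda> A B C"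
    and u [measurable]: "u \<in> borel_measurable (Reuc A)" and w [measurable]: "w \<in> borel_measurable (Reuc B)"
    and p: "cond_version \<Lambda> C (\<lambda>y. u (restrict y A)) p" and q: "cond_version \<Lambda> C (\<lambda>y. w (restrict y B)) q"
    and \<phi> [measurable]: "\<phi> \<in> borel_measurable (Reuc C)" and \<phi>0: "\<phi> (origin C) = 0"
  shows "(LI y. \<phi> (restrict y C) * (u (restrict y A) * w (restrict y B))) =
    (LI y. \<phi> (restrict y C) * (p (restrict y C) * q (restrict y C)))"
proof -
  note [measurable] = measurable_restrict_\<Lambda>[OF ABC(1)] measurable_restrict_\<Lambda>[OF ABC(2)]
    measurable_restrict_\<Lambda>[OF ABC(3)] origin_sets[OF finite_sub[OF ABC(3)]]
  have [measurable]: "p \<in> borel_measurable (Reuc C)" "q \<in> borel_measurable (Reuc C)"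
    using p q by (auto simp: cond_version_def)
  have step: "(LI y. \<phi> (restrict y C) * (w (restrict y B) * indicator F (restrict y A))) =
      (LI y. \<phi> (restrict y C) * (q (restrict y C) * indicator F (restrict y A)))"
    if F [measurable]: "F \<in> sets (Reuc A)" for F
  proof -
    obtain r where r [measurable]: "r \<in> borel_measurable (Reuc C)"
      and eq: "\<And>G H. G \<in> sets (Reuc B) \<Longrightarrow> H \<in> sets (Reuc C) \<Longrightarrow> origin C \<notin> H \<Longrightarrow>
        (LI y. indicator H (restrict y C) * (indicator G (restrict y B) * indicator F (restrict y A))) =
        (LI y. indicator H (restrict y C) * (indicator G (restrict y B) * r (restrict y C)))"
      using fact F unfolding factorizes_def by meson
    have 1: "(LI y. \<psi> (restrict y C) * (indicator G (restrict y B) * indicator F (restrict y A))) =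
        (LI y. \<psi> (restrict y C) * (indicator G (restrict y B) * r (restrict y C)))"
      if [measurable]: "\<psi> \<in> borel_measurable (Reuc C)" "G \<in> sets (Reuc B)" and "\<psi> (origin C) = 0" for \<psi> G
    proof (rule nn_integral_eq_on_cover[where A="\<lambda>_. space (Reuc C) - {origin C}" and N="Reuc C"])
      fix H assume "H \<in> sets (Reuc C)" "H \<subseteq> space (Reuc C) - {origin C}"
      then show "(LI y. indicator H (restrict y C) * (indicator G (restrict y B) * indicator F (restrict y A))) =
        (LI y. indicator H (restrict y C) * (indicator G (restrict y B) * r (restrict y C)))"
        by (intro eq) auto
    next
      show "(\<lambda>y. restrict y C) \<in> \<Lambda> \<rightarrow>\<^sub>M Reuc C" by measurable
      show "\<psi> x = 0" if "x \<in> space (Reuc C)" "x \<notin> (\<Union>n::nat. space (Reuc C) - {origin C})" for x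
        using that \<open>\<psi> (origin C) = 0\<close> by auto
    qed simp_all
    have 2: "(LI y. v (restrict y B) * (\<psi> (restrict y C) * indicator F (restrict y A))) =
        (LI y. v (restrict y B) * (\<psi> (restrict y C) * r (restrict y C)))"
      if [measurable]: "\<psi> \<in> borel_measurable (Reuc C)" "v \<in> borel_measurable (Reuc B)" and "\<psi> (origin C) = 0" for \<psi> v
    proof (rule nn_integral_eq_of_sets[where N="Reuc B"])
      fix G assume G: "G \<in> sets (Reuc B)"
      show "(LI y. indicator G (restrict y B) * (\<psi> (restrict y C) * indicator F (restrict y A))) =
        (LI y. indicator G (restrict y B) * (\<psi> (restrict y C) * r (restrict y C)))"
        using 1[OF that(1) G that(3)] by (simp only: ac_simps)
    qed measurable
    have "(LI y. \<phi> (restrict y C) * (w (restrict y B) * indicator F (restrict y A))) =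
        (LI y. (\<phi> (restrict y C) * r (restrict y C)) * w (restrict y B))"
      using 2[OF \<phi> w \<phi>0] by (simp only: ac_simps)
    also have "\<dots> = (LI y. (\<phi> (restrict y C) * r (restrict y C)) * q (restrict y C))"
    proof -
      have "(\<lambda>c. \<phi> c * r c) \<in> borel_measurable (Reuc C)" by measurable
      then show ?thesis using q \<phi>0 unfolding cond_version_def by fastforce
    qed
    also have "\<dots> = (LI y. \<phi> (restrict y C) * (q (restrict y C) * indicator F (restrict y A)))"
    proof -
      have "(LI y. 1 * ((\<phi> (restrict y C) * q (restrict y C)) * indicator F (restrict y A))) =
        (LI y. 1 * ((\<phi> (restrict y C) * q (restrict y C)) * r (restrict y C)))"
        by (rule 2) (simp_all add: \<phi>0)
      then show ?thesis by (simp only: ac_simps mult_1_left)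
    qed
    finally show ?thesis .
  qed
  have "(LI y. u (restrict y A) * (\<phi> (restrict y C) * w (restrict y B))) =
      (LI y. u (restrict y A) * (\<phi> (restrict y C) * q (restrict y C)))"
  proof (rule nn_integral_eq_of_sets[where N="Reuc A"])
    fix F assume F: "F \<in> sets (Reuc A)"
    show "(LI y. indicator F (restrict y A) * (\<phi> (restrict y C) * w (restrict y B))) =
      (LI y. indicator F (restrict y A) * (\<phi> (restrict y C) * q (restrict y C)))"
      using step[OF F] by (simp only: ac_simps)
  qed measurable
  also have "\<dots> = (LI y. (\<phi> (restrict y C) * q (restrict y C)) * u (restrict y A))"
    by (simp only: ac_simps)
  also have "\<dots> = (LI y. (\<phi> (restrict y C) * q (restrict y C)) * p (restrict y C))"
  proof -
    have "(\<lambda>c. \<phi> c * q c) \<in> borel_measurable (Reuc C)" by measurable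
    then show ?thesis using p \<phi>0 unfolding cond_version_def by fastforce
  qed
  finally show ?thesis by (simp only: ac_simps)
qed

end

section \<open>The Laplace functional given a projected process\<close>

lemma cond_uncorrelated_cong_AE:
  assumes "finite_measure_subalgebra M S"
    and [measurable]: "U \<in> borel_measurable M" "U' \<in> borel_measurable M" "W \<in> borel_measurable M" "W' \<in> borel_measurable M"
    and U: "AE \<omega> in M. U \<omega> = U' \<omega>" and W: "AE \<omega> in M. W \<omega> = W' \<omega>"
  shows "cond_uncorrelated M S U W \<longleftrightarrow> cond_uncorrelated M S U' W'"
proof -
  interpret finite_measure_subalgebra M S by fact
  have 1: "AE \<omega> in M. real_cond_exp M S (\<lambda>\<omega>. U \<omega> * W \<omega>) \<omega> = real_cond_exp M S (\<lambda>\<omega>. U' \<omega> * W' \<omega>) \<omega>"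
  proof (rule real_cond_exp_cong)
    show "AE \<omega> in M. U \<omega> * W \<omega> = U' \<omega> * W' \<omega>" using U W by eventually_elim simp
  qed measurable
  have 2: "AE \<omega> in M. real_cond_exp M S U \<omega> = real_cond_exp M S U' \<omega>"
    by (rule real_cond_exp_cong[OF U]) auto
  have 3: "AE \<omega> in M. real_cond_exp M S W \<omega> = real_cond_exp M S W' \<omega>"
    by (rule real_cond_exp_cong[OF W]) auto
  show ?thesis
    unfolding cond_uncorrelated_def
  proof
    assume "AE \<omega> in M. real_cond_exp M S (\<lambda>\<omega>. U \<omega> * W \<omega>) \<omega> = real_cond_exp M S U \<omega> * real_cond_exp M S W \<omega>"
    with 1 2 3 show "AE \<omega> in M. real_cond_exp M S (\<lambda>\<omega>. U' \<omega> * W' \<omega>) \<omega> = real_cond_exp M S U' \<omega> * real_cond_exp M S W' \<omega>"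
      by eventually_elim (simp only:)
  next
    assume "AE \<omega> in M. real_cond_exp M S (\<lambda>\<omega>. U' \<omega> * W' \<omega>) \<omega> = real_cond_exp M S U' \<omega> * real_cond_exp M S W' \<omega>"
    with 1 2 3 show "AE \<omega> in M. real_cond_exp M S (\<lambda>\<omega>. U \<omega> * W \<omega>) \<omega> = real_cond_exp M S U \<omega> * real_cond_exp M S W \<omega>"
      by eventually_elim (simp only:)
  qed
qed

lemma cond_uncorrelated_zero:
  assumes "finite_measure_subalgebra M S"
  shows "cond_uncorrelated M S (\<lambda>_. 0) W"
proof -
  interpret finite_measure_subalgebra M S by fact
  have "AE \<omega> in M. real_cond_exp M S (\<lambda>_. 0) \<omega> = 0"
    by (rule real_cond_exp_F_meas) auto
  then show ?thesis unfolding cond_uncorrelated_def mult_zero_left by eventually_elim simp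
qed

text \<open>The exponent \<open>g\<close> with \<open>1 - exp(-g) = p\<close> off the origin. Points of the process at the origin of \<open>\<real>\<^sup>C\<close> do not
  contribute; \<open>atom_integral\<close> below accounts for them.\<close>

definition cond_exponent :: "'v set \<Rightarrow> (('v \<Rightarrow> real) \<Rightarrow> ennreal) \<Rightarrow> ('v \<Rightarrow> real) \<Rightarrow> ennreal" where
  "cond_exponent C p c = (if c = origin C then 0 else nlog (1 - enn2real (p c)))"

lemma cond_exponent_origin [simp]: "cond_exponent C p (origin C) = 0"
  by (simp add: cond_exponent_def)

lemma expn_cond_exponent:
  assumes "p c \<le> 1" "c \<noteq> origin C"
  shows "expn (cond_exponent C p c) = 1 - enn2real (p c)"
    and "ennreal (1 - expn (cond_exponent C p c)) = p c"
proof -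
  have "enn2real (p c) \<le> 1" using enn2real_mono[OF assms(1)] by simp
  then show 1: "expn (cond_exponent C p c) = 1 - enn2real (p c)"
    using assms(2) by (simp add: cond_exponent_def)
  have "p c < \<top>" using assms(1) by (metis ennreal_one_less_top le_less_trans)
  then show "ennreal (1 - expn (cond_exponent C p c)) = p c"
    unfolding 1 by (simp add: ennreal_enn2real)
qed

lemma measurable_cond_exponent:
  assumes "finite C" and [measurable]: "p \<in> borel_measurable (Reuc C)"
  shows "cond_exponent C p \<in> borel_measurable (Reuc C)"
proof -
  have [measurable]: "{origin C} \<in> sets (Reuc C)" using assms(1) by simp
  have "(\<lambda>c. if c \<in> {origin C} then 0 else nlog (1 - enn2real (p c))) \<in> borel_measurable (Reuc C)"
    by measurable
  then show ?thesis by (simp add: cond_exponent_def[abs_def])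
qed

lemma measurable_proj_process:
  fixes V :: "'v set"
  assumes \<xi>: "\<xi> \<in> M \<rightarrow>\<^sub>M Npoint (Epunct V)" and I: "I \<subseteq> V"
  shows "proj_process \<xi> I \<in> M \<rightarrow>\<^sub>M Npoint (Reuc I)"
proof (rule measurable_NpointI)
  have meas: "{y \<in> space (Epunct V). restrict y I \<in> G} \<in> sets (Epunct V)" if "G \<in> sets (Reuc I)" for G
    using measurable_sets[OF measurable_restrict_Epunct[OF refl I] that]
    by (simp add: vimage_def Int_def conj_commute)
  fix \<omega> assume "\<omega> \<in> space M"
  then have \<omega>: "\<xi> \<omega> \<in> point_measures (Epunct V)" using measurable_space[OF \<xi>] by simp
  then have sets: "sets (\<xi> \<omega>) = sets (Epunct V)" by (rule sets_point_measure)
  have "s_finite (\<xi> \<omega>)" using \<omega> by (simp add: point_measures_def)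
  then obtain \<nu> :: "nat \<Rightarrow> ('v \<Rightarrow> real) measure" where \<nu>: "\<And>n. sets (\<nu> n) = sets (\<xi> \<omega>)" "\<And>n. finite_measure (\<nu> n)"
    "\<And>G. G \<in> sets (\<xi> \<omega>) \<Longrightarrow> emeasure (\<xi> \<omega>) G = (\<Sum>n. emeasure (\<nu> n) G)"
    unfolding s_finite_def by blast
  have \<nu>meas: "(\<lambda>y. restrict y I) \<in> \<nu> n \<rightarrow>\<^sub>M Reuc I" for n
    by (rule measurable_restrict_Epunct[OF _ I]) (simp add: \<nu>(1) sets)
  have sp: "space (\<nu> n) = space (Epunct V)" for n
    by (rule sets_eq_imp_space_eq) (simp add: \<nu>(1) sets)
  have "s_finite (proj_process \<xi> I \<omega>)"
    unfolding s_finite_def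
  proof (intro exI[of _ "\<lambda>n. distr (\<nu> n) (Reuc I) (\<lambda>y. restrict y I)"] conjI allI ballI)
    show "finite_measure (distr (\<nu> n) (Reuc I) (\<lambda>y. restrict y I))" for n
      using \<nu>(2) \<nu>meas by (rule finite_measure.finite_measure_distr)
    fix G assume "G \<in> sets (proj_process \<xi> I \<omega>)"
    then have G: "G \<in> sets (Reuc I)" by (simp add: proj_process_def)
    have eq: "emeasure (distr (\<nu> n) (Reuc I) (\<lambda>y. restrict y I)) G = emeasure (\<nu> n) {y \<in> space (Epunct V). restrict y I \<in> G}" for n
      using G \<nu>meas[of n] by (simp add: emeasure_distr vimage_def Int_def conj_commute sp)
    show "emeasure (proj_process \<xi> I \<omega>) G = (\<Sum>n. emeasure (distr (\<nu> n) (Reuc I) (\<lambda>y. restrict y I)) G)"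
      unfolding emeasure_proj_process[where \<xi>=\<xi> and \<omega>=\<omega>, OF \<omega> I G] eq using \<nu>(3) meas[OF G] sets by simp
  qed (simp add: proj_process_def)
  moreover have "emeasure (proj_process \<xi> I \<omega>) G \<in> \<nat> \<union> {\<infinity>}" if "G \<in> sets (Reuc I)" for G
    unfolding emeasure_proj_process[where \<xi>=\<xi> and \<omega>=\<omega>, OF \<omega> I that] using \<omega> meas[OF that] by (auto simp: point_measures_def)
  ultimately show "proj_process \<xi> I \<omega> \<in> point_measures (Reuc I)"
    by (simp add: point_measures_def proj_process_def)
next
  fix G assume G: "G \<in> sets (Reuc I)"
  have meas: "{y \<in> space (Epunct V). restrict y I \<in> G} \<in> sets (Epunct V)"
    using measurable_sets[OF measurable_restrict_Epunct[OF refl I] G]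
    by (simp add: vimage_def Int_def conj_commute)
  have eq: "emeasure (proj_process \<xi> I \<omega>) G = emeasure (\<xi> \<omega>) {y \<in> space (Epunct V). restrict y I \<in> G}" if "\<omega> \<in> space M" for \<omega>
    using measurable_space[OF \<xi> that] by (intro emeasure_proj_process I G) simp
  show "(\<lambda>\<omega>. emeasure (proj_process \<xi> I \<omega>) G) \<in> borel_measurable M"
    using measurable_compose[OF \<xi> measurable_emeasure_Npoint[OF meas]] by (subst measurable_cong[OF eq]) auto
qed

locale poisson_process_on = explosive_measure V \<Lambda> + prob_space M
  for V :: "'v set" and \<Lambda> and M :: "'w measure" +
  fixes \<xi> :: "'w \<Rightarrow> ('v \<Rightarrow> real) measure"
  assumes ppp: "poisson_point_process M (Epunct V) \<Lambda> \<xi>"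
begin

abbreviation "Lproj I f \<omega> \<equiv> expn (\<integral>\<^sup>+z. f z \<partial>proj_process \<xi> I \<omega>)"

abbreviation "proj_cond_indep A B C \<equiv> cond_indep_var M (Npoint (Reuc A)) (proj_process \<xi> A)
  (Npoint (Reuc B)) (proj_process \<xi> B) (Npoint (Reuc C)) (proj_process \<xi> C)"

lemma measurable_\<xi>: "\<xi> \<in> M \<rightarrow>\<^sub>M Npoint (Epunct V)"
  using ppp by (simp add: poisson_point_process_def)

lemma sets_\<xi>: "\<omega> \<in> space M \<Longrightarrow> sets (\<xi> \<omega>) = sets \<Lambda>"
  using measurable_space[OF measurable_\<xi>] by (simp add: sets_\<Lambda> sets_point_measure)

lemma measurable_proj [measurable]: "I \<subseteq> V \<Longrightarrow> proj_process \<xi> I \<in> M \<rightarrow>\<^sub>M Npoint (Reuc I)"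
  by (rule measurable_proj_process[OF measurable_\<xi>])

lemma nn_integral_proj:
  assumes "I \<subseteq> V" "\<omega> \<in> space M" "f \<in> borel_measurable (Reuc I)"
  shows "(\<integral>\<^sup>+z. f z \<partial>proj_process \<xi> I \<omega>) = (\<integral>\<^sup>+y. f (restrict y I) \<partial>\<xi> \<omega>)"
  unfolding proj_process_def using assms
  by (intro nn_integral_distr) (auto intro: measurable_restrict_Epunct simp: sets_\<xi> sets_\<Lambda>)

lemma measurable_integral_\<xi>: "f \<in> borel_measurable \<Lambda> \<Longrightarrow> (\<lambda>\<omega>. \<integral>\<^sup>+y. f y \<partial>\<xi> \<omega>) \<in> borel_measurable M"
  by (rule measurable_nn_integral_process[OF measurable_\<xi>]) (simp add: measurable_cong_sets[OF sets_\<Lambda> refl])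

lemma laplace:
  "f \<in> borel_measurable \<Lambda> \<Longrightarrow>
    (\<integral>\<omega>. expn (\<integral>\<^sup>+y. f y \<partial>\<xi> \<omega>) \<partial>M) = expn (LI y. ennreal (1 - expn (f y)))"
  by (rule laplace_functional[OF prob_space_axioms ppp]) (simp add: measurable_cong_sets[OF sets_\<Lambda> refl])

lemma integral_\<xi>_add:
  assumes "\<omega> \<in> space M" "f \<in> borel_measurable \<Lambda>" "g \<in> borel_measurable \<Lambda>"
  shows "(\<integral>\<^sup>+y. f y + g y \<partial>\<xi> \<omega>) = (\<integral>\<^sup>+y. f y \<partial>\<xi> \<omega>) + (\<integral>\<^sup>+y. g y \<partial>\<xi> \<omega>)"
  using assms by (intro nn_integral_add) (simp_all add: measurable_cong_sets[OF sets_\<xi> refl])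

lemma AE_null:
  assumes "S \<in> sets \<Lambda>" "emeasure \<Lambda> S = 0"
  shows "AE \<omega> in M. emeasure (\<xi> \<omega>) S = 0"
  using ppp assms by (simp add: poisson_point_process_def sets_\<Lambda>)

lemma AE_infinite:
  assumes "S \<in> sets \<Lambda>" "emeasure \<Lambda> S = \<infinity>"
  shows "AE \<omega> in M. emeasure (\<xi> \<omega>) S = \<infinity>"
  using ppp assms by (simp add: poisson_point_process_def sets_\<Lambda>)

text \<open>There is only one vector in \<open>\<real>\<^bsup>{}\<^esup>\<close>, and the number of points over it is almost surely \<open>0\<close> or almost
  surely \<open>\<infinity>\<close>.\<close>

lemma proj_process_empty_trivial:
  assumes "H \<in> sets (Npoint (Reuc {}))"
  shows "(AE \<omega> in M. proj_process \<xi> {} \<omega> \<in> H) \<or> (AE \<omega> in M. proj_process \<xi> {} \<omega> \<notin> H)"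
  using assms unfolding sets_Npoint
proof (induction rule: sigma_sets.induct)
  case (Basic a)
  then obtain G S where a: "a = {\<mu> \<in> point_measures (Reuc {}). emeasure \<mu> G \<in> S}" and G: "G \<in> sets (Reuc {})"
    by auto
  let ?S = "{y \<in> space \<Lambda>. restrict y {} \<in> G}"
  have S: "?S \<in> sets \<Lambda>" by (rule sets_restrict_preimage[OF _ G]) simp
  have "emeasure \<Lambda> ?S \<in> {0, \<infinity>}"
  proof (cases "origin {} \<in> G")
    case True
    then have "?S = {y \<in> space \<Lambda>. restrict y {} = origin {}}"
      using restrict_eq_origin_iff[of _ "{}"] by auto
    then show ?thesis using emeasure_restrict_origin[of "{}"] by simp
  next
    case False
    moreover have "restrict y {} = origin {}" for y :: "'v \<Rightarrow> real" by (simp add: restrict_eq_origin_iff)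
    ultimately have "?S = {}" by auto
    then show ?thesis by (simp only: emeasure_empty insertI1)
  qed
  then obtain l where "AE \<omega> in M. emeasure (\<xi> \<omega>) ?S = l"
    using AE_null[OF S] AE_infinite[OF S] by auto
  moreover have "AE \<omega> in M. proj_process \<xi> {} \<omega> \<in> a \<longleftrightarrow> emeasure (\<xi> \<omega>) ?S \<in> S"
  proof (rule AE_I2)
    fix \<omega> assume \<omega>: "\<omega> \<in> space M"
    have "emeasure (proj_process \<xi> {} \<omega>) G = emeasure (\<xi> \<omega>) ?S"
      unfolding space_\<Lambda> using measurable_space[OF measurable_\<xi> \<omega>] by (intro emeasure_proj_process G) auto
    then show "proj_process \<xi> {} \<omega> \<in> a \<longleftrightarrow> emeasure (\<xi> \<omega>) ?S \<in> S"
      using measurable_space[OF measurable_proj[of "{}"] \<omega>] by (simp add: a)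
  qed
  ultimately have "AE \<omega> in M. proj_process \<xi> {} \<omega> \<in> a \<longleftrightarrow> l \<in> S"
    by eventually_elim simp
  then show ?case by (cases "l \<in> S") auto
next
  case Empty
  then show ?case by simp
next
  case (Compl a)
  have pm: "AE \<omega> in M. proj_process \<xi> {} \<omega> \<in> point_measures (Reuc {})"
    using measurable_space[OF measurable_proj[of "{}"]] by (intro AE_I2) auto
  from Compl.IH show ?case
  proof
    assume "AE \<omega> in M. proj_process \<xi> {} \<omega> \<in> a"
    then have "AE \<omega> in M. proj_process \<xi> {} \<omega> \<notin> point_measures (Reuc {}) - a" by eventually_elim simp
    then show ?thesis ..
  next
    assume "AE \<omega> in M. proj_process \<xi> {} \<omega> \<notin> a"
    with pm have "AE \<omega> in M. proj_process \<xi> {} \<omega> \<in> point_measures (Reuc {}) - a" by eventually_elim simp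
    then show ?thesis ..
  qed
next
  case (Union a)
  show ?case
  proof (cases "\<exists>i. AE \<omega> in M. proj_process \<xi> {} \<omega> \<in> a i")
    case True
    then obtain i where "AE \<omega> in M. proj_process \<xi> {} \<omega> \<in> a i" by blast
    then have "AE \<omega> in M. proj_process \<xi> {} \<omega> \<in> (\<Union>i. a i)" by eventually_elim blast
    then show ?thesis ..
  next
    case False
    then have "AE \<omega> in M. \<forall>i. proj_process \<xi> {} \<omega> \<notin> a i"
      unfolding AE_all_countable using Union.IH by blast
    then have "AE \<omega> in M. proj_process \<xi> {} \<omega> \<notin> (\<Union>i. a i)" by eventually_elim blast
    then show ?thesis ..
  qed
qed

text \<open>The part of the Laplace exponent of \<open>f\<close> that comes from \<open>y\<^sub>C = 0\<close>. Points of the process with \<open>y\<^sub>C = 0\<close> are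
  independent of the others, so this part stays unaffected by conditioning on the process projected to \<open>C\<close>.\<close>

definition atom_integral :: "'v set \<Rightarrow> (('v \<Rightarrow> real) \<Rightarrow> ennreal) \<Rightarrow> ennreal" where
  "atom_integral C f = (LI y. indicator {origin C} (restrict y C) * ennreal (1 - expn (f y)))"

text \<open>The exponents of \<open>f + \<phi>(y\<^sub>C)\<close> and of \<open>g(y\<^sub>C) + \<phi>(y\<^sub>C)\<close> agree on \<open>y\<^sub>C \<noteq> 0\<close>, because they are linear in the
  functions \<open>1 - e\<^sup>-\<^sup>f\<close> and \<open>1 - e\<^sup>-\<^sup>g\<close>, which have the same conditional version. On \<open>y\<^sub>C = 0\<close> they differ by the
  atom integral if \<open>\<phi>\<close> vanishes at the origin. Otherwise explosiveness decides: either \<open>y\<^sub>C = 0\<close> is a null set, or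
  both exponents are infinite.\<close>

lemma expn_laplace_exponent:
  assumes C: "C \<subseteq> V" and f [measurable]: "f \<in> borel_measurable \<Lambda>"
    and p: "cond_version \<Lambda> C (\<lambda>y. ennreal (1 - expn (f y))) p" "\<And>c. p c \<le> 1"
    and \<phi> [measurable]: "\<phi> \<in> borel_measurable (Reuc C)"
  shows "expn (LI y. ennreal (1 - expn (f y + \<phi> (restrict y C)))) =
    expn (atom_integral C f) * expn (LI y. ennreal (1 - expn (cond_exponent C p (restrict y C) + \<phi> (restrict y C))))"
proof -
  define r where "r = (\<lambda>y :: 'v \<Rightarrow> real. restrict y C)"
  have [measurable]: "r \<in> \<Lambda> \<rightarrow>\<^sub>M Reuc C" unfolding r_def by (rule measurable_restrict_\<Lambda>[OF C])
  have [measurable]: "{origin C} \<in> sets (Reuc C)" by (rule origin_sets[OF finite_sub[OF C]])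
  have r_sp: "r y \<in> space (Reuc C)" for y by (simp add: r_def)
  have [measurable]: "p \<in> borel_measurable (Reuc C)" using p(1) by (simp add: cond_version_def)
  define g where "g = cond_exponent C p"
  have [measurable]: "g \<in> borel_measurable (Reuc C)"
    unfolding g_def by (rule measurable_cond_exponent[OF finite_sub[OF C]]) measurable
  define z :: "('v \<Rightarrow> real) \<Rightarrow> ennreal" where "z = indicator {origin C}"
  define nz :: "('v \<Rightarrow> real) \<Rightarrow> ennreal" where "nz = indicator (space (Reuc C) - {origin C})"
  have [measurable]: "z \<in> borel_measurable (Reuc C)" "nz \<in> borel_measurable (Reuc C)"
    unfolding z_def nz_def by measurable
  have split: "(LI y. h y) = (LI y. z (r y) * h y) + (LI y. nz (r y) * h y)"
    if [measurable]: "h \<in> borel_measurable \<Lambda>" for h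
    unfolding z_def nz_def r_def by (rule lambda_integral_split[OF C that]) measurable
  have nz_part: "(LI y. nz (r y) * ennreal (1 - expn (h y + \<phi> (r y)))) =
      (LI y. nz (r y) * ennreal (1 - expn (\<phi> (r y)))) +
      (LI y. (nz (r y) * ennreal (expn (\<phi> (r y)))) * ennreal (1 - expn (h y)))"
    if [measurable]: "h \<in> borel_measurable \<Lambda>" for h
    unfolding ennreal_one_minus_expn_add distrib_left
    by (subst nn_integral_add) (auto simp: mult.assoc)
  have kern: "(LI y. (nz (r y) * ennreal (expn (\<phi> (r y)))) * ennreal (1 - expn (f y))) =
      (LI y. (nz (r y) * ennreal (expn (\<phi> (r y)))) * ennreal (1 - expn (g (r y))))"
  proof -
    define \<psi> where "\<psi> c = nz c * ennreal (expn (\<phi> c))" for c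
    have "\<psi> \<in> borel_measurable (Reuc C)" unfolding \<psi>_def by measurable
    moreover have "\<psi> (origin C) = 0" by (simp add: \<psi>_def nz_def)
    ultimately have "(LI y. \<psi> (r y) * ennreal (1 - expn (f y))) = (LI y. \<psi> (r y) * p (r y))"
      using p(1) unfolding cond_version_def r_def by blast
    also have "\<dots> = (LI y. \<psi> (r y) * ennreal (1 - expn (g (r y))))"
    proof (intro nn_integral_cong)
      fix y
      show "\<psi> (r y) * p (r y) = \<psi> (r y) * ennreal (1 - expn (g (r y)))"
        using expn_cond_exponent(2)[of p "r y" C, OF p(2)]
        by (cases "r y = origin C") (simp_all add: g_def \<psi>_def nz_def)
    qed
    finally show ?thesis by (simp add: \<psi>_def)
  qed
  let ?J1 = "LI y. ennreal (1 - expn (f y + \<phi> (r y)))"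
  let ?J2 = "LI y. ennreal (1 - expn (g (r y) + \<phi> (r y)))"
  let ?K = "LI y. nz (r y) * ennreal (1 - expn (f y + \<phi> (r y)))"
  have K: "(LI y. nz (r y) * ennreal (1 - expn (g (r y) + \<phi> (r y)))) = ?K"
    by (subst (1 2) nz_part) (simp_all add: kern)
  define a where "a = \<phi> (origin C)"
  have z_cong: "z (r y) * h (r y) = z (r y) * h (origin C)" for y and h :: "_ \<Rightarrow> ennreal"
    by (auto simp: z_def indicator_def)
  have z_cong2: "z (r y) * ennreal (1 - expn (x + \<phi> (r y))) = z (r y) * ennreal (1 - expn (x + a))" for y x
    by (auto simp: z_def indicator_def a_def)
  have J1: "?J1 = (LI y. z (r y) * ennreal (1 - expn (f y + a))) + ?K"
    by (subst split) (simp_all add: z_cong2)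
  have J2: "?J2 = (LI y. z (r y) * ennreal (1 - expn a)) + ?K"
    by (subst split, simp, subst z_cong[of _ "\<lambda>c. ennreal (1 - expn (g c + \<phi> c))"], subst K)
      (simp add: g_def a_def)
  have zint: "(LI y. z (r y) * ennreal (1 - expn a)) = emeasure \<Lambda> {y \<in> space \<Lambda>. r y = origin C} * ennreal (1 - expn a)"
  proof -
    have "{y \<in> space \<Lambda>. r y \<in> {origin C}} \<in> sets \<Lambda>" by measurable
    then have m: "{y \<in> space \<Lambda>. r y = origin C} \<in> sets \<Lambda>" by simp
    have "(LI y. z (r y) * ennreal (1 - expn a)) = (LI y. indicator {y \<in> space \<Lambda>. r y = origin C} y * ennreal (1 - expn a))"
      by (intro nn_integral_cong) (auto simp: z_def indicator_def)
    then show ?thesis using m by (simp add: nn_integral_multc)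
  qed
  have atom: "atom_integral C f = (LI y. z (r y) * ennreal (1 - expn (f y)))"
    by (simp add: atom_integral_def z_def r_def)
  have "expn ?J1 = expn (atom_integral C f) * expn ?J2"
  proof (cases "a = 0")
    case True
    have "?J1 = atom_integral C f + ?J2" unfolding J1 J2 atom using True by simp
    then show ?thesis by (simp add: expn_add)
  next
    case False
    have "emeasure \<Lambda> {y \<in> space \<Lambda>. r y = origin C} \<in> {0, \<infinity>}"
      using emeasure_restrict_origin[OF C] by (simp add: r_def)
    then show ?thesis
    proof
      assume "emeasure \<Lambda> {y \<in> space \<Lambda>. r y = origin C} = 0"
      moreover have "{y \<in> space \<Lambda>. r y \<in> {origin C}} \<in> sets \<Lambda>" by measurable
      ultimately have "AE y in \<Lambda>. \<not> (r y = origin C)"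
        by (subst AE_iff_measurable[OF _ refl]) auto
      then have "AE y in \<Lambda>. z (r y) = 0" by eventually_elim (simp add: z_def)
      then have "(LI y. z (r y) * h y) = 0" if [measurable]: "h \<in> borel_measurable \<Lambda>" for h
      proof -
        have "AE y in \<Lambda>. z (r y) * h y = 0" using \<open>AE y in \<Lambda>. z (r y) = 0\<close> by eventually_elim simp
        then show ?thesis by (simp add: nn_integral_0_iff_AE)
      qed
      then have "?J1 = ?K" "?J2 = ?K" "atom_integral C f = 0"
        unfolding J1 J2 atom by simp_all
      then show ?thesis by simp
    next
      assume inf: "emeasure \<Lambda> {y \<in> space \<Lambda>. r y = origin C} \<in> {\<infinity>}"
      have "expn a < 1" using expn_le_1[of a] expn_eq_1_iff[of a] False by linarith
      then have top: "(LI y. z (r y) * ennreal (1 - expn a)) = \<infinity>"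
        unfolding zint using inf False by (simp add: ennreal_top_mult)
      have "(LI y. z (r y) * ennreal (1 - expn a)) \<le> (LI y. z (r y) * ennreal (1 - expn (f y + a)))"
        by (intro nn_integral_mono mult_left_mono ennreal_leI diff_left_mono expn_antimono) auto
      then have "?J1 = \<infinity>" "?J2 = \<infinity>" unfolding J1 J2 using top by (simp_all add: top_unique)
      then show ?thesis by simp
    qed
  qed
  then show ?thesis by (simp add: r_def g_def)
qed

abbreviation "\<sigma>proj C \<equiv> vimage_algebra (space M) (proj_process \<xi> C) (Npoint (Reuc C))"

lemma finite_measure_subalgebra_proj: "C \<subseteq> V \<Longrightarrow> finite_measure_subalgebra M (\<sigma>proj C)"
  using subalgebra_vimage(1)[OF measurable_proj] by unfold_locales

lemma measurable_integral_proj: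
  assumes "C \<subseteq> V" "f \<in> borel_measurable (Reuc C)"
  shows "(\<lambda>\<omega>. \<integral>\<^sup>+z. f z \<partial>proj_process \<xi> C \<omega>) \<in> borel_measurable M"
    and "(\<lambda>\<omega>. \<integral>\<^sup>+z. f z \<partial>proj_process \<xi> C \<omega>) \<in> borel_measurable (\<sigma>proj C)"
  using measurable_nn_integral_process[OF measurable_proj[OF assms(1)] assms(2)]
    measurable_vimage_compose[OF measurable_proj[OF assms(1)] measurable_nn_integral_Npoint[OF assms(2)]] by auto

text \<open>Multiplied by any Laplace functional \<open>exp(-\<xi>\<^sub>C(\<phi>))\<close> the two sides have the same expectation, by
  \<open>expn_laplace_exponent\<close>; so they have the same integrals over all events of \<open>\<xi>\<^sub>C\<close>.\<close>

lemma cond_laplace: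
  assumes C: "C \<subseteq> V" and f [measurable]: "f \<in> borel_measurable \<Lambda>"
    and p: "cond_version \<Lambda> C (\<lambda>y. ennreal (1 - expn (f y))) p" "\<And>c. p c \<le> 1"
  shows "AE \<omega> in M. real_cond_exp M (\<sigma>proj C) (\<lambda>\<omega>. expn (\<integral>\<^sup>+y. f y \<partial>\<xi> \<omega>)) \<omega> =
    expn (atom_integral C f) * expn (\<integral>\<^sup>+z. cond_exponent C p z \<partial>proj_process \<xi> C \<omega>)"
proof -
  interpret finite_measure_subalgebra M "\<sigma>proj C" by (rule finite_measure_subalgebra_proj[OF C])
  define r where "r = (\<lambda>y :: 'v \<Rightarrow> real. restrict y C)"
  have [measurable]: "r \<in> \<Lambda> \<rightarrow>\<^sub>M Reuc C" unfolding r_def by (rule measurable_restrict_\<Lambda>[OF C])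
  have [measurable]: "p \<in> borel_measurable (Reuc C)" using p(1) by (simp add: cond_version_def)
  define g where "g = cond_exponent C p"
  have g [measurable]: "g \<in> borel_measurable (Reuc C)"
    unfolding g_def by (rule measurable_cond_exponent[OF finite_sub[OF C]]) measurable
  define c where "c = expn (atom_integral C f)"
  define U where "U \<omega> = expn (\<integral>\<^sup>+y. f y \<partial>\<xi> \<omega>)" for \<omega>
  define Q where "Q \<omega> = Lproj C g \<omega>" for \<omega>
  have U [measurable]: "U \<in> borel_measurable M"
    unfolding U_def using measurable_integral_\<xi>[OF f] by measurable
  have Q [measurable]: "Q \<in> borel_measurable M" and QS [measurable]: "Q \<in> borel_measurable (\<sigma>proj C)"
    unfolding Q_def using measurable_integral_proj[OF C g] by measurable
  have bnd: "\<bar>U \<omega>\<bar> \<le> 1" "\<bar>Q \<omega>\<bar> \<le> 1" "\<bar>c\<bar> \<le> 1" for \<omega> by (simp_all add: U_def Q_def c_def)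
  have iU: "integrable M U" and iQ: "integrable M (\<lambda>\<omega>. c * Q \<omega>)"
    by (auto intro!: integrable_bounded_1 bnd integrable_mult_right)
  have zero: "(\<integral>\<omega>. (U \<omega> - c * Q \<omega>) * Lproj C \<phi> \<omega> \<partial>M) = 0"
    if \<phi> [measurable]: "\<phi> \<in> borel_measurable (Reuc C)" for \<phi>
  proof -
    define E where "E \<omega> = Lproj C \<phi> \<omega>" for \<omega>
    have [measurable]: "E \<in> borel_measurable M"
      unfolding E_def using measurable_integral_proj[OF C \<phi>] by measurable
    have E1: "\<bar>E \<omega>\<bar> \<le> 1" for \<omega> by (simp add: E_def)
    have "(\<integral>\<omega>. U \<omega> * E \<omega> \<partial>M) = (\<integral>\<omega>. expn (\<integral>\<^sup>+y. f y + \<phi> (r y) \<partial>\<xi> \<omega>) \<partial>M)"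
      by (intro Bochner_Integration.integral_cong refl)
        (simp add: U_def E_def nn_integral_proj[OF C _ \<phi>] integral_\<xi>_add expn_add flip: r_def[THEN fun_cong])
    also have "\<dots> = expn (LI y. ennreal (1 - expn (f y + \<phi> (r y))))"
      by (rule laplace) measurable
    also have "\<dots> = c * expn (LI y. ennreal (1 - expn (g (r y) + \<phi> (r y))))"
      unfolding c_def g_def r_def by (rule expn_laplace_exponent[OF C f p \<phi>])
    also have "expn (LI y. ennreal (1 - expn (g (r y) + \<phi> (r y)))) = (\<integral>\<omega>. expn (\<integral>\<^sup>+y. g (r y) + \<phi> (r y) \<partial>\<xi> \<omega>) \<partial>M)"
      by (rule laplace[symmetric]) measurable
    also have "\<dots> = (\<integral>\<omega>. Q \<omega> * E \<omega> \<partial>M)"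
      by (intro Bochner_Integration.integral_cong refl)
        (simp add: Q_def E_def nn_integral_proj[OF C _ \<phi>] nn_integral_proj[OF C _ g] integral_\<xi>_add expn_add flip: r_def[THEN fun_cong])
    finally have "(\<integral>\<omega>. U \<omega> * E \<omega> \<partial>M) = (\<integral>\<omega>. (c * Q \<omega>) * E \<omega> \<partial>M)" by (simp add: mult.assoc)
    moreover have "integrable M (\<lambda>\<omega>. U \<omega> * E \<omega>)" "integrable M (\<lambda>\<omega>. (c * Q \<omega>) * E \<omega>)"
      by (rule integrable_mult_bounded[OF iU _ E1] integrable_mult_bounded[OF iQ _ E1]; measurable)+
    ultimately show ?thesis by (simp add: left_diff_distrib E_def)
  qed
  have "AE \<omega> in M. real_cond_exp M (\<sigma>proj C) U \<omega> = c * Q \<omega>"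
  proof (rule real_cond_exp_charact)
    fix S assume "S \<in> sets (\<sigma>proj C)"
    then obtain H where H: "H \<in> sets (Npoint (Reuc C))" "S = proj_process \<xi> C -` H \<inter> space M"
      using subalgebra_vimage(2)[OF measurable_proj[OF C]] by auto
    have S: "S \<in> sets M" unfolding H(2) using measurable_proj[OF C] H(1) by measurable
    have "(\<integral>\<omega>. (U \<omega> - c * Q \<omega>) * indicator H (proj_process \<xi> C \<omega>) \<partial>M) = 0"
      using iU iQ H(1) zero by (intro integral_Npoint_eq_0[OF prob_space_axioms measurable_proj[OF C]]) auto
    moreover have "(\<integral>\<omega>. (U \<omega> - c * Q \<omega>) * indicator H (proj_process \<xi> C \<omega>) \<partial>M) = (LINT \<omega>:S|M. U \<omega> - c * Q \<omega>)"
      unfolding set_lebesgue_integral_def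
      by (intro Bochner_Integration.integral_cong) (auto simp: H(2) indicator_def)
    moreover have "(LINT \<omega>:S|M. U \<omega> - c * Q \<omega>) = (LINT \<omega>:S|M. U \<omega>) - (LINT \<omega>:S|M. c * Q \<omega>)"
      using S iU iQ by (intro set_integral_diff) (simp_all only: set_integrable_def integrable_mult_indicator)
    ultimately show "(LINT \<omega>:S|M. U \<omega>) = (LINT \<omega>:S|M. c * Q \<omega>)" by simp
  qed (use iU iQ in measurable)
  then show ?thesis by (simp add: U_def[abs_def] Q_def c_def g_def)
qed

text \<open>Explosiveness makes the number of points at the origin a constant. If it is infinite and \<open>f\<close> does not
  vanish there, then \<open>exp(-\<xi>\<^sub>I(f)) = 0\<close>; otherwise the value of \<open>f\<close> at the origin is irrelevant.\<close>

lemma proj_process_remove_origin: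
  assumes I: "I \<subseteq> V" and f [measurable]: "f \<in> borel_measurable (Reuc I)"
  obtains "AE \<omega> in M. Lproj I f \<omega> = 0"
  | f' where "f' \<in> borel_measurable (Reuc I)" "f' (origin I) = 0"
      "AE \<omega> in M. Lproj I f \<omega> = Lproj I f' \<omega>"
proof -
  define r where "r = (\<lambda>y :: 'v \<Rightarrow> real. restrict y I)"
  have [measurable]: "r \<in> \<Lambda> \<rightarrow>\<^sub>M Reuc I" unfolding r_def by (rule measurable_restrict_\<Lambda>[OF I])
  have [measurable]: "{origin I} \<in> sets (Reuc I)" by (rule origin_sets[OF finite_sub[OF I]])
  define S where "S = {y \<in> space \<Lambda>. r y \<in> {origin I}}"
  have S: "S \<in> sets \<Lambda>" unfolding S_def by measurable
  have "emeasure \<Lambda> S \<in> {0, \<infinity>}" using emeasure_restrict_origin[OF I] by (simp add: S_def r_def)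
  then consider "f (origin I) = 0" | "f (origin I) \<noteq> 0" "emeasure \<Lambda> S = \<infinity>" | "emeasure \<Lambda> S = 0" by blast
  then show thesis
  proof cases
    case 1
    then show thesis using that(2)[OF f] by simp
  next
    case 2
    have "AE \<omega> in M. Lproj I f \<omega> = 0"
      using AE_infinite[OF S 2(2)] AE_space
    proof eventually_elim
      case (elim \<omega>)
      have "\<infinity> = f (origin I) * emeasure (\<xi> \<omega>) S" using elim(1) 2(1) by (simp add: ennreal_mult_top)
      also have "\<dots> = (\<integral>\<^sup>+y. f (origin I) * indicator S y \<partial>\<xi> \<omega>)"
        using S by (simp add: nn_integral_cmult_indicator sets_\<xi>[OF elim(2)])
      also have "\<dots> \<le> (\<integral>\<^sup>+y. f (r y) \<partial>\<xi> \<omega>)"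
        by (intro nn_integral_mono) (auto simp: S_def indicator_def)
      also have "\<dots> = (\<integral>\<^sup>+z. f z \<partial>proj_process \<xi> I \<omega>)"
        using nn_integral_proj[OF I elim(2) f] by (simp add: r_def)
      finally show ?case by (simp add: top_unique)
    qed
    then show thesis by (rule that(1))
  next
    case 3
    define f' where "f' z = (if z \<in> {origin I} then 0 else f z)" for z
    have f' [measurable]: "f' \<in> borel_measurable (Reuc I)" unfolding f'_def by measurable
    have "AE \<omega> in M. Lproj I f \<omega> = Lproj I f' \<omega>"
      using AE_null[OF S 3] AE_space
    proof eventually_elim
      case (elim \<omega>)
      have "AE y in \<xi> \<omega>. y \<notin> S"
        using S elim by (intro AE_not_in) (simp add: null_sets_def sets_\<xi>[OF elim(2)])
      then have "AE y in \<xi> \<omega>. f (r y) = f' (r y)"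
        using AE_space sets_eq_imp_space_eq[OF sets_\<xi>[OF elim(2)]]
        by (elim AE_mp, intro AE_I2) (auto simp: S_def f'_def)
      then have "(\<integral>\<^sup>+y. f (r y) \<partial>\<xi> \<omega>) = (\<integral>\<^sup>+y. f' (r y) \<partial>\<xi> \<omega>)" by (rule nn_integral_cong_AE)
      then show ?case
        using nn_integral_proj[OF I elim(2) f] nn_integral_proj[OF I elim(2) f'] by (simp add: r_def)
    qed
    then show thesis by (intro that(2)[OF f']) (simp_all add: f'_def)
  qed
qed

text \<open>Under the product law the functions \<open>e\<^sup>-\<^sup>f\<^sup>(\<^sup>a\<^sup>)\<close> and \<open>e\<^sup>-\<^sup>g\<^sup>(\<^sup>b\<^sup>)\<close> are conditionally uncorrelated, so
  \<open>1 - e\<^sup>-\<^sup>f\<^sup>-\<^sup>g\<close> has conditional version \<open>1 - (1 - p) (1 - q)\<close>.\<close>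

lemma cond_version_sum_exponent:
  assumes ABC: "A \<subseteq> V" "B \<subseteq> V" "C \<subseteq> V" and fact: "factorizes \<Lambda> A B C"
    and f [measurable]: "f \<in> borel_measurable (Reuc A)" and g [measurable]: "g \<in> borel_measurable (Reuc B)"
    and p: "cond_version \<Lambda> C (\<lambda>y. ennreal (1 - expn (f (restrict y A)))) p" "\<And>c. p c \<le> 1"
    and q: "cond_version \<Lambda> C (\<lambda>y. ennreal (1 - expn (g (restrict y B)))) q" "\<And>c. q c \<le> 1"
  shows "cond_version \<Lambda> C (\<lambda>y. ennreal (1 - expn (f (restrict y A) + g (restrict y B)))) (\<lambda>c. p c + (1 - p c) * q c)"
proof -
  define a where "a = (\<lambda>y :: 'v \<Rightarrow> real. restrict y A)"
  define b where "b = (\<lambda>y :: 'v \<Rightarrow> real. restrict y B)"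
  define r where "r = (\<lambda>y :: 'v \<Rightarrow> real. restrict y C)"
  have [measurable]: "a \<in> \<Lambda> \<rightarrow>\<^sub>M Reuc A" "b \<in> \<Lambda> \<rightarrow>\<^sub>M Reuc B" "r \<in> \<Lambda> \<rightarrow>\<^sub>M Reuc C"
    unfolding a_def b_def r_def using ABC by measurable
  have [measurable]: "p \<in> borel_measurable (Reuc C)" "q \<in> borel_measurable (Reuc C)"
    using p(1) q(1) by (auto simp: cond_version_def)
  let ?u = "\<lambda>y. ennreal (1 - expn (f (a y)))" and ?w = "\<lambda>y. ennreal (1 - expn (g (b y)))"
  define s where "s c = p c + (1 - p c) * q c" for c
  have [measurable]: "s \<in> borel_measurable (Reuc C)" unfolding s_def by measurable
  have s: "s c + p c * q c = p c + q c" for c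
  proof -
    have "s c + p c * q c = p c + ((1 - p c) + p c) * q c" by (simp add: s_def distrib_right add.assoc)
    also have "(1 - p c) + p c = 1" using p(2)[of c] by (simp add: diff_add_cancel_ennreal)
    finally show ?thesis by simp
  qed
  have eq: "(LI y. indicator H (r y) * ennreal (1 - expn (f (a y) + g (b y)))) = (LI y. indicator H (r y) * s (r y))"
    if H [measurable]: "H \<in> sets (Reuc C)" and sub: "H \<subseteq> layer C n" for n H
  proof -
    have H0: "indicator H (origin C) = (0 :: ennreal)" using sub origin_notin_layer[of C n] by (auto simp: indicator_def)
    have Hm: "indicator H \<in> borel_measurable (Reuc C)" by measurable
    let ?X = "LI y. indicator H (r y) * ennreal (1 - expn (f (a y) + g (b y)))"
    let ?Y = "LI y. indicator H (r y) * (?u y * ?w y)"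
    have "?X + ?Y = (LI y. indicator H (r y) * (ennreal (1 - expn (f (a y) + g (b y))) + ?u y * ?w y))"
      by (subst nn_integral_add[symmetric]) (auto simp: distrib_left)
    also have "\<dots> = (LI y. indicator H (r y) * ?u y) + (LI y. indicator H (r y) * ?w y)"
      unfolding one_minus_expn_inclusion_exclusion distrib_left by (rule nn_integral_add) measurable
    also have "(LI y. indicator H (r y) * ?u y) = (LI y. indicator H (r y) * p (r y))"
      using p(1) Hm H0 unfolding cond_version_def a_def r_def by blast
    also have "(LI y. indicator H (r y) * ?w y) = (LI y. indicator H (r y) * q (r y))"
      using q(1) Hm H0 unfolding cond_version_def b_def r_def by blast
    also have "(LI y. indicator H (r y) * p (r y)) + (LI y. indicator H (r y) * q (r y)) =
        (LI y. indicator H (r y) * (s (r y) + p (r y) * q (r y)))"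
      unfolding s distrib_left by (rule nn_integral_add[symmetric]) measurable
    also have "\<dots> = (LI y. indicator H (r y) * s (r y)) + (LI y. indicator H (r y) * (p (r y) * q (r y)))"
      unfolding distrib_left by (rule nn_integral_add) measurable
    also have "(LI y. indicator H (r y) * (p (r y) * q (r y))) = ?Y"
    proof -
      have "(LI y. indicator H (restrict y C) * (ennreal (1 - expn (f (restrict y A))) * ennreal (1 - expn (g (restrict y B))))) =
        (LI y. indicator H (restrict y C) * (p (restrict y C) * q (restrict y C)))"
        using Hm H0 f g by (intro factorizes_product[OF ABC fact _ _ p(1) q(1)]) measurable
      then show ?thesis by (simp add: a_def b_def r_def)
    qed
    finally have sum: "?X + ?Y = (LI y. indicator H (r y) * s (r y)) + ?Y" .
    have "?u y * ?w y \<le> 1" for y by (simp add: mult_le_one flip: ennreal_mult)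
    then have "?Y < \<infinity>" unfolding r_def using H sub by (intro nn_integral_layer_finite[OF ABC(3)]) auto
    then have "?Y \<noteq> \<top>" by simp
    then show ?thesis using sum by (simp add: add.commute[of _ ?Y] ennreal_add_left_cancel)
  qed
  show ?thesis
    unfolding cond_version_def
  proof (intro conjI ballI impI)
    show "(\<lambda>c. p c + (1 - p c) * q c) \<in> borel_measurable (Reuc C)" by measurable
    fix \<phi> :: "('v \<Rightarrow> real) \<Rightarrow> ennreal" assume \<phi>: "\<phi> \<in> borel_measurable (Reuc C)" "\<phi> (origin C) = 0"
    have "(LI y. \<phi> (restrict y C) * ennreal (1 - expn (f (a y) + g (b y)))) = (LI y. \<phi> (restrict y C) * s (r y))"
    proof (rule nn_integral_eq_off_origin[OF ABC(3) _ _ _ \<phi>])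
      show "(LI y. indicator H (restrict y C) * ennreal (1 - expn (f (a y) + g (b y)))) =
        (LI y. indicator H (restrict y C) * s (r y))" if "H \<in> sets (Reuc C)" "H \<subseteq> layer C n" for n H
        using eq[OF that] by (simp only: r_def)
    qed measurable
    then show "(LI y. \<phi> (restrict y C) * ennreal (1 - expn (f (restrict y A) + g (restrict y B)))) =
        (LI y. \<phi> (restrict y C) * (p (restrict y C) + (1 - p (restrict y C)) * q (restrict y C)))"
      by (simp add: a_def b_def r_def s_def)
  qed
qed

lemma cond_exponent_add:
  assumes "p c \<le> 1" "q c \<le> (1 :: ennreal)"
  shows "cond_exponent C (\<lambda>c. p c + (1 - p c) * q c) c = cond_exponent C p c + cond_exponent C q c"
    and "p c + (1 - p c) * q c \<le> 1"
proof -
  obtain p' where p': "0 \<le> p'" "p' \<le> 1" "p c = ennreal p'"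
    using assms(1) by (cases "p c") (auto simp: top_unique)
  obtain q' where q': "0 \<le> q'" "q' \<le> 1" "q c = ennreal q'"
    using assms(2) by (cases "q c") (auto simp: top_unique)
  have m: "(1 - p') * q' \<le> 1 - p'" using p' q' by (simp add: mult_left_le)
  have s: "p c + (1 - p c) * q c = ennreal (p' + (1 - p') * q')"
    using p' q' by (simp add: ennreal_minus ennreal_1[symmetric] ennreal_mult ennreal_plus del: ennreal_1)
  show le: "p c + (1 - p c) * q c \<le> 1" unfolding s using m by simp
  show "cond_exponent C (\<lambda>c. p c + (1 - p c) * q c) c = cond_exponent C p c + cond_exponent C q c"
  proof (cases "c = origin C")
    case False
    have "expn (cond_exponent C (\<lambda>c. p c + (1 - p c) * q c) c) = 1 - (p' + (1 - p') * q')"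
      unfolding expn_cond_exponent(1)[of "\<lambda>c. p c + (1 - p c) * q c", OF le False] s using p' q' by (simp del: ennreal_plus)
    also have "\<dots> = (1 - p') * (1 - q')" by (simp add: algebra_simps)
    also have "\<dots> = expn (cond_exponent C p c + cond_exponent C q c)"
      using expn_cond_exponent(1)[of p, OF assms(1) False] expn_cond_exponent(1)[of q, OF assms(2) False] p' q'
      by (simp add: expn_add)
    finally show ?thesis by (rule expn_inj)
  qed simp
qed

section \<open>Conditional independence of projected Poisson processes\<close>

text \<open>By \<open>cond_laplace\<close> it suffices that the exponents for \<open>f(a) + g(b)\<close> are the sums of those for \<open>f(a)\<close> and
  \<open>g(b)\<close>. For the conditional exponents this is the second part of \<open>factorizes\<close>. For the atom integrals it is the
  first part: on \<open>y\<^sub>C = 0\<close> almost everywhere \<open>a = 0\<close> or \<open>b = 0\<close>, so that one summand vanishes.\<close>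

lemma cond_uncorrelated_if_factorizes:
  assumes ABC: "A \<subseteq> V" "B \<subseteq> V" "C \<subseteq> V" and fact: "factorizes \<Lambda> A B C"
    and f [measurable]: "f \<in> borel_measurable (Reuc A)" and f0: "f (origin A) = 0"
    and g [measurable]: "g \<in> borel_measurable (Reuc B)" and g0: "g (origin B) = 0"
  shows "cond_uncorrelated M (\<sigma>proj C)
    (\<lambda>\<omega>. Lproj A f \<omega>) (\<lambda>\<omega>. Lproj B g \<omega>)"
proof -
  interpret finite_measure_subalgebra M "\<sigma>proj C" by (rule finite_measure_subalgebra_proj[OF ABC(3)])
  define a where "a = (\<lambda>y :: 'v \<Rightarrow> real. restrict y A)"
  define b where "b = (\<lambda>y :: 'v \<Rightarrow> real. restrict y B)"
  define r where "r = (\<lambda>y :: 'v \<Rightarrow> real. restrict y C)"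
  have abr [measurable]: "a \<in> \<Lambda> \<rightarrow>\<^sub>M Reuc A" "b \<in> \<Lambda> \<rightarrow>\<^sub>M Reuc B" "r \<in> \<Lambda> \<rightarrow>\<^sub>M Reuc C"
    unfolding a_def b_def r_def using ABC by measurable
  have fa [measurable]: "(\<lambda>y. f (a y)) \<in> borel_measurable \<Lambda>" and gb [measurable]: "(\<lambda>y. g (b y)) \<in> borel_measurable \<Lambda>"
    by measurable
  obtain p where p: "cond_version \<Lambda> C (\<lambda>y. ennreal (1 - expn (f (a y)))) p" "\<And>c. p c \<le> 1"
    by (rule cond_version_exists[OF ABC(3), of "\<lambda>y. ennreal (1 - expn (f (a y)))"]) auto
  obtain q where q: "cond_version \<Lambda> C (\<lambda>y. ennreal (1 - expn (g (b y)))) q" "\<And>c. q c \<le> 1"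
    by (rule cond_version_exists[OF ABC(3), of "\<lambda>y. ennreal (1 - expn (g (b y)))"]) auto
  define s where "s c = p c + (1 - p c) * q c" for c
  have s: "cond_version \<Lambda> C (\<lambda>y. ennreal (1 - expn (f (a y) + g (b y)))) s" "\<And>c. s c \<le> 1"
  proof -
    show "cond_version \<Lambda> C (\<lambda>y. ennreal (1 - expn (f (a y) + g (b y)))) s"
      unfolding s_def a_def b_def
      by (rule cond_version_sum_exponent[OF ABC fact f g p[unfolded a_def] q[unfolded b_def]])
    show "s c \<le> 1" for c
      unfolding s_def using p(2) q(2) by (rule cond_exponent_add(2))
  qed
  have meas: "p \<in> borel_measurable (Reuc C)" "q \<in> borel_measurable (Reuc C)"
    using p(1) q(1) by (auto simp: cond_version_def)
  note ce = measurable_cond_exponent[OF finite_sub[OF ABC(3)] meas(1)] measurable_cond_exponent[OF finite_sub[OF ABC(3)] meas(2)]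
  let ?L = "\<lambda>f \<omega>. expn (\<integral>\<^sup>+y. f y \<partial>\<xi> \<omega>)"
  let ?K = "\<lambda>p \<omega>. expn (\<integral>\<^sup>+z. cond_exponent C p z \<partial>proj_process \<xi> C \<omega>)"
  have LA: "Lproj A f \<omega> = ?L (\<lambda>y. f (a y)) \<omega>" if "\<omega> \<in> space M" for \<omega>
    using nn_integral_proj[OF ABC(1) that f] by (simp add: a_def)
  have LB: "Lproj B g \<omega> = ?L (\<lambda>y. g (b y)) \<omega>" if "\<omega> \<in> space M" for \<omega>
    using nn_integral_proj[OF ABC(2) that g] by (simp add: b_def)
  have LAB: "?L (\<lambda>y. f (a y)) \<omega> * ?L (\<lambda>y. g (b y)) \<omega> = ?L (\<lambda>y. f (a y) + g (b y)) \<omega>" if "\<omega> \<in> space M" for \<omega>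
    using integral_\<xi>_add[OF that fa gb] by (simp add: expn_add)
  have K: "?K s \<omega> = ?K p \<omega> * ?K q \<omega>" for \<omega>
  proof -
    have "(\<integral>\<^sup>+z. cond_exponent C s z \<partial>proj_process \<xi> C \<omega>) = (\<integral>\<^sup>+z. cond_exponent C p z + cond_exponent C q z \<partial>proj_process \<xi> C \<omega>)"
      using cond_exponent_add(1)[of p _ q] p(2) q(2) by (simp add: s_def[abs_def])
    also have "\<dots> = (\<integral>\<^sup>+z. cond_exponent C p z \<partial>proj_process \<xi> C \<omega>) + (\<integral>\<^sup>+z. cond_exponent C q z \<partial>proj_process \<xi> C \<omega>)"
      using ce by (intro nn_integral_add) (simp_all add: proj_process_def)
    finally show ?thesis by (simp add: expn_add)
  qed
  have atom: "atom_integral C (\<lambda>y. f (a y) + g (b y)) = atom_integral C (\<lambda>y. f (a y)) + atom_integral C (\<lambda>y. g (b y))"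
  proof -
    have oC [measurable]: "{origin C} \<in> sets (Reuc C)" "{origin A} \<in> sets (Reuc A)" "{origin B} \<in> sets (Reuc B)"
      using ABC finite_sub by simp_all
    have "{y \<in> space \<Lambda>. r y \<in> {origin C} \<and> a y \<notin> {origin A} \<and> b y \<notin> {origin B}} \<in> sets \<Lambda>" by measurable
    then have "AE y in \<Lambda>. \<not> (r y = origin C \<and> a y \<noteq> origin A \<and> b y \<noteq> origin B)"
      using fact unfolding factorizes_def by (subst AE_iff_measurable[OF _ refl]) (auto simp: a_def b_def r_def)
    then have "AE y in \<Lambda>. indicator {origin C} (r y) * ennreal (1 - expn (f (a y) + g (b y))) =
        indicator {origin C} (r y) * ennreal (1 - expn (f (a y))) + indicator {origin C} (r y) * ennreal (1 - expn (g (b y)))"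
      by eventually_elim (auto simp: indicator_def f0 g0)
    then have "(LI y. indicator {origin C} (r y) * ennreal (1 - expn (f (a y) + g (b y)))) =
        (LI y. indicator {origin C} (r y) * ennreal (1 - expn (f (a y))) + indicator {origin C} (r y) * ennreal (1 - expn (g (b y))))"
      by (rule nn_integral_cong_AE)
    also have "\<dots> = (LI y. indicator {origin C} (r y) * ennreal (1 - expn (f (a y)))) +
        (LI y. indicator {origin C} (r y) * ennreal (1 - expn (g (b y))))"
      by (rule nn_integral_add) measurable
    finally show ?thesis by (simp add: atom_integral_def r_def)
  qed
  have m: "?L h \<in> borel_measurable M" if "h \<in> borel_measurable \<Lambda>" for h
    using measurable_integral_\<xi>[OF that] by measurable
  have "cond_uncorrelated M (\<sigma>proj C) (?L (\<lambda>y. f (a y))) (?L (\<lambda>y. g (b y)))"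
  proof -
    have "AE \<omega> in M. real_cond_exp M (\<sigma>proj C) (\<lambda>\<omega>. ?L (\<lambda>y. f (a y)) \<omega> * ?L (\<lambda>y. g (b y)) \<omega>) \<omega> =
        real_cond_exp M (\<sigma>proj C) (?L (\<lambda>y. f (a y) + g (b y))) \<omega>"
      using m[OF fa] m[OF gb] m[OF borel_measurable_add[OF fa gb]] by (intro real_cond_exp_cong AE_I2 LAB) auto
    moreover have "AE \<omega> in M. real_cond_exp M (\<sigma>proj C) (?L (\<lambda>y. f (a y) + g (b y))) \<omega> =
        expn (atom_integral C (\<lambda>y. f (a y) + g (b y))) * ?K s \<omega>"
      using s by (intro cond_laplace[OF ABC(3)]) auto
    moreover have "AE \<omega> in M. real_cond_exp M (\<sigma>proj C) (?L (\<lambda>y. f (a y))) \<omega> = expn (atom_integral C (\<lambda>y. f (a y))) * ?K p \<omega>"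
      by (rule cond_laplace[OF ABC(3) fa p])
    moreover have "AE \<omega> in M. real_cond_exp M (\<sigma>proj C) (?L (\<lambda>y. g (b y))) \<omega> = expn (atom_integral C (\<lambda>y. g (b y))) * ?K q \<omega>"
      by (rule cond_laplace[OF ABC(3) gb q])
    ultimately show ?thesis
      unfolding cond_uncorrelated_def by eventually_elim (simp add: atom expn_add K)
  qed
  then show ?thesis
    using m[OF fa] m[OF gb] measurable_integral_proj(1)[OF ABC(1) f] measurable_integral_proj(1)[OF ABC(2) g]
    by (subst cond_uncorrelated_cong_AE[OF finite_measure_subalgebra_proj[OF ABC(3)] _ _ _ _ AE_I2[OF LA] AE_I2[OF LB]]) auto
qed

lemma cond_indep_if_factorizes:
  assumes ABC: "A \<subseteq> V" "B \<subseteq> V" "C \<subseteq> V" and fact: "factorizes \<Lambda> A B C"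
  shows "proj_cond_indep A B C"
  unfolding cond_indep_Npoint_iff[OF prob_space_axioms measurable_proj[OF ABC(1)] measurable_proj[OF ABC(2)] measurable_proj[OF ABC(3)]]
proof (intro ballI)
  fix f g :: "('v \<Rightarrow> real) \<Rightarrow> ennreal"
  assume f: "f \<in> borel_measurable (Reuc A)" and g: "g \<in> borel_measurable (Reuc B)"
  note sub = finite_measure_subalgebra_proj[OF ABC(3)]
  let ?U = "\<lambda>f \<omega>. Lproj A f \<omega>" and ?W = "\<lambda>g \<omega>. Lproj B g \<omega>"
  have mU: "?U f \<in> borel_measurable M" if "f \<in> borel_measurable (Reuc A)" for f
    using measurable_integral_proj(1)[OF ABC(1) that] by measurable
  have mW: "?W g \<in> borel_measurable M" if "g \<in> borel_measurable (Reuc B)" for g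
    using measurable_integral_proj(1)[OF ABC(2) that] by measurable
  show "cond_uncorrelated M (\<sigma>proj C) (?U f) (?W g)"
  proof (rule proj_process_remove_origin[OF ABC(1) f])
    assume 0: "AE \<omega> in M. ?U f \<omega> = 0"
    show ?thesis
      using cond_uncorrelated_cong_AE[OF sub mU[OF f] _ mW[OF g] mW[OF g] 0] cond_uncorrelated_zero[OF sub] by simp
  next
    fix f' assume f': "f' \<in> borel_measurable (Reuc A)" "f' (origin A) = 0" "AE \<omega> in M. ?U f \<omega> = ?U f' \<omega>"
    show ?thesis
    proof (rule proj_process_remove_origin[OF ABC(2) g])
      assume 0: "AE \<omega> in M. ?W g \<omega> = 0"
      show ?thesis
        using cond_uncorrelated_cong_AE[OF sub mU[OF f] mU[OF f] mW[OF g] _ _ 0] cond_uncorrelated_zero[OF sub]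
        by (simp add: cond_uncorrelated_commute[of _ _ _ "\<lambda>_. 0"])
    next
      fix g' assume g': "g' \<in> borel_measurable (Reuc B)" "g' (origin B) = 0" "AE \<omega> in M. ?W g \<omega> = ?W g' \<omega>"
      show ?thesis
        unfolding cond_uncorrelated_cong_AE[OF sub mU[OF f] mU[OF f'(1)] mW[OF g] mW[OF g'(1)] f'(3) g'(3)]
        by (rule cond_uncorrelated_if_factorizes[OF ABC fact f'(1,2) g'(1,2)])
    qed
  qed
qed

text \<open>Conditional independence allows \<open>exp(-\<xi>\<^sub>B(g))\<close> to be replaced by its conditional expectation given \<open>\<xi>\<^sub>C\<close> also
  in the presence of \<open>exp(-\<xi>\<^sub>A(f))\<close>. Both sides are Laplace functionals, and comparing their exponents turns a
  statement about expectations into one about \<open>\<Lambda>\<close>.\<close>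

lemma laplace_exponent_exchange:
  assumes ABC: "A \<subseteq> V" "B \<subseteq> V" "C \<subseteq> V"
    and ci: "proj_cond_indep A B C"
    and f [measurable]: "f \<in> borel_measurable (Reuc A)" and g [measurable]: "g \<in> borel_measurable (Reuc B)"
    and q: "cond_version \<Lambda> C (\<lambda>y. ennreal (1 - expn (g (restrict y B)))) q" "\<And>c. q c \<le> 1"
    and \<phi> [measurable]: "\<phi> \<in> borel_measurable (Reuc C)"
  shows "(LI y. ennreal (1 - expn (f (restrict y A) + g (restrict y B) + \<phi> (restrict y C)))) =
    atom_integral C (\<lambda>y. g (restrict y B)) +
    (LI y. ennreal (1 - expn (f (restrict y A) + cond_exponent C q (restrict y C) + \<phi> (restrict y C))))"
proof -
  interpret finite_measure_subalgebra M "\<sigma>proj C" by (rule finite_measure_subalgebra_proj[OF ABC(3)])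
  define a where "a = (\<lambda>y :: 'v \<Rightarrow> real. restrict y A)"
  define b where "b = (\<lambda>y :: 'v \<Rightarrow> real. restrict y B)"
  define r where "r = (\<lambda>y :: 'v \<Rightarrow> real. restrict y C)"
  have abr [measurable]: "a \<in> \<Lambda> \<rightarrow>\<^sub>M Reuc A" "b \<in> \<Lambda> \<rightarrow>\<^sub>M Reuc B" "r \<in> \<Lambda> \<rightarrow>\<^sub>M Reuc C"
    unfolding a_def b_def r_def using ABC by measurable
  have fa: "(\<lambda>y. f (a y)) \<in> borel_measurable \<Lambda>" and gb: "(\<lambda>y. g (b y)) \<in> borel_measurable \<Lambda>"
    and \<phi>r: "(\<lambda>y. \<phi> (r y)) \<in> borel_measurable \<Lambda>"
    by measurable
  have "q \<in> borel_measurable (Reuc C)" using q(1) by (simp add: cond_version_def)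
  then have h [measurable]: "cond_exponent C q \<in> borel_measurable (Reuc C)"
    by (rule measurable_cond_exponent[OF finite_sub[OF ABC(3)]])
  define h where "h = cond_exponent C q"
  have hr: "(\<lambda>y. h (r y)) \<in> borel_measurable \<Lambda>" unfolding h_def by measurable
  let ?L = "\<lambda>f \<omega>. expn (\<integral>\<^sup>+y. f y \<partial>\<xi> \<omega>)"
  define U where "U = ?L (\<lambda>y. f (a y))"
  define W where "W = ?L (\<lambda>y. g (b y))"
  define e where "e \<omega> = Lproj C \<phi> \<omega>" for \<omega>
  define Q where "Q \<omega> = expn (atom_integral C (\<lambda>y. g (b y))) * Lproj C h \<omega>" for \<omega>
  have U [measurable]: "U \<in> borel_measurable M" unfolding U_def using measurable_integral_\<xi>[OF fa] by measurable
  have W [measurable]: "W \<in> borel_measurable M" unfolding W_def using measurable_integral_\<xi>[OF gb] by measurable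
  have e [measurable]: "e \<in> borel_measurable (\<sigma>proj C)" "e \<in> borel_measurable M"
    unfolding e_def using measurable_integral_proj[OF ABC(3) \<phi>] by measurable
  have Q [measurable]: "Q \<in> borel_measurable (\<sigma>proj C)" "Q \<in> borel_measurable M"
    unfolding Q_def h_def using measurable_integral_proj[OF ABC(3) h] by measurable
  have bnd: "\<bar>U \<omega>\<bar> \<le> 1" "\<bar>W \<omega>\<bar> \<le> 1" "\<bar>e \<omega>\<bar> \<le> 1" "\<bar>Q \<omega>\<bar> \<le> 1" for \<omega>
    by (simp_all add: U_def W_def e_def Q_def abs_mult mult_le_one)
  have AEW: "AE \<omega> in M. real_cond_exp M (\<sigma>proj C) W \<omega> = Q \<omega>"
    unfolding W_def Q_def h_def b_def by (rule cond_laplace[OF ABC(3) gb[unfolded b_def] q])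
  have "cond_uncorrelated M (\<sigma>proj C) (\<lambda>\<omega>. Lproj A f \<omega>) (\<lambda>\<omega>. Lproj B g \<omega>)"
    using ci f g
    unfolding cond_indep_Npoint_iff[OF prob_space_axioms measurable_proj[OF ABC(1)] measurable_proj[OF ABC(2)] measurable_proj[OF ABC(3)]]
    by blast
  also have "?this \<longleftrightarrow> cond_uncorrelated M (\<sigma>proj C) U W"
  proof (rule cond_uncorrelated_cong_AE[OF finite_measure_subalgebra_proj[OF ABC(3)] _ U _ W])
    show "(\<lambda>\<omega>. Lproj A f \<omega>) \<in> borel_measurable M"
      "(\<lambda>\<omega>. Lproj B g \<omega>) \<in> borel_measurable M"
      using measurable_integral_proj(1)[OF ABC(1) f] measurable_integral_proj(1)[OF ABC(2) g] by measurable
    show "AE \<omega> in M. Lproj A f \<omega> = U \<omega>"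
      unfolding U_def a_def by (intro AE_I2) (simp add: nn_integral_proj[OF ABC(1) _ f])
    show "AE \<omega> in M. Lproj B g \<omega> = W \<omega>"
      unfolding W_def b_def by (intro AE_I2) (simp add: nn_integral_proj[OF ABC(2) _ g])
  qed
  finally have "AE \<omega> in M. real_cond_exp M (\<sigma>proj C) (\<lambda>\<omega>. U \<omega> * W \<omega>) \<omega> = Q \<omega> * real_cond_exp M (\<sigma>proj C) U \<omega>"
    using AEW unfolding cond_uncorrelated_def by eventually_elim (simp add: mult.commute)
  note AEUW = this
  have i: "integrable M (\<lambda>\<omega>. e \<omega> * (U \<omega> * W \<omega>))" "integrable M (\<lambda>\<omega>. (e \<omega> * Q \<omega>) * U \<omega>)"
    using bnd by (auto intro!: integrable_bounded_1 simp: abs_mult mult_le_one)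
  have "(\<integral>\<omega>. e \<omega> * (U \<omega> * W \<omega>) \<partial>M) = (\<integral>\<omega>. e \<omega> * real_cond_exp M (\<sigma>proj C) (\<lambda>\<omega>. U \<omega> * W \<omega>) \<omega> \<partial>M)"
    by (rule real_cond_exp_intg(2)[OF i(1) e(1), symmetric]) measurable
  also have "\<dots> = (\<integral>\<omega>. (e \<omega> * Q \<omega>) * real_cond_exp M (\<sigma>proj C) U \<omega> \<partial>M)"
  proof (rule integral_cong_AE)
    show "AE \<omega> in M. e \<omega> * real_cond_exp M (\<sigma>proj C) (\<lambda>\<omega>. U \<omega> * W \<omega>) \<omega> = (e \<omega> * Q \<omega>) * real_cond_exp M (\<sigma>proj C) U \<omega>"
      using AEUW by eventually_elim simp
  qed measurable
  also have "\<dots> = (\<integral>\<omega>. (e \<omega> * Q \<omega>) * U \<omega> \<partial>M)"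
    by (rule real_cond_exp_intg(2)[OF i(2)]) measurable
  finally have main: "(\<integral>\<omega>. e \<omega> * (U \<omega> * W \<omega>) \<partial>M) = (\<integral>\<omega>. (e \<omega> * Q \<omega>) * U \<omega> \<partial>M)" .
  have add3: "(\<integral>\<^sup>+y. u y + v y + w y \<partial>\<xi> \<omega>) = (\<integral>\<^sup>+y. u y \<partial>\<xi> \<omega>) + (\<integral>\<^sup>+y. v y \<partial>\<xi> \<omega>) + (\<integral>\<^sup>+y. w y \<partial>\<xi> \<omega>)"
    if "\<omega> \<in> space M" and [measurable]: "u \<in> borel_measurable \<Lambda>" "v \<in> borel_measurable \<Lambda>" "w \<in> borel_measurable \<Lambda>" for u v w \<omega>
    using that integral_\<xi>_add[OF that(1), of "\<lambda>y. u y + v y" w] integral_\<xi>_add[OF that(1,2,3)] by simp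
  have proj: "(\<integral>\<^sup>+z. k z \<partial>proj_process \<xi> C \<omega>) = (\<integral>\<^sup>+y. k (r y) \<partial>\<xi> \<omega>)"
    if "\<omega> \<in> space M" "k \<in> borel_measurable (Reuc C)" for k \<omega>
    unfolding r_def by (rule nn_integral_proj[OF ABC(3) that])
  have "expn (LI y. ennreal (1 - expn (f (a y) + g (b y) + \<phi> (r y)))) = (\<integral>\<omega>. ?L (\<lambda>y. f (a y) + g (b y) + \<phi> (r y)) \<omega> \<partial>M)"
    using fa gb \<phi>r by (intro laplace[symmetric]) measurable
  also have "\<dots> = (\<integral>\<omega>. e \<omega> * (U \<omega> * W \<omega>) \<partial>M)"
    by (intro Bochner_Integration.integral_cong refl)
      (simp add: add3[OF _ fa gb \<phi>r] e_def U_def W_def expn_add proj[OF _ \<phi>])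
  also have "\<dots> = (\<integral>\<omega>. expn (atom_integral C (\<lambda>y. g (b y))) * ?L (\<lambda>y. f (a y) + h (r y) + \<phi> (r y)) \<omega> \<partial>M)"
    unfolding main
    by (intro Bochner_Integration.integral_cong refl)
      (simp add: add3[OF _ fa hr \<phi>r] e_def U_def Q_def expn_add proj[OF _ \<phi>] proj[OF _ h[folded h_def]])
  also have "\<dots> = expn (atom_integral C (\<lambda>y. g (b y))) * (\<integral>\<omega>. ?L (\<lambda>y. f (a y) + h (r y) + \<phi> (r y)) \<omega> \<partial>M)"
    by (rule integral_mult_right_zero)
  also have "(\<integral>\<omega>. ?L (\<lambda>y. f (a y) + h (r y) + \<phi> (r y)) \<omega> \<partial>M) = expn (LI y. ennreal (1 - expn (f (a y) + h (r y) + \<phi> (r y))))"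
    using fa hr \<phi>r by (intro laplace) measurable
  finally have "expn (LI y. ennreal (1 - expn (f (a y) + g (b y) + \<phi> (r y)))) =
    expn (atom_integral C (\<lambda>y. g (b y)) + (LI y. ennreal (1 - expn (f (a y) + h (r y) + \<phi> (r y)))))"
    by (simp add: expn_add)
  then show ?thesis unfolding a_def b_def r_def h_def by (rule expn_inj)
qed

text \<open>The preceding lemma is applied to \<open>f = 1\<^sub>F\<close> and \<open>g = 1\<^sub>G\<close>. All integrals are finite because \<open>F\<close> and \<open>G\<close> lie in
  layers. With \<open>\<phi> = \<infinity> 1\<^sub>T\<close> the integrand equals \<open>1\<close> on \<open>y\<^sub>C \<in> T\<close>, so subtracting the identity for this \<open>\<phi>\<close> from the
  one for \<open>\<phi> = 0\<close> isolates the contribution of \<open>T\<close>. What remains after all layers are exhausted is the contribution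
  of \<open>y\<^sub>C = 0\<close>.\<close>

lemma local_factorization:
  assumes ABC: "A \<subseteq> V" "B \<subseteq> V" "C \<subseteq> V"
    and ci: "proj_cond_indep A B C"
    and F [measurable]: "F \<in> sets (Reuc A)" and Fi: "F \<subseteq> layer A i"
    and G [measurable]: "G \<in> sets (Reuc B)" and Gj: "G \<subseteq> layer B j"
    and p: "cond_version \<Lambda> C (\<lambda>y. indicator G (restrict y B)) p" "\<And>c. p c \<le> 1"
  shows "(LI y. indicator {origin C} (restrict y C) * (indicator F (restrict y A) * indicator G (restrict y B))) = 0"
    and "\<And>T n. T \<in> sets (Reuc C) \<Longrightarrow> T \<subseteq> layer C n \<Longrightarrow>
      (LI y. indicator T (restrict y C) * (indicator F (restrict y A) * indicator G (restrict y B))) =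
      (LI y. indicator T (restrict y C) * (indicator F (restrict y A) * p (restrict y C)))"
proof -
  define a where "a = (\<lambda>y :: 'v \<Rightarrow> real. restrict y A)"
  define b where "b = (\<lambda>y :: 'v \<Rightarrow> real. restrict y B)"
  define r where "r = (\<lambda>y :: 'v \<Rightarrow> real. restrict y C)"
  have abr [measurable]: "a \<in> \<Lambda> \<rightarrow>\<^sub>M Reuc A" "b \<in> \<Lambda> \<rightarrow>\<^sub>M Reuc B" "r \<in> \<Lambda> \<rightarrow>\<^sub>M Reuc C"
    unfolding a_def b_def r_def using ABC by measurable
  have [measurable]: "{origin C} \<in> sets (Reuc C)" by (rule origin_sets[OF finite_sub[OF ABC(3)]])
  have r_sp: "r y \<in> space (Reuc C)" for y by (simp add: r_def)
  have pm [measurable]: "p \<in> borel_measurable (Reuc C)" using p(1) by (simp add: cond_version_def)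
  \<comment> \<open>the value of \<open>1 - exp(-f)\<close> where \<open>f = 1\<close>\<close>
  define \<kappa> where "\<kappa> = ennreal (1 - expn 1)"
  have "expn 1 < 1" using expn_le_1[of 1] expn_eq_1_iff[of 1] by (simp add: less_le)
  then have \<kappa>: "\<kappa> \<noteq> 0" "\<kappa> \<noteq> \<top>" "\<kappa> \<le> 1" by (simp_all add: \<kappa>_def)
  define u :: "('v \<Rightarrow> real) \<Rightarrow> ennreal" where "u y = indicator F (a y)" for y
  define w :: "('v \<Rightarrow> real) \<Rightarrow> ennreal" where "w y = indicator G (b y)" for y
  have u [measurable]: "u \<in> borel_measurable \<Lambda>" and w [measurable]: "w \<in> borel_measurable \<Lambda>"
    unfolding u_def w_def by measurable
  have one_minus_ind: "ennreal (1 - expn (indicator S x)) = \<kappa> * indicator S x" for S and x :: "'v \<Rightarrow> real"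
    by (simp add: indicator_def \<kappa>_def)
  have ku: "ennreal (1 - expn (u y)) = \<kappa> * u y" and kw: "ennreal (1 - expn (w y)) = \<kappa> * w y" for y
    by (simp_all add: u_def w_def one_minus_ind)
  define q where "q c = \<kappa> * p c" for c
  have qm [measurable]: "q \<in> borel_measurable (Reuc C)" unfolding q_def by measurable
  have q1: "q c \<le> 1" for c using mult_mono[OF \<kappa>(3) p(2)[of c]] by (simp add: q_def)
  have qk: "cond_version \<Lambda> C (\<lambda>y. \<kappa> * w y) q"
    unfolding q_def w_def b_def
    by (rule cond_version_cmult[OF ABC(3) _ p(1)]) (simp add: w[unfolded w_def b_def])
  have qk': "cond_version \<Lambda> C (\<lambda>y. ennreal (1 - expn (indicator G (restrict y B)))) q"
    using qk unfolding kw[symmetric] by (simp only: w_def b_def)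
  define h where "h = cond_exponent C q"
  have hm [measurable]: "h \<in> borel_measurable (Reuc C)"
    unfolding h_def by (rule measurable_cond_exponent[OF finite_sub[OF ABC(3)] qm])
  have h0: "h (origin C) = 0" by (simp add: h_def)
  have hq: "ennreal (1 - expn (h c)) = q c" if "c \<noteq> origin C" for c
    unfolding h_def by (rule expn_cond_exponent(2)[OF q1 that])
  define k1 where "k1 y = ennreal (1 - expn (u y + w y))" for y
  define k2 where "k2 y = ennreal (1 - expn (u y + h (r y)))" for y
  have k [measurable]: "k1 \<in> borel_measurable \<Lambda>" "k2 \<in> borel_measurable \<Lambda>"
    unfolding k1_def k2_def by measurable
  have k1_le: "k1 y \<le> 1" for y by (simp add: k1_def)
  define \<gamma> where "\<gamma> = (LI y. indicator {origin C} (r y) * (\<kappa> * w y))"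
  have atom: "atom_integral C (\<lambda>y. indicator G (restrict y B)) = \<gamma>"
    unfolding atom_integral_def \<gamma>_def kw[symmetric] by (simp only: r_def w_def b_def)
  have exch: "(LI y. ennreal (1 - expn (u y + w y + \<phi> (r y)))) =
      \<gamma> + (LI y. ennreal (1 - expn (u y + h (r y) + \<phi> (r y))))"
    if "\<phi> \<in> borel_measurable (Reuc C)" for \<phi>
    using laplace_exponent_exchange[OF ABC ci borel_measurable_indicator[OF F] borel_measurable_indicator[OF G] qk' q1 that]
    unfolding atom by (simp only: u_def w_def a_def b_def r_def h_def)
  have total: "(LI y. k1 y) = \<gamma> + (LI y. k2 y)"
    using exch[of "\<lambda>_. 0"] by (simp add: k1_def k2_def)
  have incl: "k1 y + (\<kappa> * u y) * (\<kappa> * w y) = \<kappa> * u y + \<kappa> * w y" for y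
    unfolding k1_def ku[symmetric] kw[symmetric] by (rule one_minus_expn_inclusion_exclusion)
  have fin: "(LI y. k1 y) < \<infinity>"
  proof -
    have "k1 y \<le> u y + w y" for y
    proof -
      have "k1 y \<le> \<kappa> * u y + \<kappa> * w y" unfolding incl[symmetric] by simp
      also have "\<dots> \<le> 1 * u y + 1 * w y" by (intro add_mono mult_right_mono \<kappa>) auto
      finally show ?thesis by simp
    qed
    then have "(LI y. k1 y) \<le> (LI y. u y + w y)" by (rule nn_integral_mono)
    also have "\<dots> = (LI y. u y) + (LI y. w y)" by (rule nn_integral_add) measurable
    also have "\<dots> < \<infinity>"
      using nn_integral_layer_finite[OF ABC(1) F Fi, of "\<lambda>_. 1"] nn_integral_layer_finite[OF ABC(2) G Gj, of "\<lambda>_. 1"]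
      by (simp add: u_def w_def a_def b_def)
    finally show ?thesis .
  qed
  have part_fin: "(LI y. indicator S (r y) * k1 y) \<noteq> \<top>" for S
  proof -
    have "(LI y. indicator S (r y) * k1 y) \<le> (LI y. k1 y)"
      by (intro nn_integral_mono) (simp add: indicator_def)
    then show ?thesis using fin by (auto simp: top_unique)
  qed
  have cancel: "x = y" if "z + x = z + y" "z \<noteq> \<top>" for x y z :: ennreal
    using that by (simp add: ennreal_add_left_cancel)
  have scale: "(LI y. indicator S (r y) * ((\<kappa> * u y) * (\<kappa> * v y))) = \<kappa> * (\<kappa> * (LI y. indicator S (r y) * (u y * v y)))"
    if [measurable]: "S \<in> sets (Reuc C)" "v \<in> borel_measurable \<Lambda>" for S v
  proof -
    have "(LI y. indicator S (r y) * ((\<kappa> * u y) * (\<kappa> * v y))) = (LI y. (\<kappa> * \<kappa>) * (indicator S (r y) * (u y * v y)))"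
      by (simp only: ac_simps)
    also have "\<dots> = (\<kappa> * \<kappa>) * (LI y. indicator S (r y) * (u y * v y))"
      by (rule nn_integral_cmult) measurable
    finally show ?thesis by (simp only: mult.assoc)
  qed
  have split: "(LI y. k y) = (LI y. indicator T (r y) * k y) + (LI y. indicator (space (Reuc C) - T) (r y) * k y)"
    if [measurable]: "k \<in> borel_measurable \<Lambda>" "T \<in> sets (Reuc C)" for k T
    unfolding r_def by (rule lambda_integral_split[OF ABC(3) that])
  have local: "(LI y. indicator T (r y) * k1 y) = (LI y. indicator T (r y) * k2 y)"
    if T [measurable]: "T \<in> sets (Reuc C)" and Tn: "T \<subseteq> layer C n" for T n
  proof -
    let ?T = "space (Reuc C) - T"
    define \<phi> :: "('v \<Rightarrow> real) \<Rightarrow> ennreal" where "\<phi> c = \<infinity> * indicator T c" for c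
    have \<phi> [measurable]: "\<phi> \<in> borel_measurable (Reuc C)" unfolding \<phi>_def by measurable
    have ex: "(LI y. ennreal (1 - expn (v y + \<phi> (r y)))) =
        (LI y. indicator T (r y)) + (LI y. indicator ?T (r y) * ennreal (1 - expn (v y)))"
      if [measurable]: "v \<in> borel_measurable \<Lambda>" for v
    proof -
      have "ennreal (1 - expn (v y + \<phi> (r y))) = indicator T (r y) + indicator ?T (r y) * ennreal (1 - expn (v y))" for y
        using r_sp[of y] by (auto simp: indicator_def \<phi>_def)
      then show ?thesis by (simp add: nn_integral_add)
    qed
    have t: "(LI y. indicator T (r y)) \<noteq> \<top>"
      using nn_integral_layer_finite[OF ABC(3) T Tn, of "\<lambda>_. 1"] by (simp add: r_def)
    have "(LI y. indicator T (r y)) + (LI y. indicator ?T (r y) * k1 y) =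
        (LI y. indicator T (r y)) + (\<gamma> + (LI y. indicator ?T (r y) * k2 y))"
    proof -
      have "(\<lambda>y. u y + w y) \<in> borel_measurable \<Lambda>" "(\<lambda>y. u y + h (r y)) \<in> borel_measurable \<Lambda>" by measurable
      then show ?thesis
        using exch[OF \<phi>] unfolding k1_def k2_def by (simp only: ex add.left_commute)
    qed
    then have x: "(LI y. indicator ?T (r y) * k1 y) = \<gamma> + (LI y. indicator ?T (r y) * k2 y)"
      using t by (simp add: ennreal_add_left_cancel)
    have "(LI y. indicator ?T (r y) * k1 y) + (LI y. indicator T (r y) * k1 y) =
      (LI y. indicator ?T (r y) * k1 y) + (LI y. indicator T (r y) * k2 y)"
      using total unfolding split[OF k(1) T] split[OF k(2) T] x by (simp only: ac_simps)
    then show ?thesis using part_fin[of ?T] by (simp add: ennreal_add_left_cancel)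
  qed
  let ?N = "space (Reuc C) - {origin C}"
  have off: "(LI y. indicator ?N (r y) * k1 y) = (LI y. indicator ?N (r y) * k2 y)"
    unfolding r_def
  proof (rule nn_integral_eq_off_origin[OF ABC(3) k])
    show "(LI y. indicator T (restrict y C) * k1 y) = (LI y. indicator T (restrict y C) * k2 y)"
      if "T \<in> sets (Reuc C)" "T \<subseteq> layer C n" for T n
      using local[OF that] by (simp only: r_def)
  qed auto
  have inv\<kappa>: "x = y" if "\<kappa> * x = \<kappa> * y" for x y
    using that \<kappa> by (simp add: ennreal_mult_cancel_left)
  have "(LI y. indicator ?N (r y) * k1 y) + (LI y. indicator {origin C} (r y) * k1 y) =
      (LI y. indicator ?N (r y) * k1 y) + (\<gamma> + (LI y. indicator {origin C} (r y) * k2 y))"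
    using total unfolding split[OF k(1), of "{origin C}", simplified] split[OF k(2), of "{origin C}", simplified] off
    by (simp add: ac_simps)
  then have z1: "(LI y. indicator {origin C} (r y) * k1 y) = \<gamma> + (LI y. indicator {origin C} (r y) * k2 y)"
    using part_fin[of ?N] by (simp add: ennreal_add_left_cancel)
  have z2: "(LI y. indicator {origin C} (r y) * k2 y) = (LI y. indicator {origin C} (r y) * (\<kappa> * u y))"
    by (intro nn_integral_cong) (auto simp: indicator_def k2_def h0 ku)
  have "(LI y. indicator {origin C} (r y) * k1 y) + (LI y. indicator {origin C} (r y) * ((\<kappa> * u y) * (\<kappa> * w y))) =
      (LI y. indicator {origin C} (r y) * (\<kappa> * u y + \<kappa> * w y))"
    unfolding incl[symmetric] distrib_left by (rule nn_integral_add[symmetric]) measurable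
  also have "\<dots> = (LI y. indicator {origin C} (r y) * k1 y) + 0"
    unfolding z1 z2 \<gamma>_def distrib_left by (subst nn_integral_add) (auto simp: ac_simps)
  finally have "(LI y. indicator {origin C} (r y) * ((\<kappa> * u y) * (\<kappa> * w y))) = 0"
    using part_fin[of "{origin C}"] by (rule cancel)
  then have "\<kappa> * (\<kappa> * (LI y. indicator {origin C} (r y) * (u y * w y))) = 0"
    by (subst (asm) scale) measurable
  then show "(LI y. indicator {origin C} (restrict y C) * (indicator F (restrict y A) * indicator G (restrict y B))) = 0"
    using \<kappa> by (simp add: u_def w_def a_def b_def r_def)
  show "(LI y. indicator T (restrict y C) * (indicator F (restrict y A) * indicator G (restrict y B))) =
      (LI y. indicator T (restrict y C) * (indicator F (restrict y A) * p (restrict y C)))"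
    if T [measurable]: "T \<in> sets (Reuc C)" and Tn: "T \<subseteq> layer C n" for T n
  proof -
    have T0: "origin C \<notin> T" using Tn origin_notin_layer[of C n] by blast
    let ?I = "\<lambda>k. LI y. indicator T (r y) * k y"
    have "?I k1 + ?I (\<lambda>y. (\<kappa> * u y) * (\<kappa> * w y)) = ?I (\<lambda>y. \<kappa> * u y + \<kappa> * w y)"
      unfolding incl[symmetric] distrib_left by (rule nn_integral_add[symmetric]) measurable
    also have "\<dots> = ?I (\<lambda>y. \<kappa> * u y) + ?I (\<lambda>y. \<kappa> * w y)"
      unfolding distrib_left by (rule nn_integral_add) measurable
    also have "?I (\<lambda>y. \<kappa> * w y) = ?I (\<lambda>y. q (r y))"
      using qk T0 unfolding cond_version_def r_def by auto
    also have "?I (\<lambda>y. \<kappa> * u y) + ?I (\<lambda>y. q (r y)) = ?I (\<lambda>y. \<kappa> * u y + q (r y))"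
      unfolding distrib_left by (rule nn_integral_add[symmetric]) measurable
    also have "\<dots> = ?I (\<lambda>y. k2 y + (\<kappa> * u y) * q (r y))"
    proof (intro nn_integral_cong)
      fix y
      show "indicator T (r y) * (\<kappa> * u y + q (r y)) = indicator T (r y) * (k2 y + (\<kappa> * u y) * q (r y))"
      proof (cases "r y \<in> T")
        case True
        then have "r y \<noteq> origin C" using T0 by auto
        then have "q (r y) = ennreal (1 - expn (h (r y)))" by (rule hq[symmetric])
        then have "k2 y + (\<kappa> * u y) * q (r y) = \<kappa> * u y + q (r y)"
          unfolding k2_def ku[symmetric] by (simp only: one_minus_expn_inclusion_exclusion)
        then show ?thesis by simp
      qed simp
    qed
    also have "\<dots> = ?I k2 + ?I (\<lambda>y. (\<kappa> * u y) * q (r y))"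
      unfolding distrib_left by (rule nn_integral_add) measurable
    also have "?I k2 = ?I k1" using local[OF T Tn] by simp
    finally have "?I (\<lambda>y. (\<kappa> * u y) * (\<kappa> * w y)) = ?I (\<lambda>y. (\<kappa> * u y) * q (r y))"
      using part_fin[of T] by (rule cancel)
    then have "\<kappa> * (\<kappa> * ?I (\<lambda>y. u y * w y)) = \<kappa> * (\<kappa> * ?I (\<lambda>y. u y * p (r y)))"
      unfolding q_def by (subst (asm) (1 2) scale) measurable
    then have "?I (\<lambda>y. u y * w y) = ?I (\<lambda>y. u y * p (r y))"
      using inv\<kappa> by blast
    then show ?thesis by (simp only: u_def w_def a_def b_def r_def)
  qed
qed

text \<open>It remains to pass from sets \<open>F\<close>, \<open>G\<close>, \<open>T\<close> in layers to general ones. For \<open>F\<close> and \<open>G\<close> this uses that the identity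
  holds for the whole space by definition of a conditional version; \<open>T\<close> has to avoid the origin anyway.\<close>

lemma factorizes_if_cond_indep:
  assumes ABC: "A \<subseteq> V" "B \<subseteq> V" "C \<subseteq> V"
    and ci: "proj_cond_indep A B C"
  shows "factorizes \<Lambda> A B C"
proof -
  define a where "a = (\<lambda>y :: 'v \<Rightarrow> real. restrict y A)"
  define b where "b = (\<lambda>y :: 'v \<Rightarrow> real. restrict y B)"
  define r where "r = (\<lambda>y :: 'v \<Rightarrow> real. restrict y C)"
  have abr [measurable]: "a \<in> \<Lambda> \<rightarrow>\<^sub>M Reuc A" "b \<in> \<Lambda> \<rightarrow>\<^sub>M Reuc B" "r \<in> \<Lambda> \<rightarrow>\<^sub>M Reuc C"
    unfolding a_def b_def r_def using ABC by measurable
  have [measurable]: "{origin C} \<in> sets (Reuc C)" by (rule origin_sets[OF finite_sub[OF ABC(3)]])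
  have lay [measurable]: "layer A i \<in> sets (Reuc A)" "layer B i \<in> sets (Reuc B)" for i
    using layer_sets finite_sub ABC by blast+
  have kern: "\<exists>p. cond_version \<Lambda> C (\<lambda>y. indicator F (restrict y I)) p \<and> (\<forall>c. p c \<le> 1)"
    if I: "I \<subseteq> V" and F: "F \<in> sets (Reuc I)" for I F
  proof -
    have "(\<lambda>y. indicator F (restrict y I)) \<in> borel_measurable \<Lambda>"
      using borel_measurable_indicator[OF F] by (rule measurable_compose[OF measurable_restrict_\<Lambda>[OF I]])
    then obtain p where "cond_version \<Lambda> C (\<lambda>y. indicator F (restrict y I)) p" "\<And>c. p c \<le> 1"
      by (rule cond_version_exists[OF ABC(3)]) (simp add: indicator_def, blast)
    then show ?thesis by blast
  qed
  have null: "emeasure \<Lambda> {y \<in> space \<Lambda>. restrict y C = origin C \<and> restrict y A \<noteq> origin A \<and> restrict y B \<noteq> origin B} = 0"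
  proof -
    define S where "S i j = {y \<in> space \<Lambda>. r y \<in> {origin C} \<and> a y \<in> layer A i \<and> b y \<in> layer B j}" for i j
    have S: "S i j \<in> sets \<Lambda>" for i j unfolding S_def by measurable
    have "S i j \<in> null_sets \<Lambda>" for i j
    proof -
      obtain p where p: "cond_version \<Lambda> C (\<lambda>y. indicator (layer B j) (restrict y B)) p" "\<And>c. p c \<le> 1"
        using kern[OF ABC(2) lay(2)[of j]] by blast
      have "(LI y. indicator {origin C} (restrict y C) * (indicator (layer A i) (restrict y A) * indicator (layer B j) (restrict y B))) = 0"
        by (rule local_factorization(1)[OF ABC ci lay(1) subset_refl lay(2) subset_refl p])
      moreover have "(LI y. indicator {origin C} (restrict y C) * (indicator (layer A i) (restrict y A) * indicator (layer B j) (restrict y B))) =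
          (LI y. indicator (S i j) y)"
        by (intro nn_integral_cong) (auto simp: S_def a_def b_def r_def indicator_def)
      ultimately show ?thesis using S by (simp add: null_sets_def)
    qed
    then have "(\<Union>i. \<Union>j. S i j) \<in> null_sets \<Lambda>" by (intro null_sets_UN) auto
    moreover have "{y \<in> space \<Lambda>. restrict y C = origin C \<and> restrict y A \<noteq> origin A \<and> restrict y B \<noteq> origin B} = (\<Union>i. \<Union>j. S i j)"
    proof -
      have "restrict y I \<noteq> origin I \<longleftrightarrow> (\<exists>i. restrict y I \<in> layer I i)" for y :: "'v \<Rightarrow> real" and I
        using UN_layer[of I] restrict_in_space[of y I] by blast
      then show ?thesis by (auto simp: S_def a_def b_def r_def)
    qed
    ultimately show ?thesis by auto
  qed
  have "\<exists>p\<in>borel_measurable (Reuc C). \<forall>G\<in>sets (Reuc B). \<forall>H\<in>sets (Reuc C). origin C \<notin> H \<longrightarrow>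
      (LI y. indicator H (restrict y C) * (indicator G (restrict y B) * indicator F (restrict y A))) =
      (LI y. indicator H (restrict y C) * (indicator G (restrict y B) * p (restrict y C)))"
    if F [measurable]: "F \<in> sets (Reuc A)" for F
  proof -
    obtain p where p: "cond_version \<Lambda> C (\<lambda>y. indicator F (restrict y A)) p" "\<And>c. p c \<le> 1"
      using kern[OF ABC(1) F] by blast
    then have pm [measurable]: "p \<in> borel_measurable (Reuc C)" by (simp add: cond_version_def)
    have loc: "(LI y. indicator G (b y) * (indicator T (r y) * indicator F (a y))) =
        (LI y. indicator G (b y) * (indicator T (r y) * p (r y)))"
      if G [measurable]: "G \<in> sets (Reuc B)" and Gj: "G \<subseteq> layer B j" and T [measurable]: "T \<in> sets (Reuc C)" and Tn: "T \<subseteq> layer C n"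
      for G T j n
    proof -
      have T0: "origin C \<notin> T" using Tn origin_notin_layer[of C n] by blast
      obtain q where q: "cond_version \<Lambda> C (\<lambda>y. indicator G (restrict y B)) q" "\<And>c. q c \<le> 1"
        using kern[OF ABC(2) G] by blast
      then have qm [measurable]: "q \<in> borel_measurable (Reuc C)" by (simp add: cond_version_def)
      have kq: "(LI y. \<phi> (r y) * indicator G (b y)) = (LI y. \<phi> (r y) * q (r y))"
        if "\<phi> \<in> borel_measurable (Reuc C)" "\<phi> (origin C) = 0" for \<phi>
        using q(1) that unfolding cond_version_def r_def b_def by blast
      have kp: "(LI y. \<phi> (r y) * indicator F (a y)) = (LI y. \<phi> (r y) * p (r y))"
        if "\<phi> \<in> borel_measurable (Reuc C)" "\<phi> (origin C) = 0" for \<phi>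
        using p(1) that unfolding cond_version_def r_def a_def by blast
      have "(LI y. indicator F (restrict y A) * (indicator T (r y) * indicator G (b y))) =
        (LI y. indicator F (restrict y A) * (indicator T (r y) * q (r y)))"
      proof (rule nn_integral_eq_extend_origin[OF ABC(1) _ _ _ _ _ F])
        fix i F' assume F': "F' \<in> sets (Reuc A)" "F' \<subseteq> layer A i"
        show "(LI y. indicator F' (restrict y A) * (indicator T (r y) * indicator G (b y))) =
          (LI y. indicator F' (restrict y A) * (indicator T (r y) * q (r y)))"
          using local_factorization(2)[OF ABC ci F' G Gj q T Tn]
          by (simp only: r_def b_def mult.left_commute)
      next
        show "(LI y. indicator T (r y) * indicator G (b y)) = (LI y. indicator T (r y) * q (r y))"
          by (rule kq) (simp_all add: T0)
        show "(LI y. indicator T (r y) * indicator G (b y)) < \<infinity>"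
          unfolding r_def by (rule nn_integral_layer_finite[OF ABC(3) T Tn]) (simp add: indicator_def)
      qed measurable
      then have "(LI y. indicator G (b y) * (indicator T (r y) * indicator F (a y))) =
          (LI y. (indicator T (r y) * q (r y)) * indicator F (a y))"
        by (simp only: a_def ac_simps)
      also have "\<dots> = (LI y. (indicator T (r y) * q (r y)) * p (r y))"
        by (rule kp[of "\<lambda>c. indicator T c * q c"]) (simp_all add: T0)
      also have "\<dots> = (LI y. (indicator T (r y) * p (r y)) * q (r y))"
        by (simp only: ac_simps)
      also have "\<dots> = (LI y. (indicator T (r y) * p (r y)) * indicator G (b y))"
        by (rule kq[of "\<lambda>c. indicator T c * p c", symmetric]) (simp_all add: T0)
      finally show ?thesis by (simp only: ac_simps)
    qed
    show ?thesis
    proof (intro bexI[OF _ pm] ballI impI)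
      fix G H assume G [measurable]: "G \<in> sets (Reuc B)" and H: "H \<in> sets (Reuc C)" "origin C \<notin> H"
      have "(LI y. indicator H (restrict y C) * (indicator G (b y) * indicator F (a y))) =
        (LI y. indicator H (restrict y C) * (indicator G (b y) * p (r y)))"
      proof (rule nn_integral_eq_off_origin[OF ABC(3)])
        fix n T assume T [measurable]: "T \<in> sets (Reuc C)" and Tn: "T \<subseteq> layer C n"
        have T0: "origin C \<notin> T" using Tn origin_notin_layer[of C n] by blast
        have "(LI y. indicator G (restrict y B) * (indicator T (r y) * indicator F (a y))) =
          (LI y. indicator G (restrict y B) * (indicator T (r y) * p (r y)))"
        proof (rule nn_integral_eq_extend_origin[OF ABC(2) _ _ _ _ _ G])
          fix j G' assume G': "G' \<in> sets (Reuc B)" "G' \<subseteq> layer B j"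
          show "(LI y. indicator G' (restrict y B) * (indicator T (r y) * indicator F (a y))) =
            (LI y. indicator G' (restrict y B) * (indicator T (r y) * p (r y)))"
            using loc[OF G' T Tn] by (simp only: b_def)
        next
          show "(LI y. indicator T (r y) * indicator F (a y)) = (LI y. indicator T (r y) * p (r y))"
            using p(1) T0 borel_measurable_indicator[OF T] unfolding cond_version_def r_def a_def by simp
          show "(LI y. indicator T (r y) * indicator F (a y)) < \<infinity>"
            unfolding r_def by (rule nn_integral_layer_finite[OF ABC(3) T Tn]) (simp add: indicator_def)
        qed measurable
        then show "(LI y. indicator T (restrict y C) * (indicator G (b y) * indicator F (a y))) =
          (LI y. indicator T (restrict y C) * (indicator G (b y) * p (r y)))"
          by (simp only: b_def r_def mult.left_commute)
      qed (use H in auto)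
      then show "(LI y. indicator H (restrict y C) * (indicator G (restrict y B) * indicator F (restrict y A))) =
        (LI y. indicator H (restrict y C) * (indicator G (restrict y B) * p (restrict y C)))"
        by (simp only: a_def b_def r_def)
    qed
  qed
  then show ?thesis unfolding factorizes_def using null by blast
qed

theorem poisson_cond_indep_iff_factorizes:
  assumes "A \<subseteq> V" "B \<subseteq> V" "C \<subseteq> V"
  shows "proj_cond_indep A B C \<longleftrightarrow> factorizes \<Lambda> A B C"
  using cond_indep_if_factorizes[OF assms] factorizes_if_cond_indep[OF assms] by blast

end

section \<open>Conditional independence on test rectangles\<close>

locale partitioned_measure = explosive_measure V \<Lambda> for V :: "'v set" and \<Lambda> +
  fixes A B C
  assumes V: "V = A \<union> B \<union> C" and disj: "A \<inter> B = {}" "A \<inter> C = {}" "B \<inter> C = {}"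
    and nonempty: "A \<noteq> {}" "B \<noteq> {}"
begin

abbreviation "cond_indep_on R \<equiv> cond_indep_var (uniform_measure \<Lambda> R) (Reuc A) (\<lambda>y. restrict y A)
  (Reuc B) (\<lambda>y. restrict y B) (Reuc C) (\<lambda>y. restrict y C)"

lemma subs: "A \<subseteq> V" "B \<subseteq> V" "C \<subseteq> V" using V by auto

lemma test_rectangle_sets:
  assumes R: "R \<in> test_rectangles V \<Lambda>"
  shows "R \<in> sets \<Lambda>" "emeasure \<Lambda> R \<noteq> 0" "emeasure \<Lambda> R < \<infinity>" "origin V \<notin> R"
proof -
  obtain Rv where Rv: "R = PiE V Rv" "\<And>v. v \<in> V \<Longrightarrow> Rv v \<in> sets borel"
    and pos: "emeasure \<Lambda> R > 0" and cl: "origin V \<notin> Rtop V closure_of R"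
    using R by (auto simp: test_rectangles_def)
  have R1: "R \<in> sets (Reuc V)" unfolding Rv(1) Reuc_def using finite_V Rv(2) by (intro sets_PiM_I_finite) auto
  have "R \<subseteq> topspace (Rtop V)" unfolding Rv(1) by auto
  then show o: "origin V \<notin> R" using cl closure_of_subset by blast
  show "R \<in> sets \<Lambda>"
    using R1 sets.sets_into_space[OF R1] o by (auto simp: sets_\<Lambda>_iff space_\<Lambda>_alt)
  show "emeasure \<Lambda> R \<noteq> 0" using pos by simp
  show "emeasure \<Lambda> R < \<infinity>" by (rule locally_finite[OF R1 cl])
qed

lemma three_variables_uniform:
  assumes R: "R \<in> test_rectangles V \<Lambda>"
  shows "three_variables (uniform_measure \<Lambda> R) (Reuc A) (\<lambda>y. restrict y A) (Reuc B) (\<lambda>y. restrict y B) (Reuc C) (\<lambda>y. restrict y C)"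
proof -
  have "prob_space (uniform_measure \<Lambda> R)"
    using test_rectangle_sets[OF R] by (intro prob_space_uniform_measure) auto
  moreover have "(\<lambda>y. restrict y I) \<in> uniform_measure \<Lambda> R \<rightarrow>\<^sub>M Reuc I" if "I \<subseteq> V" for I
    using measurable_restrict_\<Lambda>[OF that] by (simp add: measurable_def)
  ultimately show ?thesis using subs by (simp add: three_variables_def three_variables_axioms_def)
qed

text \<open>For \<open>C = {}\<close> the conditioning variable is constant.\<close>

lemma indep_given_uniform_iff:
  assumes R: "R \<in> test_rectangles V \<Lambda>"
  shows "indep_given (uniform_measure \<Lambda> R) Reuc (\<lambda>I y. restrict y I) A B C \<longleftrightarrow>
    cond_indep_on R"
proof (cases "C = {}")
  case True
  interpret three_variables "uniform_measure \<Lambda> R" "Reuc A" "\<lambda>y. restrict y A" "Reuc B" "\<lambda>y. restrict y B" "Reuc C" "\<lambda>y. restrict y C"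
    by (rule three_variables_uniform[OF R])
  have "restrict y C = origin C" for y :: "'v \<Rightarrow> real" using True by (simp add: restrict_eq_origin_iff)
  then have "cond_indep_on R
      \<longleftrightarrow> indep_var (Reuc A) (\<lambda>y. restrict y A) (Reuc B) (\<lambda>y. restrict y B)"
    by (intro cond_indep_var_trivial) auto
  then show ?thesis using True nonempty by (simp add: indep_given_def)
qed (use nonempty in \<open>simp add: indep_given_def\<close>)

lemma nn_integral_uniform_eq_iff:
  assumes R: "R \<in> test_rectangles V \<Lambda>" and f: "f \<in> borel_measurable \<Lambda>" "g \<in> borel_measurable \<Lambda>"
  shows "(\<integral>\<^sup>+y. f y \<partial>uniform_measure \<Lambda> R) = (\<integral>\<^sup>+y. g y \<partial>uniform_measure \<Lambda> R) \<longleftrightarrow>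
    (LI y. indicator R y * f y) = (LI y. indicator R y * g y)"
proof -
  note r = test_rectangle_sets[OF R]
  have "x / emeasure \<Lambda> R = y / emeasure \<Lambda> R \<longleftrightarrow> x = y" for x y
    using r(2,3) by (metis divide_mult_eq infinity_ennreal_def less_irrefl mult_divide_eq_ennreal ennreal_mult_divide_eq ennreal_times_divide mult.commute)
  then show ?thesis
    using nn_integral_uniform_measure[OF f(1) r(1)] nn_integral_uniform_measure[OF f(2) r(1)] by (simp add: mult.commute)
qed

lemma test_rectangle_cond_indepD:
  assumes R: "R \<in> test_rectangles V \<Lambda>"
    and ci: "cond_indep_on R"
    and F: "F \<in> sets (Reuc A)" and G: "G \<in> sets (Reuc B)" and H: "H \<in> sets (Reuc C)"
    and p: "p \<in> borel_measurable (Reuc C)" "\<And>z. p z \<le> 1"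
    and version: "\<And>H. H \<in> sets (Reuc C) \<Longrightarrow>
      (LI y. indicator R y * (indicator F (restrict y A) * indicator H (restrict y C))) =
      (LI y. indicator R y * (p (restrict y C) * indicator H (restrict y C)))"
  shows "(LI y. indicator R y * (indicator F (restrict y A) * indicator G (restrict y B) * indicator H (restrict y C))) =
    (LI y. indicator R y * (p (restrict y C) * indicator G (restrict y B) * indicator H (restrict y C)))"
proof -
  interpret three_variables "uniform_measure \<Lambda> R" "Reuc A" "\<lambda>y. restrict y A" "Reuc B" "\<lambda>y. restrict y B" "Reuc C" "\<lambda>y. restrict y C"
    by (rule three_variables_uniform[OF R])
  note [measurable] = measurable_restrict_\<Lambda>[OF subs(1)] measurable_restrict_\<Lambda>[OF subs(2)] measurable_restrict_\<Lambda>[OF subs(3)] F G H p(1)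
  have v: "(\<integral>\<^sup>+y. indicator F (restrict y A) * indicator H (restrict y C) \<partial>uniform_measure \<Lambda> R) =
      (\<integral>\<^sup>+y. p (restrict y C) * indicator H (restrict y C) \<partial>uniform_measure \<Lambda> R)" if [measurable]: "H \<in> sets (Reuc C)" for H
    by (subst nn_integral_uniform_eq_iff[OF R]) (measurable, rule version, fact)
  have "(\<integral>\<^sup>+y. indicator F (restrict y A) * indicator G (restrict y B) * indicator H (restrict y C) \<partial>uniform_measure \<Lambda> R) =
      (\<integral>\<^sup>+y. p (restrict y C) * indicator G (restrict y B) * indicator H (restrict y C) \<partial>uniform_measure \<Lambda> R)"
    by (rule cond_indep_varD[OF ci F G p v H])
  then show ?thesis
    by (subst (asm) nn_integral_uniform_eq_iff[OF R]) measurable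
qed

lemma test_rectangle_cond_indepI:
  assumes R: "R \<in> test_rectangles V \<Lambda>"
    and ex: "\<And>F. F \<in> sets (Reuc A) \<Longrightarrow> \<exists>p. p \<in> borel_measurable (Reuc C) \<and> (\<forall>z. p z \<le> 1) \<and>
      (\<forall>G\<in>sets (Reuc B). \<forall>H\<in>sets (Reuc C).
        (LI y. indicator R y * (indicator F (restrict y A) * indicator G (restrict y B) * indicator H (restrict y C))) =
        (LI y. indicator R y * (p (restrict y C) * indicator G (restrict y B) * indicator H (restrict y C))))"
  shows "cond_indep_on R"
proof -
  interpret three_variables "uniform_measure \<Lambda> R" "Reuc A" "\<lambda>y. restrict y A" "Reuc B" "\<lambda>y. restrict y B" "Reuc C" "\<lambda>y. restrict y C"
    by (rule three_variables_uniform[OF R])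
  note [measurable] = measurable_restrict_\<Lambda>[OF subs(1)] measurable_restrict_\<Lambda>[OF subs(2)] measurable_restrict_\<Lambda>[OF subs(3)]
  show ?thesis
  proof (rule cond_indep_varI)
    fix F assume F [measurable]: "F \<in> sets (Reuc A)"
    obtain p where p [measurable]: "p \<in> borel_measurable (Reuc C)" and p1: "\<And>z. p z \<le> 1"
      and eq: "\<And>G H. G \<in> sets (Reuc B) \<Longrightarrow> H \<in> sets (Reuc C) \<Longrightarrow>
        (LI y. indicator R y * (indicator F (restrict y A) * indicator G (restrict y B) * indicator H (restrict y C))) =
        (LI y. indicator R y * (p (restrict y C) * indicator G (restrict y B) * indicator H (restrict y C)))"
      using ex[OF F] by blast
    show "\<exists>p. p \<in> borel_measurable (Reuc C) \<and> (\<forall>z. p z \<le> (1 :: ennreal)) \<and>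
      (\<forall>G\<in>sets (Reuc B). \<forall>H\<in>sets (Reuc C).
        (\<integral>\<^sup>+y. indicator F (restrict y A) * indicator G (restrict y B) * indicator H (restrict y C) \<partial>uniform_measure \<Lambda> R) =
        (\<integral>\<^sup>+y. p (restrict y C) * indicator G (restrict y B) * indicator H (restrict y C) \<partial>uniform_measure \<Lambda> R))"
    proof (intro exI[of _ p] conjI allI ballI p p1)
      fix G H assume GH [measurable]: "G \<in> sets (Reuc B)" "H \<in> sets (Reuc C)"
      show "(\<integral>\<^sup>+y. indicator F (restrict y A) * indicator G (restrict y B) * indicator H (restrict y C) \<partial>uniform_measure \<Lambda> R) =
        (\<integral>\<^sup>+y. p (restrict y C) * indicator G (restrict y B) * indicator H (restrict y C) \<partial>uniform_measure \<Lambda> R)"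
        by (subst nn_integral_uniform_eq_iff[OF R]) (measurable, rule eq[OF GH])
    qed
  qed
qed

lemma nn_integral_split_origin:
  assumes C: "C \<subseteq> V" and k [measurable]: "k \<in> borel_measurable \<Lambda>" and H [measurable]: "H \<in> sets (Reuc C)"
  shows "(LI y. indicator H (restrict y C) * k y) =
    indicator H (origin C) * (LI y. indicator {origin C} (restrict y C) * k y) +
    (LI y. indicator (H - {origin C}) (restrict y C) * k y)"
proof -
  note [measurable] = measurable_restrict_\<Lambda>[OF C] origin_sets[OF finite_sub[OF C]]
  have "(LI y. indicator H (restrict y C) * k y) =
    (LI y. indicator H (origin C) * (indicator {origin C} (restrict y C) * k y) + indicator (H - {origin C}) (restrict y C) * k y)"
    by (intro nn_integral_cong) (auto simp: indicator_def)
  also have "\<dots> = (LI y. indicator H (origin C) * (indicator {origin C} (restrict y C) * k y)) +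
    (LI y. indicator (H - {origin C}) (restrict y C) * k y)"
    by (rule nn_integral_add) measurable
  also have "(LI y. indicator H (origin C) * (indicator {origin C} (restrict y C) * k y)) =
      indicator H (origin C) * (LI y. indicator {origin C} (restrict y C) * k y)"
    by (rule nn_integral_cmult) measurable
  finally show ?thesis .
qed

text \<open>On \<open>y\<^sub>C \<noteq> 0\<close> the version is taken relative to the event \<open>a \<in> R\<^sub>A\<close>, which equals conditioning on the rectangle
  \<open>R\<^sub>A \<times> R\<^sub>B \<times> R\<^sub>C\<close> under a product law. On \<open>y\<^sub>C = 0\<close> a constant will do.\<close>

lemma cond_indep_on_test_rectangle:
  assumes fact: "factorizes \<Lambda> A B C" and R: "R \<in> test_rectangles V \<Lambda>"
  shows "cond_indep_on R"
proof (rule test_rectangle_cond_indepI[OF R])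
  fix F assume F [measurable]: "F \<in> sets (Reuc A)"
  define a where "a = (\<lambda>y :: 'v \<Rightarrow> real. restrict y A)"
  define b where "b = (\<lambda>y :: 'v \<Rightarrow> real. restrict y B)"
  define r where "r = (\<lambda>y :: 'v \<Rightarrow> real. restrict y C)"
  have abr [measurable]: "a \<in> \<Lambda> \<rightarrow>\<^sub>M Reuc A" "b \<in> \<Lambda> \<rightarrow>\<^sub>M Reuc B" "r \<in> \<Lambda> \<rightarrow>\<^sub>M Reuc C"
    unfolding a_def b_def r_def using subs by measurable
  have [measurable]: "{origin C} \<in> sets (Reuc C)" "{origin A} \<in> sets (Reuc A)" "{origin B} \<in> sets (Reuc B)"
    using finite_sub subs by simp_all
  obtain Rv where Rv: "R = PiE V Rv" "\<And>v. v \<in> V \<Longrightarrow> Rv v \<in> sets borel"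
    using R by (auto simp: test_rectangles_def)
  define RA where "RA = PiE A Rv"
  define RB where "RB = PiE B Rv"
  define RC where "RC = PiE C Rv"
  have [measurable]: "RA \<in> sets (Reuc A)" "RB \<in> sets (Reuc B)" "RC \<in> sets (Reuc C)"
    unfolding RA_def RB_def RC_def Reuc_def using finite_sub subs Rv(2) by (auto intro!: sets_PiM_I_finite)
  have Rind: "indicator R y = (indicator RA (a y) * indicator RB (b y) * indicator RC (r y) :: ennreal)" if "y \<in> space \<Lambda>" for y
  proof -
    have "y \<in> extensional V" using that by (auto simp: space_\<Lambda>_alt space_Reuc PiE_def)
    then have "y \<in> R \<longleftrightarrow> a y \<in> RA \<and> b y \<in> RB \<and> r y \<in> RC"
      unfolding Rv(1) RA_def RB_def RC_def a_def b_def r_def V by (auto simp: PiE_def Pi_def)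
    then show ?thesis by (auto simp: indicator_def)
  qed
  have Rm [measurable]: "R \<in> sets \<Lambda>" using test_rectangle_sets[OF R] by simp
  have "\<not> (\<forall>v\<in>V. 0 \<in> Rv v)"
    using test_rectangle_sets(4)[OF R] unfolding Rv(1) by (auto simp: origin_def)
  then obtain v where v: "v \<in> V" "0 \<notin> Rv v" by blast
  have yv: "y v \<noteq> 0" if "y \<in> R" for y
    using that v unfolding Rv(1) by (metis PiE_mem)
  obtain p where pm [measurable]: "p \<in> borel_measurable (Reuc C)" and p1: "\<And>c. p c \<le> 1"
    and pk: "\<And>\<phi>. \<phi> \<in> borel_measurable (Reuc C) \<Longrightarrow> \<phi> (origin C) = 0 \<Longrightarrow>
      (LI y. \<phi> (r y) * indicator (F \<inter> RA) (a y)) = (LI y. \<phi> (r y) * (p (r y) * indicator RA (a y)))"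
    unfolding r_def
    by (rule relative_cond_version_exists[OF subs(3), of "\<lambda>y. indicator (F \<inter> RA) (a y)" "\<lambda>y. indicator RA (a y)"])
      (auto simp: indicator_def)
  \<comment> \<open>On \<open>y\<^sub>C = 0\<close> within \<open>R\<close>, one of \<open>a\<close>, \<open>b\<close> is almost everywhere zero, hence \<open>a\<close> and \<open>b\<close> are independent there.\<close>
  define z :: "('v \<Rightarrow> real) \<Rightarrow> ennreal" where "z y = indicator {origin C} (r y) * indicator R y" for y
  have [measurable]: "z \<in> borel_measurable \<Lambda>" unfolding z_def by measurable
  have "\<exists>P0\<le>1. \<forall>G\<in>sets (Reuc B). (LI y. z y * (indicator F (a y) * indicator G (b y))) = P0 * (LI y. z y * indicator G (b y))"
  proof -
    have "{y \<in> space \<Lambda>. r y \<in> {origin C} \<and> a y \<notin> {origin A} \<and> b y \<notin> {origin B}} \<in> sets \<Lambda>" by measurable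
    then have null: "AE y in \<Lambda>. \<not> (r y = origin C \<and> a y \<noteq> origin A \<and> b y \<noteq> origin B)"
      using fact unfolding factorizes_def by (subst AE_iff_measurable[OF _ refl]) (auto simp: a_def b_def r_def)
    consider "v \<in> C" | "v \<in> A" | "v \<in> B" using v(1) V by blast
    then show ?thesis
    proof cases
      case 1
      have "z y = 0" for y
        using yv[of y] 1 by (auto simp: z_def indicator_def r_def restrict_eq_origin_iff)
      then show ?thesis by (intro exI[of _ 0]) simp
    next
      case 2
      have z1: "z y \<noteq> 0 \<Longrightarrow> a y \<noteq> origin A" for y
        using yv[of y] 2 by (auto simp: z_def indicator_def a_def restrict_eq_origin_iff)
      have z2: "z y \<noteq> 0 \<Longrightarrow> r y = origin C" for y by (auto simp: z_def indicator_def)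
      have AE: "AE y in \<Lambda>. z y \<noteq> 0 \<longrightarrow> b y = origin B"
        using null by eventually_elim (use z1 z2 in blast)
      let ?m = "LI y. z y" and ?f = "LI y. z y * indicator F (a y)"
      have m: "?m < \<infinity>"
      proof -
        have "?m \<le> (LI y. indicator R y)" by (intro nn_integral_mono) (simp add: z_def indicator_def)
        also have "\<dots> < \<infinity>" using test_rectangle_sets[OF R] by simp
        finally show ?thesis .
      qed
      have fm: "?f \<le> ?m" by (intro nn_integral_mono) (simp add: indicator_def)
      have eq: "(LI y. z y * (h (a y) * indicator G (b y))) = indicator G (origin B) * (LI y. z y * h (a y))"
        if [measurable]: "h \<in> borel_measurable (Reuc A)" for h and G
      proof -
        have "(LI y. z y * (h (a y) * indicator G (b y))) = (LI y. indicator G (origin B) * (z y * h (a y)))"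
        proof (rule nn_integral_cong_AE)
          show "AE y in \<Lambda>. z y * (h (a y) * indicator G (b y)) = indicator G (origin B) * (z y * h (a y))"
            using AE by eventually_elim (auto simp: ac_simps)
        qed
        also have "\<dots> = indicator G (origin B) * (LI y. z y * h (a y))"
          by (rule nn_integral_cmult) measurable
        finally show ?thesis .
      qed
      show ?thesis
      proof (intro exI[of _ "?f / ?m"] conjI ballI)
        show "?f / ?m \<le> 1"
          using fm m by (cases "?m = 0") (auto intro!: divide_le_posI_ennreal simp: zero_less_iff_neq_zero)
        fix G assume "G \<in> sets (Reuc B)"
        have "?f = ?f / ?m * ?m"
          using fm m by (cases "?m = 0") (auto simp: ennreal_divide_times)
        then show "(LI y. z y * (indicator F (a y) * indicator G (b y))) = ?f / ?m * (LI y. z y * indicator G (b y))"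
          using eq[of "indicator F" G] eq[of "\<lambda>_. 1" G] by (simp add: mult.left_commute)
      qed
    next
      case 3
      have z1: "z y \<noteq> 0 \<Longrightarrow> b y \<noteq> origin B" for y
        using yv[of y] 3 by (auto simp: z_def indicator_def b_def restrict_eq_origin_iff)
      have z2: "z y \<noteq> 0 \<Longrightarrow> r y = origin C" for y by (auto simp: z_def indicator_def)
      have AE: "AE y in \<Lambda>. z y \<noteq> 0 \<longrightarrow> a y = origin A"
        using null by eventually_elim (use z1 z2 in blast)
      show ?thesis
      proof (intro exI[of _ "indicator F (origin A)"] conjI ballI)
        fix G assume [measurable]: "G \<in> sets (Reuc B)"
        have "(LI y. z y * (indicator F (a y) * indicator G (b y))) = (LI y. indicator F (origin A) * (z y * indicator G (b y)))"
        proof (rule nn_integral_cong_AE)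
          show "AE y in \<Lambda>. z y * (indicator F (a y) * indicator G (b y)) = indicator F (origin A) * (z y * indicator G (b y))"
            using AE by eventually_elim (auto simp: ac_simps)
        qed
        also have "\<dots> = indicator F (origin A) * (LI y. z y * indicator G (b y))"
          by (rule nn_integral_cmult) measurable
        finally show "(LI y. z y * (indicator F (a y) * indicator G (b y))) = indicator F (origin A) * (LI y. z y * indicator G (b y))" .
      qed (simp add: indicator_def)
    qed
  qed
  then obtain P0 where P0: "P0 \<le> 1" "\<And>G. G \<in> sets (Reuc B) \<Longrightarrow>
    (LI y. z y * (indicator F (a y) * indicator G (b y))) = P0 * (LI y. z y * indicator G (b y))" by blast
  define p' where "p' c = (if c \<in> {origin C} then P0 else p c)" for c
  have [measurable]: "p' \<in> borel_measurable (Reuc C)" unfolding p'_def by measurable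
  have off: "(LI y. indicator H (r y) * (indicator R y * (indicator F (a y) * indicator G (b y)))) =
      (LI y. indicator H (r y) * (indicator R y * (p' (r y) * indicator G (b y))))"
    if G [measurable]: "G \<in> sets (Reuc B)" and H [measurable]: "H \<in> sets (Reuc C)" and H0: "origin C \<notin> H" for G H
  proof -
    have kern: "\<exists>q. cond_version \<Lambda> C (\<lambda>y. indicator S (restrict y I)) q" if I: "I \<subseteq> V" and S: "S \<in> sets (Reuc I)" for S I
    proof -
      have "(\<lambda>y. indicator S (restrict y I)) \<in> borel_measurable \<Lambda>"
        using borel_measurable_indicator[OF S] by (rule measurable_compose[OF measurable_restrict_\<Lambda>[OF I]])
      then obtain p where "cond_version \<Lambda> C (\<lambda>y. indicator S (restrict y I)) p"
        by (rule cond_version_exists[OF subs(3)]) (simp add: indicator_def, blast)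
      then show ?thesis by blast
    qed
    have FRA: "F \<inter> RA \<in> sets (Reuc A)" and RAm: "RA \<in> sets (Reuc A)" and GRB: "G \<inter> RB \<in> sets (Reuc B)" by measurable
    obtain pF where pF: "cond_version \<Lambda> C (\<lambda>y. indicator (F \<inter> RA) (restrict y A)) pF" using kern[OF subs(1) FRA] by blast
    obtain pA where pA: "cond_version \<Lambda> C (\<lambda>y. indicator RA (restrict y A)) pA" using kern[OF subs(1) RAm] by blast
    obtain pG where pG: "cond_version \<Lambda> C (\<lambda>y. indicator (G \<inter> RB) (restrict y B)) pG" using kern[OF subs(2) GRB] by blast
    have [measurable]: "pF \<in> borel_measurable (Reuc C)" "pA \<in> borel_measurable (Reuc C)" "pG \<in> borel_measurable (Reuc C)"
      using pF pA pG by (auto simp: cond_version_def)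
    let ?\<phi> = "\<lambda>c. indicator (H \<inter> RC) c :: ennreal"
    have \<phi>0: "?\<phi> (origin C) = 0" using H0 by simp
    have "(LI y. indicator H (r y) * (indicator R y * (indicator F (a y) * indicator G (b y)))) =
        (LI y. ?\<phi> (r y) * (indicator (F \<inter> RA) (a y) * indicator (G \<inter> RB) (b y)))"
      by (intro nn_integral_cong) (simp add: Rind, auto simp: indicator_def)
    also have "\<dots> = (LI y. ?\<phi> (r y) * (pF (r y) * pG (r y)))"
      unfolding a_def b_def r_def using \<phi>0
      by (intro factorizes_product[OF subs fact _ _ pF pG]) measurable
    also have "\<dots> = (LI y. (?\<phi> (r y) * pG (r y)) * pF (r y))" by (simp only: ac_simps)
    also have "\<dots> = (LI y. (?\<phi> (r y) * pG (r y)) * indicator (F \<inter> RA) (a y))"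
    proof -
      have "(\<lambda>c. ?\<phi> c * pG c) \<in> borel_measurable (Reuc C)" by measurable
      then show ?thesis using pF \<phi>0 unfolding cond_version_def r_def a_def by fastforce
    qed
    also have "\<dots> = (LI y. (?\<phi> (r y) * pG (r y)) * (p (r y) * indicator RA (a y)))"
      by (rule pk[of "\<lambda>c. ?\<phi> c * pG c"]) (simp_all add: H0)
    also have "\<dots> = (LI y. (?\<phi> (r y) * pG (r y) * p (r y)) * indicator RA (a y))" by (simp only: ac_simps)
    also have "\<dots> = (LI y. (?\<phi> (r y) * pG (r y) * p (r y)) * pA (r y))"
    proof -
      have "(\<lambda>c. ?\<phi> c * pG c * p c) \<in> borel_measurable (Reuc C)" by measurable
      then show ?thesis using pA \<phi>0 unfolding cond_version_def r_def a_def by fastforce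
    qed
    also have "\<dots> = (LI y. (?\<phi> (r y) * p (r y)) * (pA (r y) * pG (r y)))" by (simp only: ac_simps)
    also have "\<dots> = (LI y. (?\<phi> (r y) * p (r y)) * (indicator RA (a y) * indicator (G \<inter> RB) (b y)))"
    proof -
      have "(\<lambda>c. ?\<phi> c * p c) \<in> borel_measurable (Reuc C)" by measurable
      then show ?thesis
        unfolding a_def b_def r_def using \<phi>0
        by (intro factorizes_product[OF subs fact _ _ pA pG, where \<phi>="\<lambda>c. ?\<phi> c * p c", symmetric]) simp_all
    qed
    also have "\<dots> = (LI y. indicator H (r y) * (indicator R y * (p' (r y) * indicator G (b y))))"
      using H0 by (intro nn_integral_cong) (simp add: Rind, auto simp: indicator_def p'_def)
    finally show ?thesis .
  qed
  have "(LI y. indicator H (r y) * (indicator R y * (indicator F (a y) * indicator G (b y)))) =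
      (LI y. indicator H (r y) * (indicator R y * (p' (r y) * indicator G (b y))))"
    if G [measurable]: "G \<in> sets (Reuc B)" and H [measurable]: "H \<in> sets (Reuc C)" for G H
  proof -
    have "(LI y. indicator {origin C} (r y) * (indicator R y * (indicator F (a y) * indicator G (b y)))) =
        (LI y. z y * (indicator F (a y) * indicator G (b y)))"
      by (simp only: z_def mult.assoc)
    also have "\<dots> = P0 * (LI y. z y * indicator G (b y))" by (rule P0(2)[OF G])
    also have "\<dots> = (LI y. P0 * (z y * indicator G (b y)))" by (rule nn_integral_cmult[symmetric]) measurable
    also have "\<dots> = (LI y. indicator {origin C} (r y) * (indicator R y * (p' (r y) * indicator G (b y))))"
      by (intro nn_integral_cong) (auto simp: z_def indicator_def p'_def)
    finally have "(LI y. indicator {origin C} (r y) * (indicator R y * (indicator F (a y) * indicator G (b y)))) =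
      (LI y. indicator {origin C} (r y) * (indicator R y * (p' (r y) * indicator G (b y))))" .
    moreover have "H - {origin C} \<in> sets (Reuc C)" by measurable
    then have "(LI y. indicator (H - {origin C}) (r y) * (indicator R y * (indicator F (a y) * indicator G (b y)))) =
      (LI y. indicator (H - {origin C}) (r y) * (indicator R y * (p' (r y) * indicator G (b y))))"
      by (intro off[OF G]) auto
    moreover have "(\<lambda>y. indicator R y * (indicator F (a y) * indicator G (b y)) :: ennreal) \<in> borel_measurable \<Lambda>"
      "(\<lambda>y. indicator R y * (p' (r y) * indicator G (b y)) :: ennreal) \<in> borel_measurable \<Lambda>" by measurable
    ultimately show ?thesis
      unfolding r_def
      using nn_integral_split_origin[OF subs(3) _ H] by simp
  qed
  note all = this
  show "\<exists>p. p \<in> borel_measurable (Reuc C) \<and> (\<forall>z. p z \<le> 1) \<and>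
      (\<forall>G\<in>sets (Reuc B). \<forall>H\<in>sets (Reuc C).
        (LI y. indicator R y * (indicator F (restrict y A) * indicator G (restrict y B) * indicator H (restrict y C))) =
        (LI y. indicator R y * (p (restrict y C) * indicator G (restrict y B) * indicator H (restrict y C))))"
  proof (intro exI[of _ p'] conjI allI ballI)
    show "p' c \<le> 1" for c using p1 P0(1) by (simp add: p'_def)
    fix G H assume "G \<in> sets (Reuc B)" "H \<in> sets (Reuc C)"
    from all[OF this] show "(LI y. indicator R y * (indicator F (restrict y A) * indicator G (restrict y B) * indicator H (restrict y C))) =
        (LI y. indicator R y * (p' (restrict y C) * indicator G (restrict y B) * indicator H (restrict y C)))"
      unfolding a_def b_def r_def by (simp only: ac_simps)
  qed measurable
qed

lemma sets_box:
  assumes "\<And>v. v \<in> V \<Longrightarrow> S v \<in> sets borel"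
  shows "PiE V S \<in> sets (Reuc V)"
  unfolding Reuc_def using finite_V assms by (intro sets_PiM_I_finite) auto

text \<open>One side away from zero keeps a rectangle away from the origin.\<close>

lemma test_rectangleI:
  assumes "\<And>v. v \<in> V \<Longrightarrow> Rv v \<in> sets borel" and w: "w \<in> V" "Rv w \<subseteq> {x. 1 / real (Suc n) < \<bar>x\<bar>}"
    and "emeasure \<Lambda> (PiE V Rv) \<noteq> 0"
  shows "PiE V Rv \<in> test_rectangles V \<Lambda>"
proof -
  have "origin V \<notin> Rtop V closure_of (PiE V Rv)"
  proof (rule origin_notin_closure[where I="{w}" and n=n])
    fix y assume "y \<in> PiE V Rv"
    then have "y w \<in> Rv w" using w(1) by (rule PiE_mem)
    then show "restrict y {w} \<in> layer {w} n" using w(2) by (auto simp: layer_def)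
  qed (use w in simp)
  then show ?thesis
    using assms(1,4) by (auto simp: test_rectangles_def zero_less_iff_neq_zero)
qed

text \<open>With \<open>R n = {y\<^sub>C = 0, \<bar>y\<^sub>v\<bar> > 1/(n+1)}\<close> and \<open>S\<close> the set in question, independence on \<open>R n\<close> bounds
  \<open>\<Lambda>(R n) \<Lambda>(S)\<close> by a finite constant. The masses \<open>\<Lambda>(R n)\<close> increase to a limit that is \<open>0\<close> or \<open>\<infinity>\<close> by explosiveness.
  In the first case \<open>S\<close> is contained in a null set, in the second one \<open>\<Lambda>(S) = 0\<close> is forced.\<close>

lemma factorizes_null_if_cond_indep_on_test_rectangles:
  assumes ci: "\<And>R. R \<in> test_rectangles V \<Lambda> \<Longrightarrow>
    cond_indep_on R"
    and va: "va \<in> A" and vb: "vb \<in> B"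
  shows "emeasure \<Lambda> {y \<in> space \<Lambda>. restrict y C = origin C \<and> 1 / real (Suc m) < \<bar>y va\<bar> \<and> 1 / real (Suc m) < \<bar>y vb\<bar>} = 0"
proof -
  define r where "r = (\<lambda>y :: 'v \<Rightarrow> real. restrict y C)"
  have rm [measurable]: "r \<in> \<Lambda> \<rightarrow>\<^sub>M Reuc C" unfolding r_def using subs by measurable
  have vV: "va \<in> V" "vb \<in> V" "va \<notin> C" "vb \<notin> C" using va vb V disj by auto
  note [measurable] = measurable_coord_\<Lambda>[OF vV(1)] measurable_coord_\<Lambda>[OF vV(2)] origin_sets[OF finite_sub[OF subs(3)]]
  define d :: "nat \<Rightarrow> real" where "d n = 1 / real (Suc n)" for n
  define Rv where "Rv n v = (if v \<in> C then {0} else if v = va then {x. d n < \<bar>x\<bar>} else UNIV)" for n v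
  define R where "R n = PiE V (Rv n)" for n
  have R_eq: "R n = {y \<in> space \<Lambda>. r y \<in> {origin C} \<and> d n < \<bar>y va\<bar>}" for n
  proof (intro set_eqI iffI)
    fix y assume y: "y \<in> R n"
    then have mem: "y v \<in> Rv n v" if "v \<in> V" for v using that unfolding R_def by (rule PiE_mem)
    have "d n < \<bar>y va\<bar>" using mem[OF vV(1)] vV(3) by (simp add: Rv_def)
    moreover from this have "y \<noteq> origin V" using vV(1) by (auto simp: origin_def d_def)
    moreover have "y v = 0" if "v \<in> C" for v using mem[of v] that subs by (auto simp: Rv_def)
    ultimately show "y \<in> {y \<in> space \<Lambda>. r y \<in> {origin C} \<and> d n < \<bar>y va\<bar>}"
      using y by (auto simp: R_def space_\<Lambda>_alt space_Reuc r_def restrict_eq_origin_iff PiE_def)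
  next
    fix y assume "y \<in> {y \<in> space \<Lambda>. r y \<in> {origin C} \<and> d n < \<bar>y va\<bar>}"
    then show "y \<in> R n"
      by (auto simp: R_def Rv_def space_\<Lambda>_alt space_Reuc r_def restrict_eq_origin_iff PiE_def Pi_def)
  qed
  have Rm [measurable]: "R n \<in> sets \<Lambda>" for n unfolding R_eq by measurable
  define S where "S = {y \<in> space \<Lambda>. r y \<in> {origin C} \<and> d m < \<bar>y va\<bar> \<and> d m < \<bar>y vb\<bar>}"
  have Sm [measurable]: "S \<in> sets \<Lambda>" unfolding S_def by measurable
  define La where "La = {y \<in> space \<Lambda>. d m < \<bar>y va\<bar>}"
  define Lb where "Lb = {y \<in> space \<Lambda>. d m < \<bar>y vb\<bar>}"
  have [measurable]: "La \<in> sets \<Lambda>" "Lb \<in> sets \<Lambda>" unfolding La_def Lb_def by measurable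
  have fin: "emeasure \<Lambda> {y \<in> space \<Lambda>. d m < \<bar>y v\<bar>} < \<infinity>" if "v \<in> V" for v
    using emeasure_layer_finite[of "{v}" m] that by (simp add: layer_def d_def)
  have dm: "d n \<le> d m" if "m \<le> n" for n using that by (simp add: d_def frac_le)
  have bound: "emeasure \<Lambda> (R n) * emeasure \<Lambda> S \<le> emeasure \<Lambda> La * emeasure \<Lambda> Lb" if mn: "m \<le> n" for n
  proof (cases "emeasure \<Lambda> (R n) = 0")
    case False
    have Rt: "R n \<in> test_rectangles V \<Lambda>"
      unfolding R_def
      by (rule test_rectangleI[where w=va and n=n]) (use False vV in \<open>auto simp: Rv_def R_def d_def simp del: of_nat_Suc\<close>)
    define F where "F = {z \<in> space (Reuc A). d m < \<bar>z va\<bar>}"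
    define G where "G = {z \<in> space (Reuc B). d m < \<bar>z vb\<bar>}"
    note [measurable] = measurable_coord[OF va] measurable_coord[OF vb]
    have FG: "F \<in> sets (Reuc A)" "G \<in> sets (Reuc B)" unfolding F_def G_def by measurable
    have iF: "indicator F (restrict y A) = (indicator {y. d m < \<bar>y va\<bar>} y :: ennreal)"
      and iG: "indicator G (restrict y B) = (indicator {y. d m < \<bar>y vb\<bar>} y :: ennreal)" for y
      using va vb by (auto simp: F_def G_def indicator_def)
    \<comment> \<open>the conditional probability of \<open>F\<close> given \<open>R n\<close>, constant because \<open>y\<^sub>C = 0\<close> on \<open>R n\<close>\<close>
    let ?P = "emeasure \<Lambda> (R n \<inter> La) / emeasure \<Lambda> (R n)"
    have fR: "emeasure \<Lambda> (R n) < \<infinity>" using test_rectangle_sets[OF Rt] by simp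
    have le: "emeasure \<Lambda> (R n \<inter> La) \<le> emeasure \<Lambda> (R n)" by (intro emeasure_mono) auto
    have P1: "?P \<le> 1" using le False fR by (auto intro!: divide_le_posI_ennreal simp: zero_less_iff_neq_zero)
    have PR: "?P * emeasure \<Lambda> (R n) = emeasure \<Lambda> (R n \<inter> La)"
      using le False fR by (auto simp: ennreal_divide_times)
    have "(LI y. indicator (R n) y * (indicator F (restrict y A) * indicator G (restrict y B) * indicator (space (Reuc C)) (restrict y C))) =
      (LI y. indicator (R n) y * (?P * indicator G (restrict y B) * indicator (space (Reuc C)) (restrict y C)))"
    proof (rule test_rectangle_cond_indepD[OF Rt ci[OF Rt] FG sets.top _ P1])
      fix H assume H [measurable]: "H \<in> sets (Reuc C)"
      have "(LI y. indicator (R n) y * (indicator F (restrict y A) * indicator H (restrict y C))) =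
          (LI y. indicator H (origin C) * indicator (R n \<inter> La) y)"
        unfolding iF by (intro nn_integral_cong) (auto simp: indicator_def R_eq La_def r_def)
      also have "\<dots> = indicator H (origin C) * emeasure \<Lambda> (R n \<inter> La)"
        by (rule nn_integral_cmult_indicator) measurable
      also have "\<dots> = (indicator H (origin C) * ?P) * emeasure \<Lambda> (R n)" by (simp only: mult.assoc PR)
      also have "\<dots> = (LI y. (indicator H (origin C) * ?P) * indicator (R n) y)"
        by (rule nn_integral_cmult_indicator[symmetric]) measurable
      also have "\<dots> = (LI y. indicator (R n) y * (?P * indicator H (restrict y C)))"
        by (intro nn_integral_cong) (auto simp: indicator_def R_eq r_def)
      finally show "(LI y. indicator (R n) y * (indicator F (restrict y A) * indicator H (restrict y C))) =
        (LI y. indicator (R n) y * (?P * indicator H (restrict y C)))" .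
    qed simp
    moreover have "(LI y. indicator (R n) y * (indicator F (restrict y A) * indicator G (restrict y B) * indicator (space (Reuc C)) (restrict y C))) =
        (LI y. indicator S y)"
      unfolding iF iG using dm[OF mn] by (intro nn_integral_cong) (auto simp: indicator_def R_eq S_def)
    moreover have "(LI y. indicator (R n) y * (?P * indicator G (restrict y B) * indicator (space (Reuc C)) (restrict y C))) =
        (LI y. ?P * indicator (R n \<inter> Lb) y)"
      unfolding iG by (intro nn_integral_cong) (auto simp: indicator_def R_eq Lb_def)
    ultimately have "emeasure \<Lambda> S = ?P * emeasure \<Lambda> (R n \<inter> Lb)"
      by (simp add: nn_integral_cmult_indicator)
    then have "emeasure \<Lambda> (R n) * emeasure \<Lambda> S = (?P * emeasure \<Lambda> (R n)) * emeasure \<Lambda> (R n \<inter> Lb)"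
      by (simp only: ac_simps)
    also have "\<dots> = emeasure \<Lambda> (R n \<inter> La) * emeasure \<Lambda> (R n \<inter> Lb)" by (simp only: PR)
    also have "\<dots> \<le> emeasure \<Lambda> La * emeasure \<Lambda> Lb" by (intro mult_mono emeasure_mono) auto
    finally show ?thesis .
  qed simp
  have inc: "incseq R"
  proof (rule incseq_SucI, rule subsetI)
    fix n y assume "y \<in> R n"
    moreover have "d (Suc n) \<le> d n" by (simp add: d_def frac_le)
    ultimately show "y \<in> R (Suc n)" by (auto simp: R_eq)
  qed
  have all_bound: "emeasure \<Lambda> (R n) * emeasure \<Lambda> S \<le> emeasure \<Lambda> La * emeasure \<Lambda> Lb" for n
  proof -
    have "emeasure \<Lambda> (R n) \<le> emeasure \<Lambda> (R (max m n))"
      using inc by (intro emeasure_mono) (auto simp: incseq_def)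
    then have "emeasure \<Lambda> (R n) * emeasure \<Lambda> S \<le> emeasure \<Lambda> (R (max m n)) * emeasure \<Lambda> S"
      by (rule mult_right_mono) simp
    also have "\<dots> \<le> emeasure \<Lambda> La * emeasure \<Lambda> Lb" by (rule bound) simp
    finally show ?thesis .
  qed
  let ?E = "{y \<in> space (Epunct V). y va \<noteq> 0 \<and> restrict y (V - (V - C)) = origin (V - (V - C))}"
  have VC: "V - (V - C) = C" using subs(3) by auto
  have UN: "(\<Union>n. R n) = ?E"
  proof (intro set_eqI iffI)
    fix y assume "y \<in> ?E"
    then have y: "y \<in> space \<Lambda>" "y va \<noteq> 0" "r y = origin C" by (auto simp: VC r_def space_\<Lambda>)
    then obtain n where "inverse (real (Suc n)) < \<bar>y va\<bar>" using reals_Archimedean[of "\<bar>y va\<bar>"] by auto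
    then show "y \<in> (\<Union>n. R n)" using y by (auto simp: R_eq d_def inverse_eq_divide)
  next
    fix y assume "y \<in> (\<Union>n. R n)"
    then obtain n where "y \<in> space \<Lambda>" "r y = origin C" "d n < \<bar>y va\<bar>" by (auto simp: R_eq)
    moreover have "0 \<le> d n" by (simp add: d_def)
    ultimately show "y \<in> ?E" by (auto simp: VC r_def space_\<Lambda>)
  qed
  have S0: "emeasure \<Lambda> S = 0"
  proof -
    have E: "emeasure \<Lambda> (\<Union>n. R n) \<in> {0, \<infinity>}"
      unfolding UN using vV by (intro explosive) auto
    show ?thesis
    proof (cases "emeasure \<Lambda> (\<Union>n. R n) = 0")
      case True
      have "S \<subseteq> R m" by (auto simp: S_def R_eq)
      then have "emeasure \<Lambda> S \<le> emeasure \<Lambda> (\<Union>n. R n)" by (intro emeasure_mono) auto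
      then show ?thesis using True by simp
    next
      case False
      have "emeasure \<Lambda> (\<Union>n. R n) * emeasure \<Lambda> S = (SUP n. emeasure \<Lambda> (R n)) * emeasure \<Lambda> S"
        using inc by (subst SUP_emeasure_incseq) auto
      also have "\<dots> = (SUP n. emeasure \<Lambda> (R n) * emeasure \<Lambda> S)" by (rule SUP_mult_right_ennreal)
      also have "\<dots> \<le> emeasure \<Lambda> La * emeasure \<Lambda> Lb" using all_bound by (rule SUP_least)
      also have "\<dots> < \<infinity>"
        using fin[OF vV(1)] fin[OF vV(2)] by (simp add: La_def Lb_def ennreal_mult_less_top)
      finally show ?thesis using E False by (cases "emeasure \<Lambda> S = 0") (auto simp: ennreal_top_mult)
    qed
  qed
  moreover have "{y \<in> space \<Lambda>. restrict y C = origin C \<and> 1 / real (Suc m) < \<bar>y va\<bar> \<and> 1 / real (Suc m) < \<bar>y vb\<bar>} = S"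
    by (auto simp: S_def r_def d_def)
  ultimately show ?thesis by simp
qed

text \<open>For the second part a version under \<open>\<Lambda>\<close> is also a version under \<open>\<Lambda>\<close> conditioned on \<open>\<bar>y\<^sub>v\<bar> > 1/(n+1)\<close>, \<open>v \<in> C\<close>,
  since this is an event of \<open>y\<^sub>C\<close>. These events cover \<open>y\<^sub>C \<noteq> 0\<close>.\<close>

lemma factorizes_if_cond_indep_on_test_rectangles:
  assumes ci: "\<And>R. R \<in> test_rectangles V \<Lambda> \<Longrightarrow>
    cond_indep_on R"
  shows "factorizes \<Lambda> A B C"
  unfolding factorizes_def
proof (intro conjI ballI)
  define r where "r = (\<lambda>y :: 'v \<Rightarrow> real. restrict y C)"
  have rm [measurable]: "r \<in> \<Lambda> \<rightarrow>\<^sub>M Reuc C" unfolding r_def using subs by measurable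
  note [measurable] = origin_sets[OF finite_sub[OF subs(3)]] measurable_restrict_\<Lambda>[OF subs(1)] measurable_restrict_\<Lambda>[OF subs(2)]
  define S where "S va vb m = {y \<in> space \<Lambda>. restrict y C = origin C \<and> 1 / real (Suc m) < \<bar>y va\<bar> \<and> 1 / real (Suc m) < \<bar>y vb\<bar>}" for va vb m
  have "S va vb m \<in> null_sets \<Lambda>" if "va \<in> A" "vb \<in> B" for va vb m
  proof
    show "emeasure \<Lambda> (S va vb m) = 0"
      unfolding S_def by (rule factorizes_null_if_cond_indep_on_test_rectangles[OF ci that])
    note [measurable] = measurable_coord_\<Lambda>[of va] measurable_coord_\<Lambda>[of vb]
    have "va \<in> V" "vb \<in> V" using that V by auto
    then have "{y \<in> space \<Lambda>. r y \<in> {origin C} \<and> 1 / real (Suc m) < \<bar>y va\<bar> \<and> 1 / real (Suc m) < \<bar>y vb\<bar>} \<in> sets \<Lambda>"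
      by measurable
    then show "S va vb m \<in> sets \<Lambda>" by (simp add: S_def r_def)
  qed
  then have "(\<Union>m. S va vb m) \<in> null_sets \<Lambda>" if "va \<in> A" "vb \<in> B" for va vb
    using that by (intro null_sets_UN) auto
  then have "(\<Union>vb\<in>B. \<Union>m. S va vb m) \<in> null_sets \<Lambda>" if "va \<in> A" for va
    using that by (intro null_sets.finite_UN[OF finite_sub[OF subs(2)]])
  then have "(\<Union>va\<in>A. \<Union>vb\<in>B. \<Union>m. S va vb m) \<in> null_sets \<Lambda>"
    by (rule null_sets.finite_UN[OF finite_sub[OF subs(1)]])
  moreover have "{y \<in> space \<Lambda>. restrict y C = origin C \<and> restrict y A \<noteq> origin A \<and> restrict y B \<noteq> origin B} = (\<Union>va\<in>A. \<Union>vb\<in>B. \<Union>m. S va vb m)"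
  proof (intro set_eqI iffI)
    fix y assume y: "y \<in> {y \<in> space \<Lambda>. restrict y C = origin C \<and> restrict y A \<noteq> origin A \<and> restrict y B \<noteq> origin B}"
    then obtain va vb where v: "va \<in> A" "y va \<noteq> 0" "vb \<in> B" "y vb \<noteq> 0" by (auto simp: restrict_eq_origin_iff)
    then have "0 < min \<bar>y va\<bar> \<bar>y vb\<bar>" by simp
    then obtain m where "inverse (real (Suc m)) < min \<bar>y va\<bar> \<bar>y vb\<bar>" using reals_Archimedean by blast
    then show "y \<in> (\<Union>va\<in>A. \<Union>vb\<in>B. \<Union>m. S va vb m)"
      using y v by (auto simp: S_def inverse_eq_divide simp del: of_nat_Suc)
  next
    fix y assume "y \<in> (\<Union>va\<in>A. \<Union>vb\<in>B. \<Union>m. S va vb m)"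
    then obtain va vb m where "va \<in> A" "vb \<in> B" "y \<in> S va vb m" by blast
    moreover have "0 \<le> 1 / real (Suc m)" by simp
    ultimately show "y \<in> {y \<in> space \<Lambda>. restrict y C = origin C \<and> restrict y A \<noteq> origin A \<and> restrict y B \<noteq> origin B}"
      unfolding S_def restrict_eq_origin_iff by force
  qed
  ultimately show "emeasure \<Lambda> {y \<in> space \<Lambda>. restrict y C = origin C \<and> restrict y A \<noteq> origin A \<and> restrict y B \<noteq> origin B} = 0"
    by auto
  fix F assume F [measurable]: "F \<in> sets (Reuc A)"
  obtain p where p: "cond_version \<Lambda> C (\<lambda>y. indicator F (restrict y A)) p" "\<And>c. p c \<le> 1"
    by (rule cond_version_exists[OF subs(3), of "\<lambda>y. indicator F (restrict y A)"]) (measurable, auto simp: indicator_def)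
  have pm [measurable]: "p \<in> borel_measurable (Reuc C)" using p(1) by (simp add: cond_version_def)
  define L where "L v n = {c \<in> space (Reuc C). 1 / real (Suc n) < \<bar>c v\<bar>}" for v n
  have Lm: "L v n \<in> sets (Reuc C)" if "v \<in> C" for v n
  proof -
    note [measurable] = measurable_coord[OF that]
    show ?thesis unfolding L_def by measurable
  qed
  have local: "(LI y. indicator T (r y) * (indicator G (restrict y B) * indicator F (restrict y A))) =
      (LI y. indicator T (r y) * (indicator G (restrict y B) * p (r y)))"
    if G [measurable]: "G \<in> sets (Reuc B)" and T [measurable]: "T \<in> sets (Reuc C)" and TL: "T \<subseteq> L v n" and v: "v \<in> C" for G T v n
  proof -
    define R where "R = PiE V (\<lambda>w. if w = v then {x. 1 / real (Suc n) < \<bar>x\<bar>} else UNIV)"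
    have vV: "v \<in> V" using v subs by auto
    have Rind: "indicator R y = (indicator (L v n) (r y) :: ennreal)" if "y \<in> space \<Lambda>" for y
      using that v vV by (auto simp: R_def L_def r_def indicator_def space_\<Lambda>_alt space_Reuc PiE_def Pi_def simp del: of_nat_Suc split: if_splits)
    have Rsub: "R \<subseteq> space \<Lambda>"
    proof
      fix y assume y: "y \<in> R"
      then have "y v \<in> {x. 1 / real (Suc n) < \<bar>x\<bar>}" using PiE_mem[OF y[unfolded R_def] vV] by simp
      then have "y \<noteq> origin V" using vV by (auto simp: origin_def)
      then show "y \<in> space \<Lambda>" using y by (auto simp: R_def space_\<Lambda>_alt space_Reuc PiE_def)
    qed
    have "R \<in> sets (Reuc V)" unfolding R_def by (rule sets_box) auto
    then have Rm [measurable]: "R \<in> sets \<Lambda>" using Rsub by (simp add: sets_\<Lambda>_iff)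
    have TR: "indicator R y * (indicator T (r y) * x) = indicator T (r y) * (x :: ennreal)" if "y \<in> space \<Lambda>" for x y
      using Rind[OF that] TL by (auto simp: indicator_def)
    show ?thesis
    proof (cases "emeasure \<Lambda> R = 0")
      case True
      then have "R \<in> null_sets \<Lambda>" by auto
      then have "AE y in \<Lambda>. y \<notin> R" by (rule AE_not_in)
      then have AE: "AE y in \<Lambda>. r y \<notin> T"
        using AE_space
      proof eventually_elim
        case (elim y)
        then have "r y \<notin> L v n" using Rind[of y] by (auto simp: indicator_def split: if_splits)
        then show ?case using TL by blast
      qed
      show ?thesis
      proof (rule nn_integral_cong_AE)
        show "AE y in \<Lambda>. indicator T (r y) * (indicator G (restrict y B) * indicator F (restrict y A)) =
          indicator T (r y) * (indicator G (restrict y B) * p (r y))"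
          using AE by eventually_elim simp
      qed
    next
      case False
      have Rt: "R \<in> test_rectangles V \<Lambda>"
        unfolding R_def
        by (rule test_rectangleI[where w=v and n=n]) (use False vV in \<open>auto simp: R_def simp del: of_nat_Suc\<close>)
      have "(LI y. indicator R y * (indicator F (restrict y A) * indicator G (restrict y B) * indicator T (restrict y C))) =
        (LI y. indicator R y * (p (restrict y C) * indicator G (restrict y B) * indicator T (restrict y C)))"
      proof (rule test_rectangle_cond_indepD[OF Rt ci[OF Rt] F G T pm p(2)])
        fix H assume H [measurable]: "H \<in> sets (Reuc C)"
        let ?\<phi> = "indicator (H \<inter> L v n) :: _ \<Rightarrow> ennreal"
        have "?\<phi> \<in> borel_measurable (Reuc C)" using Lm[OF v] by measurable
        moreover have "?\<phi> (origin C) = 0" using v by (simp add: L_def origin_def)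
        ultimately have k: "(LI y. ?\<phi> (r y) * indicator F (restrict y A)) = (LI y. ?\<phi> (r y) * p (r y))"
          using p(1) unfolding cond_version_def r_def by blast
        have ind: "indicator R y * (x * indicator H (restrict y C)) = ?\<phi> (r y) * x" if "y \<in> space \<Lambda>" for x y
          using Rind[OF that] by (auto simp: indicator_def r_def)
        have "(LI y. indicator R y * (x y * indicator H (restrict y C))) = (LI y. ?\<phi> (r y) * x y)" for x
          by (rule nn_integral_cong) (rule ind)
        then show "(LI y. indicator R y * (indicator F (restrict y A) * indicator H (restrict y C))) =
          (LI y. indicator R y * (p (restrict y C) * indicator H (restrict y C)))"
          using k by (simp only: r_def)
      qed
      moreover have "(LI y. indicator R y * (x y * indicator G (restrict y B) * indicator T (restrict y C))) =
          (LI y. indicator T (r y) * (indicator G (restrict y B) * x y))" for x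
      proof (rule nn_integral_cong)
        fix y assume "y \<in> space \<Lambda>"
        from TR[OF this, of "indicator G (restrict y B) * x y"]
        show "indicator R y * (x y * indicator G (restrict y B) * indicator T (restrict y C)) = indicator T (r y) * (indicator G (restrict y B) * x y)"
          by (simp only: r_def ac_simps)
      qed
      ultimately show ?thesis by (simp only: r_def)
    qed
  qed
  show "\<exists>p\<in>borel_measurable (Reuc C). \<forall>G\<in>sets (Reuc B). \<forall>H\<in>sets (Reuc C). origin C \<notin> H \<longrightarrow>
      (LI y. indicator H (restrict y C) * (indicator G (restrict y B) * indicator F (restrict y A))) =
      (LI y. indicator H (restrict y C) * (indicator G (restrict y B) * p (restrict y C)))"
  proof (intro bexI[OF _ pm] ballI impI)
    fix G H assume G [measurable]: "G \<in> sets (Reuc B)" and H: "H \<in> sets (Reuc C)" "origin C \<notin> H"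
    \<comment> \<open>the empty set is added because \<open>C\<close> may be empty and an enumeration needs a member\<close>
    define \<C> where "\<C> = insert {} (\<Union>v\<in>C. range (L v))"
    have \<C>: "countable \<C>" "\<C> \<noteq> {}"
      unfolding \<C>_def using finite_sub[OF subs(3)] by (auto intro: countable_finite)
    have rng: "range (from_nat_into \<C>) = \<C>" using \<C> by simp
    have cov: "\<Union>\<C> = space (Reuc C) - {origin C}"
    proof (intro set_eqI iffI)
      fix c assume "c \<in> \<Union>\<C>"
      then obtain v n where v: "v \<in> C" "c \<in> L v n" by (auto simp: \<C>_def)
      moreover have "0 \<le> 1 / real (Suc n)" by simp
      ultimately show "c \<in> space (Reuc C) - {origin C}" by (auto simp: L_def origin_def)
    next
      fix c assume "c \<in> space (Reuc C) - {origin C}"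
      then have "c \<in> (\<Union>n. layer C n)" by (simp only: UN_layer)
      then show "c \<in> \<Union>\<C>" by (auto simp: \<C>_def layer_def L_def)
    qed
    have "(LI y. indicator H (r y) * (indicator G (restrict y B) * indicator F (restrict y A))) =
      (LI y. indicator H (r y) * (indicator G (restrict y B) * p (r y)))"
    proof (rule nn_integral_eq_on_cover[where A="from_nat_into \<C>" and N="Reuc C"])
      show "from_nat_into \<C> n \<in> sets (Reuc C)" for n
        using from_nat_into[OF \<C>(2), of n] Lm by (auto simp: \<C>_def)
      fix n T assume T: "T \<in> sets (Reuc C)" "T \<subseteq> from_nat_into \<C> n"
      have "from_nat_into \<C> n \<in> \<C>" by (rule from_nat_into[OF \<C>(2)])
      then consider "T = {}" | v k where "v \<in> C" "T \<subseteq> L v k" using T(2) by (auto simp: \<C>_def)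
      then show "(LI y. indicator T (r y) * (indicator G (restrict y B) * indicator F (restrict y A))) =
        (LI y. indicator T (r y) * (indicator G (restrict y B) * p (r y)))"
        by cases (simp, rule local[OF G T(1)])
    next
      fix x assume "x \<in> space (Reuc C)" "x \<notin> (\<Union>n. from_nat_into \<C> n)"
      then have "x \<in> space (Reuc C)" "x \<notin> space (Reuc C) - {origin C}" unfolding rng cov by auto
      then have "x = origin C" by blast
      then show "indicator H x = (0 :: ennreal)" using H(2) by simp
    qed (use H in measurable)
    then show "(LI y. indicator H (restrict y C) * (indicator G (restrict y B) * indicator F (restrict y A))) =
      (LI y. indicator H (restrict y C) * (indicator G (restrict y B) * p (restrict y C)))"
      by (simp only: r_def)
  qed
qed

theorem admits_partition_iff_factorizes: "admits_partition \<Lambda> A B C \<longleftrightarrow> factorizes \<Lambda> A B C"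
  using factorizes_if_cond_indep_on_test_rectangles cond_indep_on_test_rectangle indep_given_uniform_iff
  unfolding admits_partition_def V[symmetric] by blast

end

section \<open>Marginal measures\<close>

lemma sets_marginal: "sets (marginal D \<Lambda>) = sets (Epunct D)"
proof -
  have "space (Epunct D) = space (Reuc D) - {origin D}" by (auto simp: Epunct_def space_restrict_space)
  then have "Epunct D = restrict_space (Reuc D) (space (Epunct D))" by (simp add: Epunct_def)
  moreover have "sets (marginal D \<Lambda>) = sets (restrict_space (Reuc D) (space (Epunct D)))"
    unfolding marginal_def by (rule sets_restrict_space_cong) (rule sets_distr)
  ultimately show ?thesis by metis
qed

context explosive_measure
begin

text \<open>The condition on \<open>f\<close> compensates that the marginal drops the points with \<open>y\<^sub>D = 0\<close>.\<close>

lemma nn_integral_marginal: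
  assumes D: "D \<subseteq> V" and f [measurable]: "f \<in> borel_measurable (Reuc D)" and f0: "f (origin D) = 0"
  shows "(\<integral>\<^sup>+y. f y \<partial>marginal D \<Lambda>) = (\<integral>\<^sup>+y. f (restrict y D) \<partial>\<Lambda>)"
proof -
  note [measurable] = measurable_restrict_\<Lambda>[OF D] space_Epunct_in_sets[OF finite_sub[OF D]]
  have sp: "space (Epunct D) = space (Reuc D) - {origin D}" by (auto simp: Epunct_def space_restrict_space)
  have "(\<integral>\<^sup>+y. f y \<partial>marginal D \<Lambda>) = (\<integral>\<^sup>+z. f z * indicator (space (Epunct D)) z \<partial>distr \<Lambda> (Reuc D) (\<lambda>y. restrict y D))"
    unfolding marginal_def by (rule nn_integral_restrict_space) simp
  also have "\<dots> = (\<integral>\<^sup>+y. f (restrict y D) * indicator (space (Epunct D)) (restrict y D) \<partial>\<Lambda>)"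
    by (rule nn_integral_distr) measurable
  also have "\<dots> = (\<integral>\<^sup>+y. f (restrict y D) \<partial>\<Lambda>)"
    using f0 by (intro nn_integral_cong) (auto simp: sp indicator_def)
  finally show ?thesis .
qed

text \<open>Local finiteness is inherited since the projection to \<open>D\<close> is continuous. An explosiveness set of the
  marginal for \<open>D'\<close> is the one of \<open>\<Lambda>\<close> for \<open>V - (D - D')\<close>.\<close>

lemma explosive_measure_marginal:
  assumes D: "D \<subseteq> V"
  shows "explosive_measure D (marginal D \<Lambda>)"
proof
  show "finite D" by (rule finite_sub[OF D])
  show "sets (marginal D \<Lambda>) = sets (Epunct D)" by (rule sets_marginal)
next
  fix G assume G: "G \<in> sets (Reuc D)" and cl: "origin D \<notin> Rtop D closure_of G"
  have sp: "space (Epunct D) = space (Reuc D) - {origin D}" by (auto simp: Epunct_def space_restrict_space)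
  have top: "topspace (Rtop D) = space (Reuc D)" by (simp add: space_Reuc)
  have Gsub: "G \<subseteq> space (Reuc D)" using sets.sets_into_space[OF G] .
  then have "G \<subseteq> Rtop D closure_of G" unfolding top[symmetric] by (rule closure_of_subset)
  then have "origin D \<notin> G" using cl by blast
  then have GE: "G \<in> sets (Epunct D)"
    using G Gsub sp space_Epunct_in_sets[OF finite_sub[OF D]]
    by (subst Epunct_def, subst sets_restrict_space_iff) auto
  let ?G = "{y \<in> space (Epunct V). restrict y D \<in> G}"
  have "emeasure \<Lambda> ?G < \<infinity>"
  proof (rule locally_finite)
    show "?G \<in> sets (Reuc V)"
      using sets_restrict_preimage[OF D G] by (simp add: sets_\<Lambda>_iff space_\<Lambda>)
    obtain U where U: "openin (Rtop D) U" "origin D \<in> U" "G \<inter> U = {}"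
      using cl origin_in_space[of D] unfolding in_closure_of top by blast
    have cont: "continuous_map (Rtop V) (Rtop D) (\<lambda>y. restrict y D)"
      unfolding continuous_map_componentwise
    proof (intro conjI ballI)
      fix v assume "v \<in> D"
      then show "continuous_map (Rtop V) euclideanreal (\<lambda>y. restrict y D v)"
        using continuous_map_product_projection[of v V "\<lambda>_. euclideanreal"] D by auto
    qed auto
    define W where "W = {y \<in> topspace (Rtop V). restrict y D \<in> U}"
    have W: "openin (Rtop V) W"
      unfolding W_def by (rule openin_continuous_map_preimage[OF cont U(1)])
    have "restrict (origin V) D = origin D" using D by (subst restrict_eq_origin_iff) (auto simp: origin_def)
    then have oW: "origin V \<in> W"
      using U(2) by (simp add: W_def origin_def)
    show "origin V \<notin> Rtop V closure_of ?G"
    proof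
      assume "origin V \<in> Rtop V closure_of ?G"
      then obtain y where "y \<in> ?G" "y \<in> W"
        using W oW unfolding in_closure_of by blast
      then have "restrict y D \<in> G \<inter> U" by (simp add: W_def del: restrict_apply)
      then show False by (simp only: U(3) empty_iff)
    qed
  qed
  then show "emeasure (marginal D \<Lambda>) G < \<infinity>"
    unfolding emeasure_marginal[OF finite_V sets_\<Lambda> D GE] .
next
  fix D' v assume D': "D' \<subseteq> D" and v: "v \<in> D'"
  have sp: "space (Epunct D) = space (Reuc D) - {origin D}" by (auto simp: Epunct_def space_restrict_space)
  let ?S = "{y \<in> space (Epunct D). y v \<noteq> 0 \<and> restrict y (D - D') = origin (D - D')}"
  have "?S = {y \<in> space (Epunct D). y v \<noteq> 0 \<and> (\<forall>w\<in>D - D'. y w = 0)}" by (simp add: restrict_eq_origin_iff)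
  also have "\<dots> \<in> sets (Epunct D)"
  proof -
    have m: "(\<lambda>y. y w) \<in> borel_measurable (Epunct D)" if "w \<in> D" for w
      using measurable_coord[OF that] unfolding Epunct_def by (rule measurable_restrict_space1)
    note [measurable] = m[of v]
    have "v \<in> D" using v D' by auto
    then have "{y \<in> space (Epunct D). y v \<noteq> 0} \<in> sets (Epunct D)" by measurable
    moreover have "{y \<in> space (Epunct D). \<forall>w\<in>D - D'. y w = 0} \<in> sets (Epunct D)"
    proof (rule sets.sets_Collect_finite_All)
      fix w assume "w \<in> D - D'"
      then have [measurable]: "(\<lambda>y. y w) \<in> borel_measurable (Epunct D)" by (intro m) auto
      show "{y \<in> space (Epunct D). y w = 0} \<in> sets (Epunct D)" by measurable
    qed (use finite_sub[OF D] in auto)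
    ultimately have "{y \<in> space (Epunct D). y v \<noteq> 0} \<inter> {y \<in> space (Epunct D). \<forall>w\<in>D - D'. y w = 0} \<in> sets (Epunct D)"
      by (rule sets.Int)
    moreover have "{y \<in> space (Epunct D). y v \<noteq> 0} \<inter> {y \<in> space (Epunct D). \<forall>w\<in>D - D'. y w = 0} =
      {y \<in> space (Epunct D). y v \<noteq> 0 \<and> (\<forall>w\<in>D - D'. y w = 0)}" by blast
    ultimately show ?thesis by (simp only:)
  qed
  finally have S: "?S \<in> sets (Epunct D)" .
  have "{y \<in> space (Epunct V). restrict y D \<in> ?S} =
      {y \<in> space (Epunct V). y v \<noteq> 0 \<and> restrict y (V - (V - (D - D'))) = origin (V - (V - (D - D')))}"
  proof -
    have 1: "V - (V - (D - D')) = D - D'" using D by auto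
    have 2: "restrict (restrict y D) (D - D') = restrict y (D - D')" for y :: "'v \<Rightarrow> real"
      by (simp add: restrict_restrict Int_absorb1)
    have 3: "restrict y D v = y v" for y :: "'v \<Rightarrow> real" using v D' by auto
    have "restrict y D \<noteq> origin D" if "y v \<noteq> 0" for y using that v D' by (auto simp: restrict_eq_origin_iff)
    then show ?thesis unfolding 1 by (auto simp: 2 3 sp simp del: restrict_apply restrict_restrict)
  qed
  moreover have "emeasure \<Lambda> {y \<in> space (Epunct V). y v \<noteq> 0 \<and> restrict y (V - (V - (D - D'))) = origin (V - (V - (D - D')))} \<in> {0, \<infinity>}"
    using v D' D by (intro explosive) auto
  ultimately show "emeasure (marginal D \<Lambda>) ?S \<in> {0, \<infinity>}"
    unfolding emeasure_marginal[OF finite_V sets_\<Lambda> D S] by simp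
qed

text \<open>Both parts of the property concern sets on which \<open>y\<^sub>D \<noteq> 0\<close>.\<close>

lemma factorizes_marginal_iff:
  assumes D: "D \<subseteq> V" and ABC: "A \<subseteq> D" "B \<subseteq> D" "C \<subseteq> D"
  shows "factorizes (marginal D \<Lambda>) A B C \<longleftrightarrow> factorizes \<Lambda> A B C"
proof -
  interpret m: explosive_measure D "marginal D \<Lambda>" by (rule explosive_measure_marginal[OF D])
  have ABCV: "A \<subseteq> V" "B \<subseteq> V" "C \<subseteq> V" using D ABC by auto
  have rr: "restrict (restrict y D) I = restrict y I" if "I \<subseteq> D" for y :: "'v \<Rightarrow> real" and I
    using that by (simp add: restrict_restrict Int_absorb1)
  have mr: "(\<lambda>y. restrict y I) \<in> Reuc D \<rightarrow>\<^sub>M Reuc I" if "I \<subseteq> D" for I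
    unfolding Reuc_def using that by (rule measurable_restrict_subset)
  note [measurable] = mr[OF ABC(1)] mr[OF ABC(2)] mr[OF ABC(3)] origin_sets[OF m.finite_sub[OF ABC(1)]]
    origin_sets[OF m.finite_sub[OF ABC(2)]] origin_sets[OF m.finite_sub[OF ABC(3)]]
    m.measurable_restrict_\<Lambda>[OF ABC(1)] m.measurable_restrict_\<Lambda>[OF ABC(2)] m.measurable_restrict_\<Lambda>[OF ABC(3)]
    measurable_restrict_\<Lambda>[OF ABCV(1)] measurable_restrict_\<Lambda>[OF ABCV(2)] measurable_restrict_\<Lambda>[OF ABCV(3)]
  have o: "restrict (origin D) I = origin I" if "I \<subseteq> D" for I
    using that by (subst restrict_eq_origin_iff) (auto simp: origin_def)
  have int: "(\<integral>\<^sup>+y. h (restrict y A) (restrict y B) (restrict y C) \<partial>marginal D \<Lambda>) = (\<integral>\<^sup>+y. h (restrict y A) (restrict y B) (restrict y C) \<partial>\<Lambda>)"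
    if "(\<lambda>y. h (restrict y A) (restrict y B) (restrict y C)) \<in> borel_measurable (Reuc D)" and "h (origin A) (origin B) (origin C) = 0" for h
  proof -
    have "(\<integral>\<^sup>+y. h (restrict y A) (restrict y B) (restrict y C) \<partial>marginal D \<Lambda>) =
      (\<integral>\<^sup>+y. h (restrict (restrict y D) A) (restrict (restrict y D) B) (restrict (restrict y D) C) \<partial>\<Lambda>)"
      by (rule nn_integral_marginal[OF D that(1)]) (simp only: o ABC that(2))
    then show ?thesis by (simp only: rr ABC)
  qed
  define N where "N x y z = (indicator {origin C} z * (1 - indicator {origin A} x) * (1 - indicator {origin B} y) :: ennreal)"
    for x y z :: "'v \<Rightarrow> real"
  have null: "emeasure \<mu> {y \<in> space \<mu>. restrict y C = origin C \<and> restrict y A \<noteq> origin A \<and> restrict y B \<noteq> origin B} =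
      (\<integral>\<^sup>+y. N (restrict y A) (restrict y B) (restrict y C) \<partial>\<mu>)"
    if [measurable]: "(\<lambda>y. restrict y A) \<in> \<mu> \<rightarrow>\<^sub>M Reuc A" "(\<lambda>y. restrict y B) \<in> \<mu> \<rightarrow>\<^sub>M Reuc B" "(\<lambda>y. restrict y C) \<in> \<mu> \<rightarrow>\<^sub>M Reuc C" for \<mu> :: "('v \<Rightarrow> real) measure"
  proof -
    let ?S = "{y \<in> space \<mu>. restrict y C \<in> {origin C} \<and> restrict y A \<notin> {origin A} \<and> restrict y B \<notin> {origin B}}"
    have "?S \<in> sets \<mu>" by measurable
    then have "emeasure \<mu> ?S = (\<integral>\<^sup>+y. indicator ?S y \<partial>\<mu>)" by simp
    also have "\<dots> = (\<integral>\<^sup>+y. N (restrict y A) (restrict y B) (restrict y C) \<partial>\<mu>)"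
      by (intro nn_integral_cong) (auto simp: N_def indicator_def)
    finally show ?thesis by simp
  qed
  have "(\<integral>\<^sup>+y. N (restrict y A) (restrict y B) (restrict y C) \<partial>marginal D \<Lambda>) = (\<integral>\<^sup>+y. N (restrict y A) (restrict y B) (restrict y C) \<partial>\<Lambda>)"
  proof (rule int)
    show "(\<lambda>y. N (restrict y A) (restrict y B) (restrict y C)) \<in> borel_measurable (Reuc D)"
      unfolding N_def by measurable
    show "N (origin A) (origin B) (origin C) = 0" by (simp add: N_def)
  qed
  then have 1: "emeasure (marginal D \<Lambda>) {y \<in> space (marginal D \<Lambda>). restrict y C = origin C \<and> restrict y A \<noteq> origin A \<and> restrict y B \<noteq> origin B} =
      emeasure \<Lambda> {y \<in> space \<Lambda>. restrict y C = origin C \<and> restrict y A \<noteq> origin A \<and> restrict y B \<noteq> origin B}"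
    by (subst (1 2) null) measurable
  have 2: "(\<integral>\<^sup>+y. indicator H (restrict y C) * (indicator G (restrict y B) * indicator F (restrict y A)) \<partial>marginal D \<Lambda>) =
      (\<integral>\<^sup>+y. indicator H (restrict y C) * (indicator G (restrict y B) * indicator F (restrict y A)) \<partial>\<Lambda>)"
    if [measurable]: "F \<in> sets (Reuc A)" "G \<in> sets (Reuc B)" "H \<in> sets (Reuc C)" and H0: "origin C \<notin> H" for F G H
    by (rule int[of "\<lambda>x y z. indicator H z * (indicator G y * indicator F x)"]) (measurable, simp add: H0)
  have 3: "(\<integral>\<^sup>+y. indicator H (restrict y C) * (indicator G (restrict y B) * p (restrict y C)) \<partial>marginal D \<Lambda>) =
      (\<integral>\<^sup>+y. indicator H (restrict y C) * (indicator G (restrict y B) * p (restrict y C)) \<partial>\<Lambda>)"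
    if [measurable]: "p \<in> borel_measurable (Reuc C)" "G \<in> sets (Reuc B)" "H \<in> sets (Reuc C)" and H0: "origin C \<notin> H" for p G H
    by (rule int[of "\<lambda>x y z. indicator H z * (indicator G y * p z)"]) (measurable, simp add: H0)
  have "(\<forall>G\<in>sets (Reuc B). \<forall>H\<in>sets (Reuc C). origin C \<notin> H \<longrightarrow>
        (\<integral>\<^sup>+y. indicator H (restrict y C) * (indicator G (restrict y B) * indicator F (restrict y A)) \<partial>marginal D \<Lambda>) =
        (\<integral>\<^sup>+y. indicator H (restrict y C) * (indicator G (restrict y B) * p (restrict y C)) \<partial>marginal D \<Lambda>)) \<longleftrightarrow>
      (\<forall>G\<in>sets (Reuc B). \<forall>H\<in>sets (Reuc C). origin C \<notin> H \<longrightarrow>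
        (\<integral>\<^sup>+y. indicator H (restrict y C) * (indicator G (restrict y B) * indicator F (restrict y A)) \<partial>\<Lambda>) =
        (\<integral>\<^sup>+y. indicator H (restrict y C) * (indicator G (restrict y B) * p (restrict y C)) \<partial>\<Lambda>))"
    if F: "F \<in> sets (Reuc A)" and p: "p \<in> borel_measurable (Reuc C)" for F and p :: "_ \<Rightarrow> ennreal"
    using 2[OF F] 3[OF p] by simp
  then show ?thesis unfolding factorizes_def 1 by simp
qed

end

section \<open>Equivalence of the two notions\<close>

theorem theorem1p2:
  fixes d :: nat and V A B C :: "nat set"
    and \<Lambda> :: "(nat \<Rightarrow> real) measure"
    and M :: "'w measure" and \<xi> :: "'w \<Rightarrow> (nat \<Rightarrow> real) measure"
  assumes "d \<ge> 1" and "V = {1..d}"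
    and "sets \<Lambda> = sets (Epunct V)"
    and "\<And>G. G \<in> sets (Reuc V) \<Longrightarrow> origin V \<notin> Rtop V closure_of G \<Longrightarrow> emeasure \<Lambda> G < \<infinity>"
    and "\<And>D v. D \<subseteq> V \<Longrightarrow> v \<in> D \<Longrightarrow>
           emeasure \<Lambda> {y \<in> space (Epunct V). y v \<noteq> 0 \<and> restrict y (V - D) = origin (V - D)} \<in> {0, \<infinity>}"
    and "prob_space M"
    and "poisson_point_process M (Epunct V) \<Lambda> \<xi>"
    and "A \<subseteq> V" and "B \<subseteq> V" and "C \<subseteq> V"
    and "A \<inter> B = {}" and "A \<inter> C = {}" and "B \<inter> C = {}"
  shows "admits V \<Lambda> A B C \<longleftrightarrow>
         indep_given M (\<lambda>I. Npoint (Reuc I)) (proj_process \<xi>) A B C"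
proof (cases "A = {} \<or> B = {}")
  case True
  then show ?thesis by (auto simp: admits_def admits_partition_def indep_given_def)
next
  case False
  have "finite V" using assms(2) by simp
  then interpret explosive_measure V \<Lambda>
    using assms(3-5) by (simp add: explosive_measure_def)
  interpret poisson_process_on V \<Lambda> M \<xi>
    using explosive_measure_axioms assms(6,7) by (simp add: poisson_process_on_def poisson_process_on_axioms_def)
  let ?D = "A \<union> B \<union> C"
  have D: "?D \<subseteq> V" using assms(8-10) by auto
  have "admits V \<Lambda> A B C \<longleftrightarrow> factorizes \<Lambda> A B C"
  proof (cases "?D = V")
    case True
    interpret partitioned_measure V \<Lambda> A B C
      using True False assms(11-13) by unfold_locales auto
    show ?thesis using True admits_partition_iff_factorizes by (simp add: admits_def)
  next
    case neq: False
    interpret m: explosive_measure ?D "marginal ?D \<Lambda>" by (rule explosive_measure_marginal[OF D])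
    interpret m: partitioned_measure ?D "marginal ?D \<Lambda>" A B C
      using False assms(11-13) by unfold_locales auto
    show ?thesis
      using neq m.admits_partition_iff_factorizes factorizes_marginal_iff[OF D, of A B C] by (auto simp: admits_def)
  qed
  also have "\<dots> \<longleftrightarrow> cond_indep_var M (Npoint (Reuc A)) (proj_process \<xi> A) (Npoint (Reuc B)) (proj_process \<xi> B)
      (Npoint (Reuc C)) (proj_process \<xi> C)"
    using assms(8-10) by (rule poisson_cond_indep_iff_factorizes[symmetric])
  also have "\<dots> \<longleftrightarrow> indep_given M (\<lambda>I. Npoint (Reuc I)) (proj_process \<xi>) A B C"
  proof (cases "C = {}")
    case True
    interpret three_variables M "Npoint (Reuc A)" "proj_process \<xi> A" "Npoint (Reuc B)" "proj_process \<xi> B"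
        "Npoint (Reuc C)" "proj_process \<xi> C"
      using measurable_proj assms(8-10) by unfold_locales auto
    show ?thesis
      using cond_indep_var_trivial proj_process_empty_trivial True False by (simp add: indep_given_def)
  qed (use False in \<open>simp add: indep_given_def\<close>)
  finally show ?thesis .
qed

end
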